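(* Let $N\ge 3$, $s\in(0,1)$, $\alpha\in(0,N)$. Let $F\in C^1(\mathbb{R};\mathbb{R})$ and $f:=F'$, and assume: (i) there is a constant $C>0$ such that $|tf(t)|\le C\big(|t|^{\frac{N+\alpha}{N}}+|t|^{\frac{N+\alpha}{N-2}}\big)$ for all $t\in\mathbb{R}$; (ii) $\lim_{t\to0}\frac{F(t)}{|t|^{\frac{N+\alpha}{N}}}=0=\lim_{|t|\to\infty}\frac{F(t)}{|t|^{\frac{N+\alpha}{N-2}}}$; (iii) there exists $t_0\in\mathbb{R}\setminus\{0\}$ such that $F(t_0)\ne0$; (iv) $f$ is nondecreasing and there exists a constant $\bar k>0$ such that $|f(t)|\le\bar k|t|$ for all $t\in\mathbb{R}$. Let $\{u_n\}_{n\in\mathbb{N}}\subset H^1(\mathbb{R}^N)$ be a sequence with $I(u_n)\to b$, $I'(u_n)\to0$ strongly in the dual space of $H^1(\mathbb{R}^N)$ and $P(u_n)\to0$ as $n\to\infty$, and let $u\in H^1(\mathbb{R}^N)\setminus\{0\}$ be a weak solution of $$-\Delta u+(-\Delta)^s u+u=(I_\alpha*F(u))\,F'(u)\quad\text{in }\mathbb{R}^N$$ obtained from it as the weak limit in $H^1(\mathbb{R}^N)$, along a subsequence, of the translates $u_n(\cdot-y_n)$ for some sequence $\{y_n\}_{n\in\mathbb{N}}\subset\mathbb{R}^N$. Then $u$ is a ground state solution of this equation.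
   Context: $I_\alpha(x)=\frac{A_{N,\alpha}}{|x|^{N-\alpha}}$ for $x\ne0$, with $A_{N,\alpha}=\frac{\Gamma(\frac{N-\alpha}{2})}{\pi^{N/2}2^{\alpha}\Gamma(\frac{\alpha}{2})}$, is the Riesz potential, and $(I_\alpha*F(u))(x)=\int_{\mathbb{R}^N}I_\alpha(x-y)F(u(y))\,dy$. $(-\Delta)^s$ is the fractional Laplacian $(-\Delta)^su(x)=C(N,s)\,\mathrm{P.V.}\int_{\mathbb{R}^N}\frac{u(x)-u(y)}{|x-y|^{N+2s}}dy$, with $C(N,s)=\left(\int_{\mathbb{R}^N}\frac{1-\cos(\zeta_1)}{|\zeta|^{N+2s}}d\zeta\right)^{-1}$. Functions are real-valued, $\|\cdot\|_2$ is the $L^2(\mathbb{R}^N)$ norm, $$\ll u,v\gg:=\frac{C(N,s)}{2}\int_{\mathbb{R}^N}\int_{\mathbb{R}^N}\frac{(u(x)-u(y))(v(x)-v(y))}{|x-y|^{N+2s}}\,dx\,dy,\qquad [u]^2:=\ll u,u\gg,$$ and $H^1(\mathbb{R}^N)$ carries the norm $\|u\|=(\|\nabla u\|_2^2+\|u\|_2^2+[u]^2)^{1/2}$. A function $u\in H^1(\mathbb{R}^N)$ is a weak solution of the equation if for every $v\in H^1(\mathbb{R}^N)$ $$\int_{\mathbb{R}^N}\nabla u\cdot\nabla v\,dx+\ll u,v\gg+\int_{\mathbb{R}^N}uv\,dx=\int_{\mathbb{R}^N}(I_\alpha*F(u))f(u)v\,dx.$$ Put $A(u):=\int_{\mathbb{R}^N}(I_\alpha*F(u))F(u)\,dx$.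 The energy functional is $I(u)=\frac12\|\nabla u\|_2^2+\frac12\|u\|_2^2+\frac12[u]^2-\frac12A(u)$; it is continuously differentiable on $H^1(\mathbb{R}^N)$ and its critical points are the weak solutions. The Pohožaev functional is $$P(u):=\frac{N-2}{2}\|\nabla u\|_2^2+\frac{N-2s}{2}[u]^2+\frac N2\|u\|_2^2-\frac{N+\alpha}{2}A(u).$$ The mountain pass level is $b:=\inf_{\rho\in\Sigma}\sup_{z\in[0,1]}I(\rho(z))$, where $\Sigma=\{\rho\in C([0,1];H^1(\mathbb{R}^N)):\rho(0)=0,\ I(\rho(1))<0\}$. Ground state solution: $u\in H^1(\mathbb{R}^N)\setminus\{0\}$ is a ground state solution if it is a weak solution and $I(u)=m:=\inf\{I(v):v\in H^1(\mathbb{R}^N)\setminus\{0\}\text{ is a weak solution}\}$. *)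

theory Defs
  imports "HOL-Analysis.Analysis"
begin

text \<open>
  Elements of \<open>L\<^sup>2\<close> and \<open>H\<^sup>1\<close> are represented by Borel functions; two functions that agree almost
  everywhere are the same element. In particular, being nonzero in \<open>H\<^sup>1\<close> means not being zero
  almost everywhere. The dimension \<open>N\<close> is \<open>CARD('n)\<close>.
\<close>

section \<open>The Sobolev space\<close>

definition square_integrable :: "(real ^ 'n \<Rightarrow> 'b :: euclidean_space) \<Rightarrow> bool" where
  "square_integrable u \<longleftrightarrow>
     u \<in> borel_measurable lborel \<and> integrable lborel (\<lambda>x. (norm (u x))\<^sup>2)"

definition L2_norm :: "(real ^ 'n \<Rightarrow> 'b :: euclidean_space) \<Rightarrow> real" where
  "L2_norm u = sqrt (LINT x|lborel. (norm (u x))\<^sup>2)"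

definition partial_deriv :: "'n \<Rightarrow> (real ^ 'n \<Rightarrow> real) \<Rightarrow> real ^ 'n \<Rightarrow> real" where
  "partial_deriv i \<phi> x = frechet_derivative \<phi> (at x) (axis i 1)"

primrec C_k :: "nat \<Rightarrow> (real ^ 'n \<Rightarrow> real) \<Rightarrow> bool" where
  "C_k 0 \<phi> \<longleftrightarrow> continuous_on UNIV \<phi>"
| "C_k (Suc k) \<phi> \<longleftrightarrow> (\<forall>x. \<phi> differentiable (at x)) \<and> (\<forall>i. C_k k (partial_deriv i \<phi>))"

definition test_function :: "(real ^ 'n \<Rightarrow> real) \<Rightarrow> bool" where
  "test_function \<phi> \<longleftrightarrow> (\<forall>k. C_k k \<phi>) \<and> compact (closure {x. \<phi> x \<noteq> 0})"

definition weak_gradient :: "(real ^ 'n \<Rightarrow> real) \<Rightarrow> (real ^ 'n \<Rightarrow> real ^ 'n) \<Rightarrow> bool" where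
  "weak_gradient u g \<longleftrightarrow>
     (\<forall>\<phi> i. test_function \<phi> \<longrightarrow>
        (LINT x|lborel. u x * partial_deriv i \<phi> x) = - (LINT x|lborel. g x $ i * \<phi> x))"

definition H1 :: "(real ^ 'n \<Rightarrow> real) set" where
  "H1 = {u. square_integrable u \<and> (\<exists>g. square_integrable g \<and> weak_gradient u g)}"

text \<open>The weak gradient is unique only up to null sets.\<close>

definition grad :: "(real ^ 'n \<Rightarrow> real) \<Rightarrow> real ^ 'n \<Rightarrow> real ^ 'n" where
  "grad u = (SOME g. square_integrable g \<and> weak_gradient u g)"

text \<open>
  The normalising constant \<open>C(N,s)\<close>. An arbitrary finite index type has no designated first
  coordinate; by symmetry the integral does not depend on the chosen one.
\<close>

definition frac_const :: "'n :: finite itself \<Rightarrow> real \<Rightarrow> real" where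
  "frac_const _ s =
     inverse (LINT \<zeta>|lborel. (1 - cos ((\<zeta> :: real ^ 'n) $ (SOME i. True)))
                               / norm \<zeta> powr (real CARD('n) + 2 * s))"

text \<open>
  The integrand is \<open>0\<close> on the null set \<open>x = y\<close>, by division by zero; for \<open>u, v\<close> in \<open>H\<^sup>1\<close> and
  \<open>0 < s < 1\<close> the integral converges absolutely.
\<close>

definition gagliardo_form ::
  "real \<Rightarrow> (real ^ 'n \<Rightarrow> real) \<Rightarrow> (real ^ 'n \<Rightarrow> real) \<Rightarrow> real" where
  "gagliardo_form s u v = frac_const TYPE('n) s / 2 *
     (LINT (x, y)|(lborel \<Otimes>\<^sub>M lborel).
        (u x - u y) * (v x - v y) / norm (x - y) powr (real CARD('n) + 2 * s))"

definition H1_norm :: "real \<Rightarrow> (real ^ 'n \<Rightarrow> real) \<Rightarrow> real" where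
  "H1_norm s u = sqrt ((L2_norm (grad u))\<^sup>2 + (L2_norm u)\<^sup>2 + gagliardo_form s u u)"

definition H1_dual :: "real \<Rightarrow> ((real ^ 'n \<Rightarrow> real) \<Rightarrow> real) set" where
  "H1_dual s = {L.
     (\<forall>u\<in>H1. \<forall>v\<in>H1. L (\<lambda>x. u x + v x) = L u + L v) \<and>
     (\<forall>c. \<forall>u\<in>H1. L (\<lambda>x. c * u x) = c * L u) \<and>
     (\<exists>K. \<forall>u\<in>H1. \<bar>L u\<bar> \<le> K * H1_norm s u)}"

definition H1_dual_norm :: "real \<Rightarrow> ((real ^ 'n \<Rightarrow> real) \<Rightarrow> real) \<Rightarrow> real" where
  "H1_dual_norm s L = Sup {\<bar>L v\<bar> | v. v \<in> H1 \<and> H1_norm s v \<le> 1}"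

definition H1_weakly_converges ::
  "real \<Rightarrow> (nat \<Rightarrow> real ^ 'n \<Rightarrow> real) \<Rightarrow> (real ^ 'n \<Rightarrow> real) \<Rightarrow> bool" where
  "H1_weakly_converges s w u \<longleftrightarrow>
     (\<forall>n. w n \<in> H1) \<and> u \<in> H1 \<and> (\<forall>L\<in>H1_dual s. (\<lambda>n. L (w n)) \<longlonglongrightarrow> L u)"

definition H1_has_derivative ::
  "real \<Rightarrow> ((real ^ 'n \<Rightarrow> real) \<Rightarrow> real) \<Rightarrow> (real ^ 'n \<Rightarrow> real) \<Rightarrow>
    ((real ^ 'n \<Rightarrow> real) \<Rightarrow> real) \<Rightarrow> bool" where
  "H1_has_derivative s J u L \<longleftrightarrow>
     L \<in> H1_dual s \<and>
     (\<forall>\<epsilon>>0. \<exists>\<delta>>0. \<forall>h\<in>H1. H1_norm s h < \<delta> \<longrightarrow>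
        \<bar>J (\<lambda>x. u x + h x) - J u - L h\<bar> \<le> \<epsilon> * H1_norm s h)"

section \<open>The equation and its functionals\<close>

definition riesz_const :: "nat \<Rightarrow> real \<Rightarrow> real" where
  "riesz_const N \<alpha> =
     Gamma ((real N - \<alpha>) / 2) / (pi powr (real N / 2) * 2 powr \<alpha> * Gamma (\<alpha> / 2))"

definition riesz_potential :: "real \<Rightarrow> real ^ 'n \<Rightarrow> real" where
  "riesz_potential \<alpha> x = riesz_const CARD('n) \<alpha> / norm x powr (real CARD('n) - \<alpha>)"

definition riesz_conv :: "real \<Rightarrow> (real ^ 'n \<Rightarrow> real) \<Rightarrow> real ^ 'n \<Rightarrow> real" where
  "riesz_conv \<alpha> g x = (LINT y|lborel. riesz_potential \<alpha> (x - y) * g y)"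

definition weak_solution ::
  "real \<Rightarrow> real \<Rightarrow> (real \<Rightarrow> real) \<Rightarrow> (real \<Rightarrow> real) \<Rightarrow> (real ^ 'n \<Rightarrow> real) \<Rightarrow> bool" where
  "weak_solution s \<alpha> F f u \<longleftrightarrow> u \<in> H1 \<and>
     (\<forall>v\<in>H1.
        (LINT x|lborel. grad u x \<bullet> grad v x) + gagliardo_form s u v + (LINT x|lborel. u x * v x)
        = (LINT x|lborel. riesz_conv \<alpha> (\<lambda>y. F (u y)) x * f (u x) * v x))"

definition choquard_term :: "real \<Rightarrow> (real \<Rightarrow> real) \<Rightarrow> (real ^ 'n \<Rightarrow> real) \<Rightarrow> real" where
  "choquard_term \<alpha> F u = (LINT x|lborel. riesz_conv \<alpha> (\<lambda>y. F (u y)) x * F (u x))"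

definition energy :: "real \<Rightarrow> real \<Rightarrow> (real \<Rightarrow> real) \<Rightarrow> (real ^ 'n \<Rightarrow> real) \<Rightarrow> real" where
  "energy s \<alpha> F u =
     1 / 2 * (L2_norm (grad u))\<^sup>2 + 1 / 2 * (L2_norm u)\<^sup>2 + 1 / 2 * gagliardo_form s u u
     - 1 / 2 * choquard_term \<alpha> F u"

definition pohozaev :: "real \<Rightarrow> real \<Rightarrow> (real \<Rightarrow> real) \<Rightarrow> (real ^ 'n \<Rightarrow> real) \<Rightarrow> real" where
  "pohozaev s \<alpha> F u =
     (real CARD('n) - 2) / 2 * (L2_norm (grad u))\<^sup>2
     + (real CARD('n) - 2 * s) / 2 * gagliardo_form s u u
     + real CARD('n) / 2 * (L2_norm u)\<^sup>2
     - (real CARD('n) + \<alpha>) / 2 * choquard_term \<alpha> F u"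

definition mountain_pass_paths ::
  "real \<Rightarrow> real \<Rightarrow> (real \<Rightarrow> real) \<Rightarrow> (real \<Rightarrow> real ^ 'n \<Rightarrow> real) set" where
  "mountain_pass_paths s \<alpha> F = {\<rho>.
     (\<forall>z\<in>{0..1}. \<rho> z \<in> H1) \<and>
     (\<forall>z\<in>{0..1}. ((\<lambda>w. H1_norm s (\<lambda>x. \<rho> w x - \<rho> z x)) \<longlongrightarrow> 0) (at z within {0..1})) \<and>
     (AE x in lborel. \<rho> 0 x = 0) \<and>
     energy s \<alpha> F (\<rho> 1) < 0}"

text \<open>Infima and suprema are taken in the extended reals, so that no boundedness is presupposed.\<close>

definition mountain_pass_level :: "'n :: finite itself \<Rightarrow> real \<Rightarrow> real \<Rightarrow> (real \<Rightarrow> real) \<Rightarrow> ereal" where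
  "mountain_pass_level _ s \<alpha> F =
     (INF \<rho> \<in> (mountain_pass_paths s \<alpha> F :: (real \<Rightarrow> real ^ 'n \<Rightarrow> real) set).
        SUP z \<in> {0..1}. ereal (energy s \<alpha> F (\<rho> z)))"

definition nontrivial_weak_solutions ::
  "real \<Rightarrow> real \<Rightarrow> (real \<Rightarrow> real) \<Rightarrow> (real \<Rightarrow> real) \<Rightarrow> (real ^ 'n \<Rightarrow> real) set" where
  "nontrivial_weak_solutions s \<alpha> F f =
     {v. weak_solution s \<alpha> F f v \<and> \<not> (AE x in lborel. v x = 0)}"

definition ground_state ::
  "real \<Rightarrow> real \<Rightarrow> (real \<Rightarrow> real) \<Rightarrow> (real \<Rightarrow> real) \<Rightarrow> (real ^ 'n \<Rightarrow> real) \<Rightarrow> bool" where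
  "ground_state s \<alpha> F f u \<longleftrightarrow>
     u \<in> nontrivial_weak_solutions s \<alpha> F f \<and>
     ereal (energy s \<alpha> F u)
       = (INF v \<in> (nontrivial_weak_solutions s \<alpha> F f :: (real ^ 'n \<Rightarrow> real) set).
            ereal (energy s \<alpha> F v))"

end

theory Submission
  imports Defs
begin

text \<open>
  Convexity replaces the Pohozaev identity. As \<open>f = F'\<close> is nondecreasing with \<open>f 0 = 0\<close>, the function
  \<open>F\<close> is convex, and \<open>0 \<le> F t \<le> t f(t)\<close>. Write \<open>A v\<close> for the Choquard term and
  \<open>B v = \<integral> (I\<^sub>\<alpha> * F(v)) f(v) v\<close>. Multiplying the tangent-line bounds at two points gives, for all
  \<open>t \<ge> 0\<close>, the inequality \<open>A(t v) \<ge> A v + (t\<^sup>2 - 1) B v\<close> (\<open>choquard_term_ray\<close>), hence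
  \<open>I(t v) \<le> I v + (t\<^sup>2 - 1)/2 \<cdot> (\<parallel>v\<parallel>\<^sup>2 - B v)\<close>. Everything else is drawn from this.

  \<^item> A weak solution tested with itself gives \<open>\<parallel>v\<parallel>\<^sup>2 = B v\<close>, so \<open>I\<close> attains its maximum along the ray
    through \<open>v\<close> at \<open>v\<close>. Strict convexity in the form \<open>B(2 v) > 4 B v\<close> makes \<open>I\<close> negative far out on the
    ray. The ray is then an admissible path, and the mountain pass level \<open>b\<close> is at most \<open>I v\<close>, for every
    nontrivial weak solution \<open>v\<close> (\<open>mountain_pass_level_le_solution_energy\<close>).

  \<^item> Dividing by \<open>t - 1\<close> from both sides of \<open>t = 1\<close> identifies \<open>I'(v) v = \<parallel>v\<parallel>\<^sup>2 - B v\<close> wherever the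
    derivative exists. Hence \<open>2 I v - I'(v) v = B v - A v\<close> is the double integral of
    \<open>I\<^sub>\<alpha>(x - y) F(v(y)) (f(v(x)) v(x) - F(v(x)))\<close>, which is nonnegative and translation invariant. The
    sequence is bounded in \<open>H\<^sup>1\<close>, because in \<open>I - P/(N + \<alpha>)\<close> the Choquard term cancels and the three
    quadratic terms keep positive coefficients; so \<open>I'(u\<^sub>n) u\<^sub>n\<close> tends to \<open>0\<close>. The weakly convergent
    translates have an almost everywhere convergent subsequence, and Fatou's lemma yields \<open>I u \<le> b\<close>.

  Both halves together give \<open>I u \<le> b \<le> I v\<close> for all nontrivial weak solutions \<open>v\<close>.

  For this to make sense \<open>A\<close> must be finite on \<open>H\<^sup>1\<close>. That is the diagonal Hardy-Littlewood-Sobolev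
  inequality together with the critical Sobolev embedding; the latter is itself deduced from the former
  (with exponent \<open>2\<close>) by duality, from the pointwise bound of \<open>u\<close> by the Riesz potential of
  \<open>\<bar>\<nabla>u\<bar>\<close>. That bound, and the estimate of \<open>u(x + h) - u(x)\<close> in \<open>L\<^sup>2\<close> behind the compactness step, come
  from writing \<open>u(x + h) - u(x)\<close> as the integral of the weak gradient over a segment.
\<close>

section \<open>Power kernels on Euclidean space\<close>

lemma ex_dyadic_scale:
  fixes r :: real
  assumes "1 \<le> r"
  obtains k :: nat where "2 ^ k \<le> r" "r < 2 ^ Suc k"
proof -
  define k where "k = (LEAST k. r < 2 ^ Suc k)"
  obtain n where "r < 2 ^ n" using real_arch_pow[of 2 r] by auto
  hence "r < 2 ^ Suc n" by (rule order.strict_trans2) simp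
  hence k: "r < 2 ^ Suc k" unfolding k_def by (rule LeastI)
  have "2 ^ k \<le> r"
  proof (cases k)
    case 0 thus ?thesis using assms by simp
  next
    case (Suc j)
    hence "\<not> r < 2 ^ Suc j" using not_less_Least[of j "\<lambda>k. r < 2 ^ Suc k"] k_def by auto
    thus ?thesis using Suc by simp
  qed
  thus thesis using k that by blast
qed

lemma dyadic_powr:
  "(2 ^ k) powr a = (2::real) powr (real k * a)"
  "(1 / 2 ^ k) powr a = (2::real) powr (- (real k * a))"
  "(2 ^ k) ^ n = (2::real) powr (real k * real n)"
  "(1 / 2 ^ k) ^ n = (2::real) powr (- (real k * real n))"
proof -
  have two: "(2::real) ^ k = 2 powr real k" by (simp add: powr_realpow)
  have half: "1 / (2::real) ^ k = 2 powr (- real k)" by (simp add: two powr_minus_divide)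
  show 1: "(2 ^ k) powr a = (2::real) powr (real k * a)" for a unfolding two by (simp add: powr_powr)
  show 2: "(1 / 2 ^ k) powr a = (2::real) powr (- (real k * a))" for a unfolding half by (simp add: powr_powr)
  show "(2 ^ k) ^ n = (2::real) powr (real k * real n)"
    using 1[of "real n"] by (simp add: powr_realpow)
  show "(1 / 2 ^ k) ^ n = (2::real) powr (- (real k * real n))"
    using 2[of "real n"] by (simp add: powr_realpow)
qed

lemma ennreal_le_suminf: "f i \<le> (\<Sum>k. f k :: ennreal)"
  using sum_le_suminf[of f "{i}"] by (simp add: summableI)

lemma ball_in_borel [measurable]: "ball (c::'a::euclidean_space) R \<in> sets borel"
  by simp

lemma nn_integral_scale:
  fixes f :: "'a::euclidean_space \<Rightarrow> ennreal" and R :: real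
  assumes [measurable]: "f \<in> borel_measurable borel" and R: "R > 0"
  shows "(\<integral>\<^sup>+z. f z \<partial>lborel) = ennreal (R ^ DIM('a)) * (\<integral>\<^sup>+z. f (R *\<^sub>R z) \<partial>lborel)"
proof -
  have "(\<integral>\<^sup>+z. f z \<partial>lborel)
      = (\<integral>\<^sup>+z. f z \<partial>density (distr lborel borel (\<lambda>x::'a. 0 + R *\<^sub>R x)) (\<lambda>_. ennreal (\<bar>R\<bar> ^ DIM('a))))"
    using lborel_affine[of R "0::'a"] R by simp
  also have "\<dots> = ennreal (R ^ DIM('a)) * (\<integral>\<^sup>+z. f (R *\<^sub>R z) \<partial>lborel)"
    using R by (simp add: nn_integral_density nn_integral_distr nn_integral_cmult)
  finally show ?thesis .
qed

lemma nn_integral_translate: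
  fixes f :: "'a::euclidean_space \<Rightarrow> ennreal"
  assumes [measurable]: "f \<in> borel_measurable borel"
  shows "(\<integral>\<^sup>+x. f (x + a) \<partial>lborel) = (\<integral>\<^sup>+x. f x \<partial>lborel)"
    and "(\<integral>\<^sup>+x. f (a + x) \<partial>lborel) = (\<integral>\<^sup>+x. f x \<partial>lborel)"
    and "(\<integral>\<^sup>+x. f (x - a) \<partial>lborel) = (\<integral>\<^sup>+x. f x \<partial>lborel)"
proof -
  have A: "(\<integral>\<^sup>+x. f (a + x) \<partial>lborel) = (\<integral>\<^sup>+x. f x \<partial>lborel)" for a
  proof -
    have "(\<integral>\<^sup>+x. f x \<partial>lborel) = (\<integral>\<^sup>+x. f x \<partial>distr lborel borel ((+) a))"
      by (simp add: lborel_distr_plus)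
    also have "\<dots> = (\<integral>\<^sup>+x. f (a + x) \<partial>lborel)" by (simp add: nn_integral_distr)
    finally show ?thesis by simp
  qed
  show "(\<integral>\<^sup>+x. f (a + x) \<partial>lborel) = (\<integral>\<^sup>+x. f x \<partial>lborel)" by (rule A)
  show "(\<integral>\<^sup>+x. f (x + a) \<partial>lborel) = (\<integral>\<^sup>+x. f x \<partial>lborel)" using A[of a] by (simp add: add.commute)
  show "(\<integral>\<^sup>+x. f (x - a) \<partial>lborel) = (\<integral>\<^sup>+x. f x \<partial>lborel)" using A[of "-a"] by simp
qed

lemma nn_integral_reflect:
  fixes f :: "'a::euclidean_space \<Rightarrow> ennreal"
  assumes [measurable]: "f \<in> borel_measurable borel"
  shows "(\<integral>\<^sup>+x. f (a - x) \<partial>lborel) = (\<integral>\<^sup>+x. f x \<partial>lborel)"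
proof -
  have "(\<integral>\<^sup>+z. f z \<partial>lborel)
      = (\<integral>\<^sup>+z. f z \<partial>density (distr lborel borel (\<lambda>x::'a. a + (-1) *\<^sub>R x)) (\<lambda>_. ennreal (\<bar>-1\<bar> ^ DIM('a))))"
    using lborel_affine[of "-1" a] by simp
  thus ?thesis by (simp add: nn_integral_density nn_integral_distr)
qed

text \<open>
  A function dominated by a sum of multiples of indicators of balls is integrable as soon as the
  weighted volumes form a geometric series. It is applied to dyadic balls, which avoids polar
  coordinates.
\<close>

lemma geometric_nn_integral_bound:
  fixes f :: "'a::euclidean_space \<Rightarrow> ennreal" and A c :: "nat \<Rightarrow> real"
  assumes le: "\<And>z. f z \<le> (\<Sum>k. ennreal (c k) * indicator (ball 0 (A k)) z)"
    and A: "\<And>k. A k > 0" and c: "\<And>k. c k \<ge> 0"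
    and eq: "\<And>k. c k * A k ^ DIM('a) = K * q ^ k" and q: "0 \<le> q" "q < 1"
  shows "(\<integral>\<^sup>+z. f z \<partial>lborel) < \<infinity>"
proof -
  have K: "K \<ge> 0" using eq[of 0] c[of 0] A[of 0] by (metis less_imp_le mult_nonneg_nonneg power_0 mult_1_right zero_le_power)
  define V where "V = measure lborel (ball (0::'a) 1)"
  have "(\<integral>\<^sup>+z. f z \<partial>lborel) \<le> (\<integral>\<^sup>+z. (\<Sum>k. ennreal (c k) * indicator (ball 0 (A k)) z) \<partial>(lborel :: 'a measure))"
    by (rule nn_integral_mono) (rule le)
  also have "\<dots> = (\<Sum>k. \<integral>\<^sup>+z. ennreal (c k) * indicator (ball 0 (A k)) z \<partial>(lborel :: 'a measure))"
    by (intro nn_integral_suminf) measurable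
  also have "\<dots> = (\<Sum>k. ennreal (V * K * q ^ k))"
  proof (intro suminf_cong)
    fix k
    have "(\<integral>\<^sup>+z. ennreal (c k) * indicator (ball 0 (A k)) z \<partial>(lborel :: 'a measure))
       = ennreal (c k) * emeasure lborel (ball (0::'a) (A k))"
      by (subst nn_integral_cmult) auto
    also have "emeasure lborel (ball (0::'a) (A k)) = ennreal (A k ^ DIM('a) * V)"
      using A[of k] content_ball_conv_unit_ball[of "A k" "0::'a"] emeasure_lborel_ball_finite[of "0::'a" "A k"]
      by (simp add: emeasure_eq_ennreal_measure V_def)
    also have "ennreal (c k) * ennreal (A k ^ DIM('a) * V) = ennreal (V * (c k * A k ^ DIM('a)))"
      using c[of k] A[of k] by (simp add: V_def ennreal_mult[symmetric] mult_ac less_imp_le)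
    finally show "(\<integral>\<^sup>+z. ennreal (c k) * indicator (ball 0 (A k)) z \<partial>(lborel :: 'a measure)) = ennreal (V * K * q ^ k)"
      by (simp add: eq mult_ac)
  qed
  also have "\<dots> = ennreal (\<Sum>k. V * K * q ^ k)"
    using q K by (intro suminf_ennreal2) (auto simp: V_def intro!: summable_mult summable_geometric)
  finally show ?thesis by (simp add: le_less_trans)
qed

text \<open>
  Scaling reduces the radius to \<open>1\<close>, so only finiteness has to be shown: on the
  shell \<open>2\<^sup>-\<^sup>k\<^sup>-\<^sup>1 \<le> \<bar>z\<bar> < 2\<^sup>-\<^sup>k\<close>
  the integrand is at most \<open>2\<close> to the power \<open>(k + 1)(N - \<beta>)\<close>,
  and the volume compensates up to a factor \<open>2\<^sup>-\<^sup>\<beta>\<^sup>k\<close>.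
\<close>

lemma powr_kernel_near:
  fixes \<beta> :: real
  assumes \<beta>: "0 < \<beta>" "\<beta> < DIM('a::euclidean_space)"
  obtains C where "C \<ge> 0"
    "\<And>R. R > 0 \<Longrightarrow> (\<integral>\<^sup>+z. ennreal (indicator (ball 0 R) z * norm (z::'a) powr (\<beta> - DIM('a))) \<partial>lborel)
        = ennreal (C * R powr \<beta>)"
proof -
  let ?f = "\<lambda>R z. ennreal (indicator (ball 0 R) z * norm (z::'a) powr (\<beta> - DIM('a)))"
  define J where "J = (\<integral>\<^sup>+z. ?f 1 z \<partial>lborel)"
  let ?\<gamma> = "DIM('a) - \<beta>"
  have "J < \<infinity>" unfolding J_def
  proof (rule geometric_nn_integral_bound[where c="\<lambda>k. 2 powr (real (k + 1) * ?\<gamma>)" and A="\<lambda>k. 1 / 2 ^ k" and K="2 powr ?\<gamma>" and q="2 powr (-\<beta>)"])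
    fix z :: 'a
    show "?f 1 z \<le> (\<Sum>k. ennreal (2 powr (real (k + 1) * ?\<gamma>)) * indicator (ball 0 (1 / 2 ^ k)) z)"
    proof (cases "z \<in> ball 0 1 \<and> z \<noteq> 0")
      case True
      hence "1 \<le> 1 / norm z" by auto
      then obtain k where k: "2 ^ k \<le> 1 / norm z" "1 / norm z < 2 ^ Suc k" by (rule ex_dyadic_scale)
      have nz: "norm z > 0" using True by simp
      have z1: "norm z \<le> 1 / 2 ^ k" using k nz by (simp add: field_simps)
      have z2: "norm z > 1 / 2 ^ Suc k" using k nz by (simp add: field_simps)
      obtain j where j: "z \<in> ball 0 (1 / 2 ^ j)" "1 / 2 ^ Suc j \<le> norm z"
      proof (cases "norm z = 1 / 2 ^ k")
        case True2: True
        then obtain i where "k = Suc i" using True by (cases k) auto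
        hence "norm z < 1 / 2 ^ i" "1 / 2 ^ Suc i \<le> norm z" using True2 by (simp_all add: field_simps)
        thus ?thesis using that[of i] by simp
      next
        case False thus ?thesis using that[of k] z1 z2 by simp
      qed
      have "norm z powr (\<beta> - DIM('a)) \<le> (1 / 2 ^ Suc j) powr (\<beta> - DIM('a))"
        using j \<beta> by (intro powr_mono2') auto
      also have "\<dots> = 2 powr (real (j + 1) * ?\<gamma>)"
        by (simp only: dyadic_powr, rule arg_cong[where f="\<lambda>x. 2 powr x"]) (simp add: algebra_simps)
      finally have le: "?f 1 z \<le> ennreal (2 powr (real (j + 1) * ?\<gamma>)) * indicator (ball 0 (1 / 2 ^ j)) z"
        using j(1) True by (simp add: ennreal_leI)
      also have "\<dots> \<le> (\<Sum>k. ennreal (2 powr (real (k + 1) * ?\<gamma>)) * indicator (ball 0 (1 / 2 ^ k)) z)"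
        by (rule ennreal_le_suminf[of "\<lambda>k. ennreal (2 powr (real (k + 1) * ?\<gamma>)) * indicator (ball 0 (1 / 2 ^ k)) z" j])
      finally show ?thesis .
    next
      case False
      hence e: "?f 1 z = 0" by (auto simp: indicator_def)
      show ?thesis unfolding e by simp
    qed
  next
    fix k :: nat
    have "2 powr (real (k + 1) * ?\<gamma>) * (1 / 2 ^ k) ^ DIM('a) = 2 powr (real (k+1) * ?\<gamma>) * 2 powr (- real k * DIM('a))"
      by (simp only: dyadic_powr) simp
    also have "\<dots> = 2 powr (real (k+1) * ?\<gamma> - real k * DIM('a))" by (simp add: powr_add[symmetric])
    also have "real (k+1) * ?\<gamma> - real k * DIM('a) = ?\<gamma> + (-\<beta>) * k" by (simp add: algebra_simps)
    also have "2 powr \<dots> = 2 powr ?\<gamma> * (2 powr (-\<beta>)) ^ k"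
      by (simp only: powr_add powr_powr[symmetric]) (simp add: powr_realpow)
    finally show "2 powr (real (k + 1) * ?\<gamma>) * (1 / 2 ^ k) ^ DIM('a) = 2 powr ?\<gamma> * (2 powr (-\<beta>)) ^ k" .
  next
    show "2 powr (-\<beta>) < 1" using powr_less_mono[of "-\<beta>" 0 2] \<beta> by simp
  qed simp_all
  then obtain C where C: "C \<ge> 0" "J = ennreal C" by (cases J) auto
  show thesis
  proof
    show "C \<ge> 0" by fact
    fix R :: real assume R: "R > 0"
    have "(\<integral>\<^sup>+z. ?f R z \<partial>lborel) = ennreal (R ^ DIM('a)) * (\<integral>\<^sup>+z. ?f R (R *\<^sub>R z) \<partial>lborel)"
      by (rule nn_integral_scale[OF _ R]) measurable
    also have "(\<lambda>z::'a. ?f R (R *\<^sub>R z)) = (\<lambda>z. ennreal (R powr (\<beta> - DIM('a))) * ?f 1 z)"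
      using R by (auto simp: fun_eq_iff indicator_def powr_mult ennreal_mult)
    also have "(\<integral>\<^sup>+z. ennreal (R powr (\<beta> - DIM('a))) * ?f 1 z \<partial>lborel) = ennreal (R powr (\<beta> - DIM('a))) * J"
      unfolding J_def by (rule nn_integral_cmult) measurable
    also have "ennreal (R ^ DIM('a)) * (ennreal (R powr (\<beta> - DIM('a))) * J) = ennreal (C * R powr \<beta>)"
      using R C by (simp add: ennreal_mult[symmetric] powr_realpow[symmetric] powr_add[symmetric] mult.left_commute[of _ C] mult.commute[of _ C])
    finally show "(\<integral>\<^sup>+z. ?f R z \<partial>lborel) = ennreal (C * R powr \<beta>)" .
  qed
qed

lemma powr_kernel_far:
  fixes \<beta> :: real
  assumes \<beta>: "0 < \<beta>"
  obtains C where "C \<ge> 0"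
    "\<And>R. R > 0 \<Longrightarrow> (\<integral>\<^sup>+z. ennreal (indicator (- ball 0 R) z * norm (z::'a::euclidean_space) powr (- real DIM('a) - \<beta>)) \<partial>lborel)
        = ennreal (C * R powr (-\<beta>))"
proof -
  let ?f = "\<lambda>R z. ennreal (indicator (- ball 0 R) z * norm (z::'a) powr (- real DIM('a) - \<beta>))"
  define J where "J = (\<integral>\<^sup>+z. ?f 1 z \<partial>lborel)"
  let ?\<gamma> = "DIM('a) + \<beta>"
  have "J < \<infinity>" unfolding J_def
  proof (rule geometric_nn_integral_bound[where c="\<lambda>k. 2 powr (- real k * ?\<gamma>)" and A="\<lambda>k. 2 ^ Suc k" and K="2 powr DIM('a)" and q="2 powr (-\<beta>)"])
    fix z :: 'a
    show "?f 1 z \<le> (\<Sum>k. ennreal (2 powr (- real k * ?\<gamma>)) * indicator (ball 0 (2 ^ Suc k)) z)"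
    proof (cases "norm z \<ge> 1")
      case True
      then obtain j where j: "2 ^ j \<le> norm z" "norm z < 2 ^ Suc j" by (rule ex_dyadic_scale)
      have "norm z powr (- real DIM('a) - \<beta>) \<le> (2 ^ j) powr (- real DIM('a) - \<beta>)"
        using j \<beta> by (intro powr_mono2') auto
      also have "\<dots> = 2 powr (- real j * ?\<gamma>)"
        by (simp only: dyadic_powr, rule arg_cong[where f="\<lambda>x. 2 powr x"]) (simp add: algebra_simps)
      finally have le: "?f 1 z \<le> ennreal (2 powr (- real j * ?\<gamma>)) * indicator (ball 0 (2 ^ Suc j)) z"
        using j True by (simp add: ennreal_leI del: power_Suc)
      also have "\<dots> \<le> (\<Sum>k. ennreal (2 powr (- real k * ?\<gamma>)) * indicator (ball 0 (2 ^ Suc k)) z)"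
        by (rule ennreal_le_suminf[of "\<lambda>k. ennreal (2 powr (- real k * ?\<gamma>)) * indicator (ball 0 (2 ^ Suc k)) z" j])
      finally show ?thesis .
    next
      case False
      hence e: "?f 1 z = 0" by (auto simp: indicator_def)
      show ?thesis unfolding e by simp
    qed
  next
    fix k :: nat
    have "2 powr (- real k * ?\<gamma>) * (2 ^ Suc k) ^ DIM('a) = 2 powr (- real k * ?\<gamma>) * 2 powr (real (k+1) * DIM('a))"
      by (simp only: dyadic_powr) simp
    also have "\<dots> = 2 powr (- real k * ?\<gamma> + real (k+1) * DIM('a))" by (simp add: powr_add[symmetric])
    also have "- real k * ?\<gamma> + real (k+1) * DIM('a) = DIM('a) + (-\<beta>) * k" by (simp add: algebra_simps)
    also have "2 powr \<dots> = 2 powr DIM('a) * (2 powr (-\<beta>)) ^ k"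
      by (simp only: powr_add powr_powr[symmetric]) (simp add: powr_realpow)
    finally show "2 powr (- real k * ?\<gamma>) * (2 ^ Suc k) ^ DIM('a) = 2 powr DIM('a) * (2 powr (-\<beta>)) ^ k" .
  next
    show "2 powr (-\<beta>) < 1" using powr_less_mono[of "-\<beta>" 0 2] \<beta> by simp
  qed simp_all
  then obtain C where C: "C \<ge> 0" "J = ennreal C" by (cases J) auto
  show thesis
  proof
    show "C \<ge> 0" by fact
    fix R :: real assume R: "R > 0"
    have "(\<integral>\<^sup>+z. ?f R z \<partial>lborel) = ennreal (R ^ DIM('a)) * (\<integral>\<^sup>+z. ?f R (R *\<^sub>R z) \<partial>lborel)"
      by (rule nn_integral_scale[OF _ R]) measurable
    also have "(\<lambda>z::'a. ?f R (R *\<^sub>R z)) = (\<lambda>z. ennreal (R powr (- real DIM('a) - \<beta>)) * ?f 1 z)"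
      using R by (auto simp: fun_eq_iff indicator_def powr_mult ennreal_mult)
    also have "(\<integral>\<^sup>+z. ennreal (R powr (- real DIM('a) - \<beta>)) * ?f 1 z \<partial>lborel) = ennreal (R powr (- real DIM('a) - \<beta>)) * J"
      unfolding J_def by (rule nn_integral_cmult) measurable
    also have "ennreal (R ^ DIM('a)) * (ennreal (R powr (- real DIM('a) - \<beta>)) * J) = ennreal (C * R powr (-\<beta>))"
      using R C by (simp add: ennreal_mult[symmetric] powr_realpow[symmetric] powr_add[symmetric] mult.left_commute[of _ C] mult.commute[of _ C])
    finally show "(\<integral>\<^sup>+z. ?f R z \<partial>lborel) = ennreal (C * R powr (-\<beta>))" .
  qed
qed

section \<open>The diagonal Hardy-Littlewood-Sobolev inequality\<close>

lemma ennreal_sum_of_three_products: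
  assumes "0 \<le> a" "0 \<le> a'" "0 \<le> b" "0 \<le> b'" "0 \<le> c" "0 \<le> c'"
  shows "ennreal (a * a' + (b * b' + c * c'))
    = ennreal a * ennreal a' + (ennreal b * ennreal b' + ennreal c * ennreal c')"
  using assms by (simp add: ennreal_mult)

text \<open>
  Hedberg's splitting, without the maximal function. Within distance \<open>R\<close> the factor
  \<open>g\<close> is replaced by its upper bound \<open>a\<close>; beyond \<open>R\<close>,
  Young's inequality separates \<open>g\<close> from the kernel, whose power \<open>q'\<close>
  is \<open>\<bar>z\<bar>\<close> to the power \<open>-2N\<close> and integrable there. The
  restriction to \<open>g \<le> a\<close> costs nothing in the double integral, by symmetry.
\<close>

lemma Riesz_kernel_below_level:
  fixes \<alpha> :: real
  defines "q \<equiv> 2 * real DIM('a::euclidean_space) / (real DIM('a) + \<alpha>)"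
  assumes \<alpha>: "0 < \<alpha>" "\<alpha> < DIM('a)"
  obtains C where "C \<ge> 0"
    "\<And>(g :: 'a \<Rightarrow> real) x a. g \<in> borel_measurable borel \<Longrightarrow> (\<And>y. 0 \<le> g y) \<Longrightarrow>
       (\<integral>\<^sup>+y. ennreal (g y powr q) \<partial>lborel) \<le> 1 \<Longrightarrow> 0 < a \<Longrightarrow>
       (\<integral>\<^sup>+y. ennreal (norm (x - y) powr (\<alpha> - DIM('a)) * g y) * indicator {y. g y \<le> a} y \<partial>lborel)
         \<le> ennreal (C * a powr (q - 1))"
proof -
  let ?N = "real DIM('a)"
  have N0: "?N > 0" by simp
  define q' where "q' = 2 * ?N / (?N - \<alpha>)"
  have q1: "q > 1" using \<alpha> by (simp add: q_def field_simps)
  have q'1: "q' > 1" using \<alpha> by (simp add: q'_def field_simps)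
  have qq: "1 / q + 1 / q' = 1" using \<alpha> N0 by (simp add: q_def q'_def field_simps)
  have qm: "q - 1 = (?N - \<alpha>) / (?N + \<alpha>)" using \<alpha> by (simp add: q_def field_simps)
  obtain C1 where C1: "C1 \<ge> 0" "\<And>R. R > 0 \<Longrightarrow>
      (\<integral>\<^sup>+z. ennreal (indicator (ball 0 R) z * norm (z::'a) powr (\<alpha> - ?N)) \<partial>lborel) = ennreal (C1 * R powr \<alpha>)"
    apply (rule powr_kernel_near[OF \<alpha>])
    subgoal premises p by (rule p(1)[OF p(2,3)])
    done
  obtain C2 where C2: "C2 \<ge> 0" "\<And>R. R > 0 \<Longrightarrow>
      (\<integral>\<^sup>+z. ennreal (indicator (- ball 0 R) z * norm (z::'a) powr (- ?N - ?N)) \<partial>lborel) = ennreal (C2 * R powr (- ?N))"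
    apply (rule powr_kernel_far[OF N0, where 'a='a])
    subgoal premises p by (rule p(1)[OF p(2,3)])
    done
  show thesis
  proof
    show "C1 + (1 + C2) \<ge> 0" using C1 C2 by simp
    fix g :: "'a \<Rightarrow> real" and x :: 'a and a :: real
    assume g[measurable]: "g \<in> borel_measurable borel" and g0: "\<And>y. 0 \<le> g y"
      and g1: "(\<integral>\<^sup>+y. ennreal (g y powr q) \<partial>lborel) \<le> 1" and a: "0 < a"
    \<comment> \<open>The radius and the Young weight for which all three contributions are multiples of
        \<open>a\<close> to the power \<open>q - 1\<close>.\<close>
    define R where "R = a powr (- 2 / (?N + \<alpha>))"
    define \<kappa> where "\<kappa> = a powr (q - 1)"
    have R: "R > 0" and \<kappa>: "\<kappa> > 0" using a by (auto simp: R_def \<kappa>_def)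
    have e1: "a * R powr \<alpha> = \<kappa>"
    proof -
      have "a * R powr \<alpha> = a powr 1 * a powr (- 2 * \<alpha> / (?N + \<alpha>))"
        using a by (simp add: R_def powr_powr)
      also have "\<dots> = a powr (1 + - 2 * \<alpha> / (?N + \<alpha>))" by (rule powr_add[symmetric])
      also have "1 + - 2 * \<alpha> / (?N + \<alpha>) = q - 1" using \<alpha> by (simp add: qm field_simps)
      finally show ?thesis by (simp add: \<kappa>_def)
    qed
    have e2: "\<kappa> powr (- q') * R powr (- ?N) = 1"
    proof -
      have "\<kappa> powr (- q') * R powr (- ?N) = a powr ((q - 1) * - q' + (- 2 / (?N + \<alpha>)) * - ?N)"
        by (simp only: R_def \<kappa>_def powr_powr powr_add)
      also have "(q - 1) * - q' + (- 2 / (?N + \<alpha>)) * - ?N = 0"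
      proof -
        have "(q - 1) * q' = 2 * ?N / (?N + \<alpha>)" unfolding qm q'_def using \<alpha> by simp
        thus ?thesis by (simp add: field_simps)
      qed
      finally show ?thesis using a by simp
    qed
    let ?k = "\<lambda>z. norm (z::'a) powr (\<alpha> - ?N)"
    let ?n = "\<lambda>z. indicator (ball 0 R) z * norm (z::'a) powr (\<alpha> - ?N)"
    let ?h = "\<lambda>z. indicator (- ball 0 R) z * norm (z::'a) powr (- ?N - ?N)"
    have pw: "ennreal (?k (x - y) * g y) * indicator {y. g y \<le> a} y
        \<le> ennreal a * ennreal (?n (x - y)) + (ennreal \<kappa> * ennreal (g y powr q)
            + ennreal (\<kappa> * \<kappa> powr (- q')) * ennreal (?h (x - y)))" for y
    proof (cases "g y \<le> a")
      case True
      have "?k (x - y) * g y \<le> a * ?n (x - y) + (\<kappa> * g y powr q + \<kappa> * \<kappa> powr (- q') * ?h (x - y))"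
      proof (cases "x - y \<in> ball 0 R")
        case inside: True
        have "?k (x - y) * g y \<le> a * ?n (x - y)"
          using inside True by (simp add: mult.commute mult_right_mono)
        thus ?thesis using \<kappa> by (simp add: add_increasing2 inside)
      next
        case False
        let ?b = "?k (x - y) / \<kappa>"
        have b: "?b \<ge> 0" using \<kappa> by simp
        have "g y * ?b \<le> g y powr q / q + ?b powr q' / q'"
          by (rule Youngs_inequality[OF q1 q'1 qq g0 b])
        also have "\<dots> \<le> g y powr q + ?b powr q'"
          using q1 q'1 by (intro add_mono) (auto simp: divide_le_eq mult_le_cancel_left1)
        also have "?b powr q' = \<kappa> powr (- q') * ?k (x - y) powr q'"
          using \<kappa> by (simp add: powr_divide powr_minus_divide)
        also have "?k (x - y) powr q' = norm (x - y) powr (- ?N - ?N)"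
        proof -
          have "(\<alpha> - ?N) * q' = - ?N - ?N" using \<alpha> by (simp add: q'_def field_simps)
          thus ?thesis by (simp only: powr_powr)
        qed
        finally have "\<kappa> * (g y * ?b) \<le> \<kappa> * (g y powr q + \<kappa> powr (- q') * norm (x - y) powr (- ?N - ?N))"
          using \<kappa> by (intro mult_left_mono) auto
        moreover have "\<kappa> * (g y * ?b) = ?k (x - y) * g y" using \<kappa> by simp
        ultimately show ?thesis using False by (simp add: algebra_simps)
      qed
      hence "ennreal (?k (x - y) * g y) \<le> ennreal (a * ?n (x - y) + (\<kappa> * g y powr q + \<kappa> * \<kappa> powr (- q') * ?h (x - y)))"
        by (rule ennreal_leI)
      also have "\<dots> = ennreal a * ennreal (?n (x - y)) + (ennreal \<kappa> * ennreal (g y powr q)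
            + ennreal (\<kappa> * \<kappa> powr (- q')) * ennreal (?h (x - y)))"
        using a \<kappa> by (intro ennreal_sum_of_three_products) auto
      finally show ?thesis using True by simp
    qed simp
    have "(\<integral>\<^sup>+y. ennreal (?k (x - y) * g y) * indicator {y. g y \<le> a} y \<partial>lborel)
      \<le> (\<integral>\<^sup>+y. ennreal a * ennreal (?n (x - y)) + (ennreal \<kappa> * ennreal (g y powr q)
            + ennreal (\<kappa> * \<kappa> powr (- q')) * ennreal (?h (x - y))) \<partial>lborel)"
      by (rule nn_integral_mono) (rule pw)
    also have "\<dots> = ennreal a * (\<integral>\<^sup>+y. ennreal (?n (x - y)) \<partial>lborel)
        + (ennreal \<kappa> * (\<integral>\<^sup>+y. ennreal (g y powr q) \<partial>lborel)
           + ennreal (\<kappa> * \<kappa> powr (- q')) * (\<integral>\<^sup>+y. ennreal (?h (x - y)) \<partial>lborel))"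
      by (subst nn_integral_add, measurable)+ (simp add: nn_integral_cmult)
    also have "(\<integral>\<^sup>+y. ennreal (?n (x - y)) \<partial>lborel) = ennreal (C1 * R powr \<alpha>)"
      unfolding C1(2)[OF R, symmetric]
      by (rule nn_integral_reflect[where f="\<lambda>z. ennreal (?n z)"]) measurable
    also have "(\<integral>\<^sup>+y. ennreal (?h (x - y)) \<partial>lborel) = ennreal (C2 * R powr (- ?N))"
      unfolding C2(2)[OF R, symmetric]
      by (rule nn_integral_reflect[where f="\<lambda>z. ennreal (?h z)"]) measurable
    also have "ennreal a * ennreal (C1 * R powr \<alpha>) = ennreal (C1 * \<kappa>)"
      using e1 a C1 by (simp add: ennreal_mult[symmetric] mult.left_commute)
    also have "ennreal (\<kappa> * \<kappa> powr (- q')) * ennreal (C2 * R powr (- ?N)) = ennreal (C2 * \<kappa>)"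
    proof -
      have "\<kappa> * \<kappa> powr (- q') * (C2 * R powr (- ?N)) = C2 * \<kappa> * (\<kappa> powr (- q') * R powr (- ?N))" by simp
      thus ?thesis using C2 \<kappa> by (simp only: e2 ennreal_mult[symmetric]) (simp add: ennreal_mult[symmetric] e2)
    qed
    also have "ennreal (C1 * \<kappa>) + (ennreal \<kappa> * (\<integral>\<^sup>+y. ennreal (g y powr q) \<partial>lborel) + ennreal (C2 * \<kappa>))
       \<le> ennreal (C1 * \<kappa>) + (ennreal \<kappa> * 1 + ennreal (C2 * \<kappa>))"
      by (intro add_mono mult_left_mono g1) auto
    also have "\<dots> = ennreal ((C1 + (1 + C2)) * a powr (q - 1))"
      using C1 C2 \<kappa> by (simp add: \<kappa>_def[symmetric] ennreal_plus[symmetric] algebra_simps del: ennreal_plus)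
    finally show "(\<integral>\<^sup>+y. ennreal (norm (x - y) powr (\<alpha> - DIM('a)) * g y) * indicator {y. g y \<le> a} y \<partial>lborel)
         \<le> ennreal ((C1 + (1 + C2)) * a powr (q - 1))" .
  qed
qed

text \<open>
  By symmetry half of the double integral lives on the pairs with \<open>g y \<le> g x\<close>.
  There the preceding lemma with \<open>a = g x\<close> bounds the inner integral by a multiple
  of \<open>g x\<close> to the power \<open>q - 1\<close>, which leaves the integral of
  \<open>g\<^sup>q\<close>. Homogeneity reduces general \<open>M\<close> to \<open>M =
  1\<close>.
\<close>

theorem Hardy_Littlewood_Sobolev_diagonal:
  fixes \<alpha> :: real
  defines "q \<equiv> 2 * real DIM('a::euclidean_space) / (real DIM('a) + \<alpha>)"
  assumes \<alpha>: "0 < \<alpha>" "\<alpha> < DIM('a)"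
  obtains C where "C \<ge> 0"
    "\<And>(g :: 'a \<Rightarrow> real) M. g \<in> borel_measurable borel \<Longrightarrow> (\<And>y. 0 \<le> g y) \<Longrightarrow> 0 < M \<Longrightarrow>
       (\<integral>\<^sup>+y. ennreal (g y powr q) \<partial>lborel) \<le> ennreal M \<Longrightarrow>
       (\<integral>\<^sup>+x. \<integral>\<^sup>+y. ennreal (norm (x - y) powr (\<alpha> - DIM('a)) * g x * g y) \<partial>lborel \<partial>lborel)
         \<le> ennreal (C * M powr (2 / q))"
proof -
  let ?k = "\<lambda>z. norm (z::'a) powr (\<alpha> - DIM('a))"
  have q1: "q > 1" using \<alpha> by (simp add: q_def field_simps)
  obtain C where C: "C \<ge> 0"
    "\<And>(g :: 'a \<Rightarrow> real) x a. g \<in> borel_measurable borel \<Longrightarrow> (\<And>y. 0 \<le> g y) \<Longrightarrow>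
       (\<integral>\<^sup>+y. ennreal (g y powr q) \<partial>lborel) \<le> 1 \<Longrightarrow> 0 < a \<Longrightarrow>
       (\<integral>\<^sup>+y. ennreal (?k (x - y) * g y) * indicator {y. g y \<le> a} y \<partial>lborel)
         \<le> ennreal (C * a powr (q - 1))"
    apply (rule Riesz_kernel_below_level[OF \<alpha>, folded q_def])
    subgoal premises p by (rule p(1)[OF p(2,3)])
    done
  have unit: "(\<integral>\<^sup>+x. \<integral>\<^sup>+y. ennreal (?k (x - y) * g x * g y) \<partial>lborel \<partial>lborel) \<le> ennreal (2 * C)"
    if g[measurable]: "g \<in> borel_measurable borel" and g0: "\<And>y. 0 \<le> g y"
      and g1: "(\<integral>\<^sup>+y. ennreal (g y powr q) \<partial>lborel) \<le> 1" for g :: "'a \<Rightarrow> real"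
  proof -
    let ?T = "\<lambda>x y. ennreal (?k (x - y) * g x * g y) * indicator {y. g y \<le> g x} y"
    let ?T' = "\<lambda>x y. ennreal (?k (x - y) * g x * g y) * indicator {y. g x \<le> g y} y"
    have mT: "(\<lambda>(x, y). ?T x y) \<in> borel_measurable (borel \<Otimes>\<^sub>M borel)"
      and mT': "(\<lambda>(x, y). ?T' x y) \<in> borel_measurable (borel \<Otimes>\<^sub>M borel)"
      unfolding indicator_def by (simp_all add: split_beta')
    note mT[measurable] mT'[measurable]
    have "(\<integral>\<^sup>+x. \<integral>\<^sup>+y. ennreal (?k (x - y) * g x * g y) \<partial>lborel \<partial>lborel)
        \<le> (\<integral>\<^sup>+x. \<integral>\<^sup>+y. ?T x y + ?T' x y \<partial>lborel \<partial>lborel)"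
      by (intro nn_integral_mono) (auto simp: indicator_def)
    also have "\<dots> = (\<integral>\<^sup>+x. (\<integral>\<^sup>+y. ?T x y \<partial>lborel) + (\<integral>\<^sup>+y. ?T' x y \<partial>lborel) \<partial>lborel)"
      by (intro nn_integral_cong nn_integral_add) measurable
    also have "\<dots> = (\<integral>\<^sup>+x. \<integral>\<^sup>+y. ?T x y \<partial>lborel \<partial>lborel) + (\<integral>\<^sup>+x. \<integral>\<^sup>+y. ?T' x y \<partial>lborel \<partial>lborel)"
      by (intro nn_integral_add) measurable
    also have "(\<integral>\<^sup>+x. \<integral>\<^sup>+y. ?T' x y \<partial>lborel \<partial>lborel) = (\<integral>\<^sup>+y. \<integral>\<^sup>+x. ?T' x y \<partial>lborel \<partial>lborel)"
      by (rule lborel_pair.Fubini'[symmetric]) measurable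
    also have "\<dots> = (\<integral>\<^sup>+x. \<integral>\<^sup>+y. ?T x y \<partial>lborel \<partial>lborel)"
      by (intro nn_integral_cong) (auto simp: indicator_def norm_minus_commute mult_ac)
    also have "(\<integral>\<^sup>+x. \<integral>\<^sup>+y. ?T x y \<partial>lborel \<partial>lborel) \<le> (\<integral>\<^sup>+x. ennreal C * ennreal (g x powr q) \<partial>lborel)"
    proof (rule nn_integral_mono)
      fix x
      show "(\<integral>\<^sup>+y. ?T x y \<partial>lborel) \<le> ennreal C * ennreal (g x powr q)"
      proof (cases "g x = 0")
        case True thus ?thesis by simp
      next
        case False
        hence gx: "g x > 0" using g0[of x] by simp
        have "(\<integral>\<^sup>+y. ?T x y \<partial>lborel)
            = (\<integral>\<^sup>+y. ennreal (g x) * (ennreal (?k (x - y) * g y) * indicator {y. g y \<le> g x} y) \<partial>lborel)"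
          using g0 by (intro nn_integral_cong) (auto simp: indicator_def ennreal_mult[symmetric] mult_ac)
        also have "\<dots> = ennreal (g x) * (\<integral>\<^sup>+y. ennreal (?k (x - y) * g y) * indicator {y. g y \<le> g x} y \<partial>lborel)"
          by (rule nn_integral_cmult) measurable
        also have "\<dots> \<le> ennreal (g x) * ennreal (C * g x powr (q - 1))"
          by (intro mult_left_mono C(2) g g0 g1 gx) auto
        also have "\<dots> = ennreal (C * (g x powr 1 * g x powr (q - 1)))"
          using gx C(1) by (simp add: ennreal_mult[symmetric] mult_ac)
        also have "g x powr 1 * g x powr (q - 1) = g x powr q" by (simp only: powr_add[symmetric]) simp
        finally show ?thesis using C(1) by (simp add: ennreal_mult)
      qed
    qed
    also have "(\<integral>\<^sup>+x. ennreal C * ennreal (g x powr q) \<partial>lborel) = ennreal C * (\<integral>\<^sup>+x. ennreal (g x powr q) \<partial>lborel)"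
      by (rule nn_integral_cmult) measurable
    also have "\<dots> \<le> ennreal C * 1" by (intro mult_left_mono g1) auto
    finally have "(\<integral>\<^sup>+x. \<integral>\<^sup>+y. ennreal (?k (x - y) * g x * g y) \<partial>lborel \<partial>lborel) \<le> ennreal C + ennreal C"
      by (simp add: add_mono)
    thus ?thesis using C(1) by (simp add: ennreal_plus[symmetric] del: ennreal_plus)
  qed
  show thesis
  proof
    show "2 * C \<ge> 0" using C by simp
    fix g :: "'a \<Rightarrow> real" and M :: real
    assume g[measurable]: "g \<in> borel_measurable borel" and g0: "\<And>y. 0 \<le> g y" and M: "0 < M"
      and gM: "(\<integral>\<^sup>+y. ennreal (g y powr q) \<partial>lborel) \<le> ennreal M"
    define c where "c = M powr (1 / q)"
    have c: "c > 0" "c powr q = M" using M q1 by (auto simp: c_def powr_powr)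
    have "(\<integral>\<^sup>+y. ennreal ((g y / c) powr q) \<partial>lborel) = (\<integral>\<^sup>+y. ennreal (1 / M) * ennreal (g y powr q) \<partial>lborel)"
      using g0 c M by (intro nn_integral_cong) (simp add: powr_divide ennreal_mult[symmetric])
    also have "\<dots> = ennreal (1 / M) * (\<integral>\<^sup>+y. ennreal (g y powr q) \<partial>lborel)"
      by (rule nn_integral_cmult) measurable
    also have "\<dots> \<le> ennreal (1 / M) * ennreal M" by (intro mult_left_mono gM) auto
    also have "\<dots> = 1" using M by (simp add: ennreal_mult[symmetric])
    finally have 1: "(\<integral>\<^sup>+x. \<integral>\<^sup>+y. ennreal (?k (x - y) * (g x / c) * (g y / c)) \<partial>lborel \<partial>lborel) \<le> ennreal (2 * C)"
      using c g0 by (intro unit) auto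
    have "(\<integral>\<^sup>+x. \<integral>\<^sup>+y. ennreal (?k (x - y) * g x * g y) \<partial>lborel \<partial>lborel)
      = (\<integral>\<^sup>+x. \<integral>\<^sup>+y. ennreal (c\<^sup>2) * ennreal (?k (x - y) * (g x / c) * (g y / c)) \<partial>lborel \<partial>lborel)"
      using g0 c by (intro nn_integral_cong) (simp add: ennreal_mult[symmetric] power2_eq_square)
    also have "\<dots> = (\<integral>\<^sup>+x. ennreal (c\<^sup>2) * (\<integral>\<^sup>+y. ennreal (?k (x - y) * (g x / c) * (g y / c)) \<partial>lborel) \<partial>lborel)"
      by (intro nn_integral_cong nn_integral_cmult) measurable
    also have "\<dots> = ennreal (c\<^sup>2) * (\<integral>\<^sup>+x. \<integral>\<^sup>+y. ennreal (?k (x - y) * (g x / c) * (g y / c)) \<partial>lborel \<partial>lborel)"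
      by (intro nn_integral_cmult) measurable
    also have "\<dots> \<le> ennreal (c\<^sup>2) * ennreal (2 * C)" by (intro mult_left_mono 1) auto
    also have "\<dots> = ennreal (2 * C * M powr (2 / q))"
    proof -
      have "c\<^sup>2 = M powr (2 / q)" using c by (simp add: c_def powr_powr powr_realpow[symmetric])
      thus ?thesis using C(1) by (simp add: ennreal_mult[symmetric] mult_ac)
    qed
    finally show "(\<integral>\<^sup>+x. \<integral>\<^sup>+y. ennreal (?k (x - y) * g x * g y) \<partial>lborel \<partial>lborel) \<le> ennreal (2 * C * M powr (2 / q))" .
  qed
qed

section \<open>From Riesz potentials to the critical Sobolev exponent\<close>

lemma nn_integral_combination:
  assumes [measurable]: "f1 \<in> borel_measurable M" "f2 \<in> borel_measurable M"
    "f3 \<in> borel_measurable M" "f4 \<in> borel_measurable M"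
  shows "(\<integral>\<^sup>+z. c * (f1 z + f2 z) + (f3 z + f4 z) \<partial>M)
    = c * ((\<integral>\<^sup>+z. f1 z \<partial>M) + (\<integral>\<^sup>+z. f2 z \<partial>M)) + ((\<integral>\<^sup>+z. f3 z \<partial>M) + (\<integral>\<^sup>+z. f4 z \<partial>M))"
  by (simp add: nn_integral_add nn_integral_cmult)

text \<open>
  Half of the semigroup law \<open>I\<^sub>1 * I\<^sub>1 = I\<^sub>2\<close>, up to constants:
  with \<open>R = \<bar>x - y\<bar>/2\<close>, near one of the two points the other factor is
  bounded by its value at distance \<open>R\<close>, and away from both points the product is at
  most the sum of the squares.
\<close>

lemma Riesz_kernel_composition:
  assumes N: "2 < DIM('a::euclidean_space)"
  obtains C where "C \<ge> 0"
    "\<And>x y :: 'a. x \<noteq> y \<Longrightarrow>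
       (\<integral>\<^sup>+z. ennreal (norm (x - z) powr (1 - real DIM('a)) * norm (y - z) powr (1 - real DIM('a))) \<partial>lborel)
         \<le> ennreal (C * norm (x - y) powr (2 - real DIM('a)))"
proof -
  let ?N = "real DIM('a)"
  have b1: "0 < (1::real)" "1 < ?N" and b2: "0 < ?N - 2" using N by simp_all
  obtain C1 where C1: "C1 \<ge> 0" "\<And>R. R > 0 \<Longrightarrow>
      (\<integral>\<^sup>+z. ennreal (indicator (ball 0 R) z * norm (z::'a) powr (1 - ?N)) \<partial>lborel) = ennreal (C1 * R powr 1)"
    apply (rule powr_kernel_near[OF b1])
    subgoal premises p by (rule p(1)[OF p(2,3)])
    done
  obtain C2 where C2: "C2 \<ge> 0" "\<And>R. R > 0 \<Longrightarrow>
      (\<integral>\<^sup>+z. ennreal (indicator (- ball 0 R) z * norm (z::'a) powr (- ?N - (?N - 2))) \<partial>lborel) = ennreal (C2 * R powr (- (?N - 2)))"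
    apply (rule powr_kernel_far[OF b2, where 'a='a])
    subgoal premises p by (rule p(1)[OF p(2,3)])
    done
  define C where "C = 2 * (C1 + C2) * 2 powr (?N - 2)"
  show thesis
  proof
    show "C \<ge> 0" using C1 C2 by (simp add: C_def)
    fix x y :: 'a assume xy: "x \<noteq> y"
    define R where "R = norm (x - y) / 2"
    have R: "R > 0" using xy by (simp add: R_def)
    let ?k = "\<lambda>z. norm (z::'a) powr (1 - ?N)"
    let ?n = "\<lambda>z. indicator (ball 0 R) z * norm (z::'a) powr (1 - ?N)"
    let ?h = "\<lambda>z. indicator (- ball 0 R) z * norm (z::'a) powr (- ?N - (?N - 2))"
    have kR: "?k w \<le> R powr (1 - ?N)" if "R \<le> norm w" for w
      using that R b1 by (intro powr_mono2') auto
    have kk: "?k w * ?k w = norm w powr (- ?N - (?N - 2))" for w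
    proof -
      have "(1 - ?N) + (1 - ?N) = - ?N - (?N - 2)" by simp
      thus ?thesis by (metis powr_add)
    qed
    have h0: "0 \<le> ?h w" for w by simp
    have pw: "?k (x - z) * ?k (y - z) \<le> R powr (1 - ?N) * (?n (x - z) + ?n (y - z)) + (?h (x - z) + ?h (y - z))" for z
    proof -
      have tri: "2 * R \<le> norm (x - z) + norm (y - z)"
        using norm_triangle_ineq[of "x - z" "z - y"] by (simp add: R_def norm_minus_commute)
      consider "norm (x - z) < R" "R \<le> norm (y - z)" | "norm (y - z) < R" "R \<le> norm (x - z)"
        | "R \<le> norm (x - z)" "R \<le> norm (y - z)"
        using tri by linarith
      thus ?thesis
      proof cases
        case 1
        have "?k (x - z) * ?k (y - z) \<le> ?k (x - z) * R powr (1 - ?N)"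
          using kR[of "y - z"] 1 by (intro mult_left_mono) auto
        also have "\<dots> \<le> R powr (1 - ?N) * (?n (x - z) + ?n (y - z))"
          using 1 by (subst mult.commute, intro mult_left_mono) auto
        finally show ?thesis using h0[of "x - z"] h0[of "y - z"] by linarith
      next
        case 2
        have "?k (x - z) * ?k (y - z) \<le> R powr (1 - ?N) * ?k (y - z)"
          using kR[of "x - z"] 2 by (intro mult_right_mono) auto
        also have "\<dots> \<le> R powr (1 - ?N) * (?n (x - z) + ?n (y - z))"
          using 2 by (intro mult_left_mono) auto
        finally show ?thesis using h0[of "x - z"] h0[of "y - z"] by linarith
      next
        case 3
        have "2 * (?k (x - z) * ?k (y - z)) \<le> ?k (x - z) * ?k (x - z) + ?k (y - z) * ?k (y - z)"
          using sum_squares_bound[of "?k (x - z)" "?k (y - z)"] by (simp add: power2_eq_square mult.assoc)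
        moreover have "0 \<le> ?k (x - z) * ?k (y - z)" by simp
        ultimately have "?k (x - z) * ?k (y - z) \<le> ?k (x - z) * ?k (x - z) + ?k (y - z) * ?k (y - z)" by linarith
        thus ?thesis using 3 unfolding kk by simp
      qed
    qed
    have near: "(\<integral>\<^sup>+z. ennreal (?n (w - z)) \<partial>lborel) = ennreal (C1 * R powr 1)" for w
      unfolding C1(2)[OF R, symmetric]
      by (rule nn_integral_reflect[where f="\<lambda>z. ennreal (?n z)"]) measurable
    have far: "(\<integral>\<^sup>+z. ennreal (?h (w - z)) \<partial>lborel) = ennreal (C2 * R powr (- (?N - 2)))" for w
      unfolding C2(2)[OF R, symmetric]
      by (rule nn_integral_reflect[where f="\<lambda>z. ennreal (?h z)"]) measurable
    have const: "R powr (1 - ?N) * (C1 * R powr 1 + C1 * R powr 1) + (C2 * R powr (- (?N - 2)) + C2 * R powr (- (?N - 2)))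
        = C * norm (x - y) powr (2 - ?N)"
    proof -
      have "R powr (1 - ?N) * R powr 1 = R powr (2 - ?N)" by (simp only: powr_add[symmetric]) simp
      hence "R powr (1 - ?N) * (C1 * R powr 1 + C1 * R powr 1) = 2 * C1 * R powr (2 - ?N)"
        by (simp add: distrib_left mult.left_commute)
      moreover have "2 powr (?N - 2) * 2 powr (2 - ?N) = (1::real)" by (simp only: powr_add[symmetric]) simp
      hence "R powr (2 - ?N) = norm (x - y) powr (2 - ?N) * 2 powr (?N - 2)"
        unfolding R_def by (simp add: powr_divide field_simps)
      ultimately show ?thesis by (simp add: C_def algebra_simps)
    qed
    have "(\<integral>\<^sup>+z. ennreal (?k (x - z) * ?k (y - z)) \<partial>lborel)
      \<le> (\<integral>\<^sup>+z. ennreal (R powr (1 - ?N)) * (ennreal (?n (x - z)) + ennreal (?n (y - z)))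
           + (ennreal (?h (x - z)) + ennreal (?h (y - z))) \<partial>lborel)"
    proof (rule nn_integral_mono)
      fix z
      have "ennreal (?k (x - z) * ?k (y - z))
          \<le> ennreal (R powr (1 - ?N) * (?n (x - z) + ?n (y - z)) + (?h (x - z) + ?h (y - z)))"
        by (rule ennreal_leI) (rule pw)
      thus "ennreal (?k (x - z) * ?k (y - z)) \<le> ennreal (R powr (1 - ?N)) * (ennreal (?n (x - z)) + ennreal (?n (y - z)))
           + (ennreal (?h (x - z)) + ennreal (?h (y - z)))"
        by (subst (asm) ennreal_plus, simp, simp, subst (asm) ennreal_mult, simp, simp)
           (subst (asm) ennreal_plus, simp, simp, subst (asm) ennreal_plus, simp, simp)
    qed
    also have "\<dots> = ennreal (R powr (1 - ?N)) * ((\<integral>\<^sup>+z. ennreal (?n (x - z)) \<partial>lborel) + (\<integral>\<^sup>+z. ennreal (?n (y - z)) \<partial>lborel))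
           + ((\<integral>\<^sup>+z. ennreal (?h (x - z)) \<partial>lborel) + (\<integral>\<^sup>+z. ennreal (?h (y - z)) \<partial>lborel))"
      by (rule nn_integral_combination) measurable
    also have "\<dots> = ennreal (R powr (1 - ?N)) * (ennreal (C1 * R powr 1) + ennreal (C1 * R powr 1))
          + (ennreal (C2 * R powr (- (?N - 2))) + ennreal (C2 * R powr (- (?N - 2))))"
      unfolding near far ..
    also have "\<dots> = ennreal (C * norm (x - y) powr (2 - ?N))" unfolding const[symmetric]
      using C1(1) C2(1) R by (simp add: ennreal_plus[symmetric] ennreal_mult[symmetric] algebra_simps del: ennreal_plus)
    finally show "(\<integral>\<^sup>+z. ennreal (?k (x - z) * ?k (y - z)) \<partial>lborel) \<le> ennreal (C * norm (x - y) powr (2 - ?N))" .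
  qed
qed

text \<open>
  Expanding the square of \<open>I\<^sub>1 * h\<close> and integrating out the common variable
  leaves the double integral of \<open>h h\<close> against \<open>I\<^sub>2\<close>, to which
  the diagonal inequality with exponent \<open>2\<close> applies. This is the dual form of the
  Sobolev inequality.
\<close>

lemma Riesz_potential_L2_bound:
  assumes N: "2 < DIM('a::euclidean_space)"
  obtains C where "C \<ge> 0"
    "\<And>(h :: 'a \<Rightarrow> real) M. h \<in> borel_measurable borel \<Longrightarrow> (\<And>y. 0 \<le> h y) \<Longrightarrow> 0 < M \<Longrightarrow>
       (\<integral>\<^sup>+y. ennreal (h y powr (2 * real DIM('a) / (real DIM('a) + 2))) \<partial>lborel) \<le> ennreal M \<Longrightarrow>
       (\<integral>\<^sup>+z. (\<integral>\<^sup>+x. ennreal (norm (x - z) powr (1 - real DIM('a)) * h x) \<partial>lborel)\<^sup>2 \<partial>lborel)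
         \<le> ennreal (C * M powr ((real DIM('a) + 2) / real DIM('a)))"
proof -
  let ?N = "real DIM('a)"
  let ?q = "2 * ?N / (?N + 2)"
  let ?k = "\<lambda>z. norm (z::'a) powr (1 - ?N)"
  have \<alpha>: "0 < (2::real)" "2 < ?N" using N by auto
  obtain A where A: "A \<ge> 0"
    "\<And>x y :: 'a. x \<noteq> y \<Longrightarrow> (\<integral>\<^sup>+z. ennreal (?k (x - z) * ?k (y - z)) \<partial>lborel) \<le> ennreal (A * norm (x - y) powr (2 - ?N))"
    apply (rule Riesz_kernel_composition[OF N])
    subgoal premises p by (rule p(1)[OF p(2,3)])
    done
  obtain B where B: "B \<ge> 0"
    "\<And>(g :: 'a \<Rightarrow> real) M. g \<in> borel_measurable borel \<Longrightarrow> (\<And>y. 0 \<le> g y) \<Longrightarrow> 0 < M \<Longrightarrow>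
       (\<integral>\<^sup>+y. ennreal (g y powr ?q) \<partial>lborel) \<le> ennreal M \<Longrightarrow>
       (\<integral>\<^sup>+x. \<integral>\<^sup>+y. ennreal (norm (x - y) powr (2 - ?N) * g x * g y) \<partial>lborel \<partial>lborel)
         \<le> ennreal (B * M powr (2 / ?q))"
    apply (rule Hardy_Littlewood_Sobolev_diagonal[OF \<alpha>])
    subgoal premises p by (rule p(1)[OF p(2,3)])
    done
  show thesis
  proof
    show "A * B \<ge> 0" using A B by simp
    fix h :: "'a \<Rightarrow> real" and M
    assume h[measurable]: "h \<in> borel_measurable borel" and h0: "\<And>y. 0 \<le> h y" and M: "0 < M"
      and hM: "(\<integral>\<^sup>+y. ennreal (h y powr ?q) \<partial>lborel) \<le> ennreal M"
    have "(\<integral>\<^sup>+z. (\<integral>\<^sup>+x. ennreal (?k (x - z) * h x) \<partial>lborel)\<^sup>2 \<partial>lborel)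
       = (\<integral>\<^sup>+z. \<integral>\<^sup>+x. \<integral>\<^sup>+y. ennreal (?k (x - z) * h x) * ennreal (?k (y - z) * h y) \<partial>lborel \<partial>lborel \<partial>lborel)"
      by (simp add: power2_eq_square nn_integral_cmult nn_integral_multc)
    also have "\<dots> = (\<integral>\<^sup>+x. \<integral>\<^sup>+z. \<integral>\<^sup>+y. ennreal (?k (x - z) * h x) * ennreal (?k (y - z) * h y) \<partial>lborel \<partial>lborel \<partial>lborel)"
      by (rule lborel_pair.Fubini') measurable
    also have "\<dots> = (\<integral>\<^sup>+x. \<integral>\<^sup>+y. \<integral>\<^sup>+z. ennreal (?k (x - z) * h x) * ennreal (?k (y - z) * h y) \<partial>lborel \<partial>lborel \<partial>lborel)"
      by (intro nn_integral_cong lborel_pair.Fubini') measurable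
    also have "\<dots> \<le> (\<integral>\<^sup>+x. \<integral>\<^sup>+y. ennreal A * ennreal (norm (x - y) powr (2 - ?N) * h x * h y) \<partial>lborel \<partial>lborel)"
    proof (rule nn_integral_mono, rule nn_integral_mono_AE)
      fix x :: 'a
      have ne: "AE y in lborel. y \<noteq> x" by (rule AE_lborel_singleton)
      show "AE y in lborel. (\<integral>\<^sup>+z. ennreal (?k (x - z) * h x) * ennreal (?k (y - z) * h y) \<partial>lborel)
          \<le> ennreal A * ennreal (norm (x - y) powr (2 - ?N) * h x * h y)"
        using ne
      proof eventually_elim
        case (elim y)
        have "(\<integral>\<^sup>+z. ennreal (?k (x - z) * h x) * ennreal (?k (y - z) * h y) \<partial>lborel)
          = (\<integral>\<^sup>+z. ennreal (h x * h y) * ennreal (?k (x - z) * ?k (y - z)) \<partial>lborel)"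
          using h0 by (intro nn_integral_cong) (simp add: ennreal_mult[symmetric] mult_ac)
        also have "\<dots> = ennreal (h x * h y) * (\<integral>\<^sup>+z. ennreal (?k (x - z) * ?k (y - z)) \<partial>lborel)"
          by (rule nn_integral_cmult) measurable
        also have "\<dots> \<le> ennreal (h x * h y) * ennreal (A * norm (x - y) powr (2 - ?N))"
          using elim by (intro mult_left_mono A(2)) auto
        also have "\<dots> = ennreal A * ennreal (norm (x - y) powr (2 - ?N) * h x * h y)"
          using A h0 by (simp add: ennreal_mult[symmetric] mult_ac)
        finally show ?case .
      qed
    qed
    also have "\<dots> = (\<integral>\<^sup>+x. ennreal A * (\<integral>\<^sup>+y. ennreal (norm (x - y) powr (2 - ?N) * h x * h y) \<partial>lborel) \<partial>lborel)"
      by (intro nn_integral_cong nn_integral_cmult) measurable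
    also have "\<dots> = ennreal A * (\<integral>\<^sup>+x. \<integral>\<^sup>+y. ennreal (norm (x - y) powr (2 - ?N) * h x * h y) \<partial>lborel \<partial>lborel)"
      by (intro nn_integral_cmult) measurable
    also have "\<dots> \<le> ennreal A * ennreal (B * M powr (2 / ?q))"
      by (intro mult_left_mono B(2) h h0 M hM) auto
    also have "2 / ?q = (?N + 2) / ?N" by (simp add: field_simps)
    also have "ennreal A * ennreal (B * M powr ((?N + 2) / ?N)) = ennreal (A * B * M powr ((?N + 2) / ?N))"
      using A(1) B(1) by (simp add: ennreal_mult[symmetric] mult_ac)
    finally show "(\<integral>\<^sup>+z. (\<integral>\<^sup>+x. ennreal (?k (x - z) * h x) \<partial>lborel)\<^sup>2 \<partial>lborel) \<le> ennreal (A * B * M powr ((?N + 2) / ?N))" .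
  qed
qed

text \<open>
  Duality with \<open>h = min(\<bar>u\<bar>, n)\<^sup>p\<^sup>-\<^sup>1\<close>, where
  \<open>p\<close> is the critical exponent. If \<open>m\<close> denotes the integral of
  \<open>min(\<bar>u\<bar>, n)\<^sup>p\<close>, the potential bound and the Cauchy-Schwarz
  inequality bound \<open>m\<^sup>2\<close> by a constant times the power \<open>1 + 2/N\<close>
  of \<open>m\<close>. The truncation makes \<open>m\<close> finite, so it can be cancelled, and
  the resulting bound on \<open>m\<close> does not depend on \<open>n\<close>.
\<close>

lemma Sobolev_from_potential_bound:
  fixes u g :: "'a::euclidean_space \<Rightarrow> real" and K :: real
  assumes N: "2 < DIM('a)"
    and u[measurable]: "u \<in> borel_measurable borel" and g[measurable]: "g \<in> borel_measurable borel"
    and u2: "(\<integral>\<^sup>+x. ennreal ((u x)\<^sup>2) \<partial>lborel) < \<infinity>" and g2: "(\<integral>\<^sup>+x. ennreal ((g x)\<^sup>2) \<partial>lborel) < \<infinity>"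
    and K: "K \<ge> 0" and g0: "\<And>x. 0 \<le> g x"
    and le: "AE x in lborel. ennreal \<bar>u x\<bar> \<le> ennreal K * (\<integral>\<^sup>+z. ennreal (norm (x - z) powr (1 - real DIM('a)) * g z) \<partial>lborel)"
  shows "(\<integral>\<^sup>+x. ennreal (\<bar>u x\<bar> powr (2 * real DIM('a) / (real DIM('a) - 2))) \<partial>lborel) < \<infinity>"
proof -
  let ?N = "real DIM('a)"
  let ?q = "2 * ?N / (?N + 2)"
  define p where "p = 2 * ?N / (?N - 2)"
  let ?k = "\<lambda>z. norm (z::'a) powr (1 - ?N)"
  have N2: "?N > 2" using N by simp
  have p2: "p > 2" using N2 by (simp add: p_def field_simps)
  have p1: "p - 1 = (?N + 2) / (?N - 2)" using N2 by (simp add: p_def field_simps)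
  have pq: "(p - 1) * ?q = p"
  proof -
    have "(p - 1) * ?q = ((?N + 2) * (2 * ?N)) / ((?N - 2) * (?N + 2))" unfolding p1 by simp
    also have "\<dots> = p" using N2 by (simp add: p_def)
    finally show ?thesis .
  qed
  obtain C where C: "C \<ge> 0"
    "\<And>(h :: 'a \<Rightarrow> real) M. h \<in> borel_measurable borel \<Longrightarrow> (\<And>y. 0 \<le> h y) \<Longrightarrow> 0 < M \<Longrightarrow>
       (\<integral>\<^sup>+y. ennreal (h y powr ?q) \<partial>lborel) \<le> ennreal M \<Longrightarrow>
       (\<integral>\<^sup>+z. (\<integral>\<^sup>+x. ennreal (?k (x - z) * h x) \<partial>lborel)\<^sup>2 \<partial>lborel) \<le> ennreal (C * M powr ((?N + 2) / ?N))"
    apply (rule Riesz_potential_L2_bound[OF N])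
    subgoal premises p by (rule p(1)[OF p(2,3)])
    done
  obtain G where G: "G \<ge> 0" "(\<integral>\<^sup>+x. ennreal ((g x)\<^sup>2) \<partial>lborel) = ennreal G"
    using g2 by (cases "\<integral>\<^sup>+x. ennreal ((g x)\<^sup>2) \<partial>lborel") auto
  \<comment> \<open>The factor by which \<open>m\<^sup>2\<close> is bounded in terms of the power \<open>1 +
      2/N\<close> of \<open>m\<close>.\<close>
  define D where "D = K\<^sup>2 * (G * C)"
  have D: "D \<ge> 0" using G C K by (simp add: D_def)
  define t where "t n x = min \<bar>u x\<bar> (real n)" for n x
  have t[measurable]: "t n \<in> borel_measurable borel" for n unfolding t_def by measurable
  have t0: "0 \<le> t n x" for n x by (simp add: t_def)
  have bound: "(\<integral>\<^sup>+x. ennreal (t n x powr p) \<partial>lborel) \<le> ennreal (D powr (?N / (?N - 2)))" for n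
  proof -
    have "(\<integral>\<^sup>+x. ennreal (t n x powr p) \<partial>lborel) \<le> (\<integral>\<^sup>+x. ennreal (real n powr (p - 2)) * ennreal ((u x)\<^sup>2) \<partial>lborel)"
    proof (rule nn_integral_mono)
      fix x
      have "t n x powr p = t n x powr (p - 2) * t n x powr 2" by (simp only: powr_add[symmetric]) simp
      also have "\<dots> \<le> real n powr (p - 2) * \<bar>u x\<bar> powr 2"
        using p2 by (intro mult_mono powr_mono2) (auto simp: t_def)
      also have "\<bar>u x\<bar> powr 2 = (u x)\<^sup>2" by simp
      finally show "ennreal (t n x powr p) \<le> ennreal (real n powr (p - 2)) * ennreal ((u x)\<^sup>2)"
        by (simp add: ennreal_mult[symmetric] ennreal_leI)
    qed
    also have "\<dots> = ennreal (real n powr (p - 2)) * (\<integral>\<^sup>+x. ennreal ((u x)\<^sup>2) \<partial>lborel)"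
      by (rule nn_integral_cmult) measurable
    also have "\<dots> < \<infinity>" using u2 by (simp add: ennreal_mult_less_top)
    finally obtain m where m: "m \<ge> 0" "(\<integral>\<^sup>+x. ennreal (t n x powr p) \<partial>lborel) = ennreal m"
      by (cases "\<integral>\<^sup>+x. ennreal (t n x powr p) \<partial>lborel") auto
    show ?thesis
    proof (cases "m = 0")
      case True thus ?thesis using m by simp
    next
      case False
      hence m0: "m > 0" using m by simp
      define h where "h x = t n x powr (p - 1)" for x
      have h[measurable]: "h \<in> borel_measurable borel" unfolding h_def by measurable
      have h0: "0 \<le> h x" for x by (simp add: h_def)
      have hq: "h x powr ?q = t n x powr p" for x by (simp only: h_def powr_powr pq)
      define \<Phi> where "\<Phi> z = (\<integral>\<^sup>+x. ennreal (?k (x - z) * h x) \<partial>lborel)" for z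
      have \<Phi>[measurable]: "\<Phi> \<in> borel_measurable borel" unfolding \<Phi>_def by measurable
      have \<Phi>2: "(\<integral>\<^sup>+z. (\<Phi> z)\<^sup>2 \<partial>lborel) \<le> ennreal (C * m powr ((?N + 2) / ?N))"
        unfolding \<Phi>_def using m by (intro C(2) h h0 m0) (simp add: hq)
      have "ennreal m = (\<integral>\<^sup>+x. ennreal (t n x powr p) \<partial>lborel)" using m by simp
      also have "\<dots> \<le> (\<integral>\<^sup>+x. ennreal \<bar>u x\<bar> * ennreal (h x) \<partial>lborel)"
      proof (rule nn_integral_mono)
        fix x
        have "t n x powr p = t n x powr 1 * t n x powr (p - 1)" by (simp only: powr_add[symmetric]) simp
        also have "\<dots> \<le> \<bar>u x\<bar> * h x" unfolding h_def by (intro mult_right_mono) (auto simp: t_def)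
        finally show "ennreal (t n x powr p) \<le> ennreal \<bar>u x\<bar> * ennreal (h x)"
          using h0 by (simp add: ennreal_mult[symmetric] ennreal_leI)
      qed
      also have "\<dots> \<le> (\<integral>\<^sup>+x. (ennreal K * (\<integral>\<^sup>+z. ennreal (?k (x - z) * g z) \<partial>lborel)) * ennreal (h x) \<partial>lborel)"
        by (rule nn_integral_mono_AE, use le in eventually_elim) (rule mult_right_mono, auto)
      also have "\<dots> = (\<integral>\<^sup>+x. \<integral>\<^sup>+z. ennreal K * (ennreal (g z) * ennreal (?k (x - z) * h x)) \<partial>lborel \<partial>lborel)"
      proof (rule nn_integral_cong)
        fix x
        have "(ennreal K * (\<integral>\<^sup>+z. ennreal (?k (x - z) * g z) \<partial>lborel)) * ennreal (h x)
          = (\<integral>\<^sup>+z. ennreal K * ennreal (?k (x - z) * g z) * ennreal (h x) \<partial>lborel)"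
          by (simp add: nn_integral_cmult nn_integral_multc)
        also have "\<dots> = (\<integral>\<^sup>+z. ennreal K * (ennreal (g z) * ennreal (?k (x - z) * h x)) \<partial>lborel)"
          using K h0 g0 by (intro nn_integral_cong) (simp add: ennreal_mult[symmetric] mult_ac)
        finally show "(ennreal K * (\<integral>\<^sup>+z. ennreal (?k (x - z) * g z) \<partial>lborel)) * ennreal (h x)
          = (\<integral>\<^sup>+z. ennreal K * (ennreal (g z) * ennreal (?k (x - z) * h x)) \<partial>lborel)" .
      qed
      also have "\<dots> = (\<integral>\<^sup>+z. \<integral>\<^sup>+x. ennreal K * (ennreal (g z) * ennreal (?k (x - z) * h x)) \<partial>lborel \<partial>lborel)"
        by (rule lborel_pair.Fubini'[symmetric]) measurable
      also have "\<dots> = ennreal K * (\<integral>\<^sup>+z. ennreal (g z) * \<Phi> z \<partial>lborel)"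
        by (simp add: nn_integral_cmult \<Phi>_def)
      finally have "(ennreal m)\<^sup>2 \<le> (ennreal K * (\<integral>\<^sup>+z. ennreal (g z) * \<Phi> z \<partial>lborel))\<^sup>2"
        by (intro power_mono) auto
      also have "\<dots> = (ennreal K)\<^sup>2 * (\<integral>\<^sup>+z. ennreal (g z) * \<Phi> z \<partial>lborel)\<^sup>2" by (simp add: power_mult_distrib)
      also have "\<dots> \<le> (ennreal K)\<^sup>2 * ((\<integral>\<^sup>+z. (ennreal (g z))\<^sup>2 \<partial>lborel) * (\<integral>\<^sup>+z. (\<Phi> z)\<^sup>2 \<partial>lborel))"
        by (intro mult_left_mono Cauchy_Schwarz_nn_integral) auto
      also have "(\<integral>\<^sup>+z. (ennreal (g z))\<^sup>2 \<partial>lborel) = ennreal G"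
        using G g0 by (simp add: ennreal_power)
      also have "(ennreal K)\<^sup>2 * (ennreal G * (\<integral>\<^sup>+z. (\<Phi> z)\<^sup>2 \<partial>lborel)) \<le> (ennreal K)\<^sup>2 * (ennreal G * ennreal (C * m powr ((?N + 2) / ?N)))"
        by (intro mult_left_mono \<Phi>2) auto
      also have "\<dots> = ennreal (D * m powr ((?N + 2) / ?N))"
        using K G C(1) by (simp add: D_def ennreal_power ennreal_mult[symmetric] mult_ac)
      finally have "m\<^sup>2 \<le> D * m powr ((?N + 2) / ?N)"
        using m D by (simp add: ennreal_power ennreal_le_iff)
      also have "m\<^sup>2 = m powr ((?N - 2) / ?N) * m powr ((?N + 2) / ?N)"
      proof -
        have "(?N - 2) / ?N + (?N + 2) / ?N = 2" using N2 by (simp add: field_simps)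
        hence "m\<^sup>2 = m powr ((?N - 2) / ?N + (?N + 2) / ?N)" using m0 by simp
        thus ?thesis by (simp only: powr_add)
      qed
      finally have "m powr ((?N - 2) / ?N) \<le> D" using m0 by simp
      hence "(m powr ((?N - 2) / ?N)) powr (?N / (?N - 2)) \<le> D powr (?N / (?N - 2))"
        using N2 by (intro powr_mono2) auto
      also have "(m powr ((?N - 2) / ?N)) powr (?N / (?N - 2)) = m"
        using N2 m0 by (simp add: powr_powr)
      finally show ?thesis using m by (simp add: ennreal_leI)
    qed
  qed
  have "(\<lambda>n. \<integral>\<^sup>+x. ennreal (t n x powr p) \<partial>lborel) \<longlonglongrightarrow> (\<integral>\<^sup>+x. ennreal (\<bar>u x\<bar> powr p) \<partial>lborel)"
  proof (rule nn_integral_LIMSEQ)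
    show "incseq (\<lambda>n x. ennreal (t n x powr p))"
      using p2 by (auto simp: incseq_def le_fun_def t_def intro!: ennreal_leI powr_mono2)
    show "(\<lambda>n. ennreal (t n x powr p)) \<longlonglongrightarrow> ennreal (\<bar>u x\<bar> powr p)" for x
    proof (rule tendsto_eventually)
      obtain n0 :: nat where n0: "\<bar>u x\<bar> \<le> real n0" using real_arch_simple by blast
      show "\<forall>\<^sub>F n in sequentially. ennreal (t n x powr p) = ennreal (\<bar>u x\<bar> powr p)"
        unfolding eventually_sequentially
      proof (intro exI allI impI)
        fix n assume "n0 \<le> n"
        hence "\<bar>u x\<bar> \<le> real n" using n0 by linarith
        thus "ennreal (t n x powr p) = ennreal (\<bar>u x\<bar> powr p)" by (simp add: t_def)
      qed
    qed
  qed simp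
  hence "(\<integral>\<^sup>+x. ennreal (\<bar>u x\<bar> powr p) \<partial>lborel) \<le> ennreal (D powr (?N / (?N - 2)))"
    by (rule LIMSEQ_le_const2) (use bound in auto)
  thus ?thesis unfolding p_def by (rule le_less_trans) simp
qed

section \<open>Smooth bumps and the fundamental lemma\<close>

text \<open>
  Differentiability to finite order in one variable, in a form that matches the recursion of
  \<open>C_k\<close> and lets the product rule go through by induction without a Leibniz
  formula.
\<close>

primrec smooth_upto :: "nat \<Rightarrow> (real \<Rightarrow> real) \<Rightarrow> bool" where
  "smooth_upto 0 f \<longleftrightarrow> continuous_on UNIV f"
| "smooth_upto (Suc k) f \<longleftrightarrow> (\<exists>f'. (\<forall>t. (f has_real_derivative f' t) (at t)) \<and> smooth_upto k f')"

lemma smooth_upto_Suc_D: "smooth_upto (Suc k) f \<Longrightarrow> smooth_upto k f"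
proof (induction k arbitrary: f)
  case 0
  then obtain f' where "\<forall>t. (f has_real_derivative f' t) (at t)" by auto
  thus ?case using DERIV_isCont by (auto simp: continuous_on_eq_continuous_at)
next
  case (Suc k)
  then obtain f' where "\<forall>t. (f has_real_derivative f' t) (at t)" "smooth_upto (Suc k) f'"
    by (metis smooth_upto.simps(2))
  thus ?case using Suc.IH by auto
qed

lemma smooth_upto_add:
  "smooth_upto k f \<Longrightarrow> smooth_upto k g \<Longrightarrow> smooth_upto k (\<lambda>t. f t + g t)"
proof (induction k arbitrary: f g)
  case 0 thus ?case by (auto intro: continuous_on_add)
next
  case (Suc k)
  then obtain f' g' where "\<forall>t. (f has_real_derivative f' t) (at t)" "smooth_upto k f'"
    "\<forall>t. (g has_real_derivative g' t) (at t)" "smooth_upto k g'" by auto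
  thus ?case using Suc.IH[of f' g'] by (auto intro!: exI[of _ "\<lambda>t. f' t + g' t"] DERIV_add)
qed

lemma smooth_upto_mult:
  "smooth_upto k f \<Longrightarrow> smooth_upto k g \<Longrightarrow> smooth_upto k (\<lambda>t. f t * g t)"
proof (induction k arbitrary: f g)
  case 0 thus ?case by (auto intro: continuous_on_mult)
next
  case (Suc k)
  then obtain f' g' where d: "\<forall>t. (f has_real_derivative f' t) (at t)" "smooth_upto k f'"
    "\<forall>t. (g has_real_derivative g' t) (at t)" "smooth_upto k g'" by auto
  have "smooth_upto k f" "smooth_upto k g" using Suc.prems smooth_upto_Suc_D by auto
  hence "smooth_upto k (\<lambda>t. f' t * g t + g' t * f t)"
    using Suc.IH d smooth_upto_add by auto
  moreover have "((\<lambda>t. f t * g t) has_real_derivative f' t * g t + g' t * f t) (at t)" for t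
    by (rule DERIV_mult) (use d in auto)
  ultimately show ?case unfolding smooth_upto.simps by (intro exI[of _ "\<lambda>t. f' t * g t + g' t * f t"] conjI allI)
qed

lemma smooth_upto_const: "smooth_upto k (\<lambda>_. c)"
proof (induction k arbitrary: c)
  case (Suc k)
  show ?case using Suc[of 0] by (auto intro!: exI[of _ "\<lambda>_. 0"])
qed simp

lemma smooth_upto_affine:
  "smooth_upto k f \<Longrightarrow> smooth_upto k (\<lambda>t. f (a * t + b))"
proof (induction k arbitrary: f)
  case 0 thus ?case by (auto intro!: continuous_on_compose2[of UNIV f] continuous_intros)
next
  case (Suc k)
  then obtain f' where d: "\<And>t. (f has_real_derivative f' t) (at t)" "smooth_upto k f'" by auto
  have "((\<lambda>t. f (a * t + b)) has_real_derivative f' (a * t + b) * a) (at t)" for t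
    by (rule DERIV_chain2[OF d(1)]) (auto intro!: derivative_eq_intros)
  moreover have "smooth_upto k (\<lambda>t. f' (a * t + b) * a)"
    by (rule smooth_upto_mult[OF Suc.IH[OF d(2)] smooth_upto_const])
  ultimately show ?case unfolding smooth_upto.simps by (intro exI[of _ "\<lambda>t. f' (a * t + b) * a"] conjI allI)
qed

text \<open>
  The family \<open>p(1/x) exp(-1/x)\<close>, extended by \<open>0\<close>, is closed under
  differentiation; this makes the classical flat function \<open>exp(-1/x)\<close>, the case
  \<open>p = 1\<close>, smooth.
\<close>

definition flat_poly :: "real poly \<Rightarrow> real \<Rightarrow> real" where
  "flat_poly p x = (if 0 < x then poly p (1 / x) * exp (- (1 / x)) else 0)"

lemma poly_over_exp_tendsto_0: "((\<lambda>y. poly p y * exp (- y)) \<longlongrightarrow> (0::real)) at_top"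
proof -
  have "((\<lambda>y. \<Sum>i\<le>degree p. coeff p i * (y ^ i / exp y)) \<longlongrightarrow> (\<Sum>i\<le>degree p. coeff p i * 0)) at_top"
    by (intro tendsto_sum tendsto_mult tendsto_const tendsto_power_div_exp_0)
  thus ?thesis by (simp add: poly_altdef sum_distrib_right exp_minus divide_inverse mult.assoc)
qed

lemma flat_poly_has_derivative:
  "(flat_poly p has_real_derivative flat_poly ([:0, 0, 1:] * (p - pderiv p)) x) (at x)"
proof -
  let ?q = "[:0, 0, 1:] * (p - pderiv p)"
  consider "x > 0" | "x < 0" | "x = 0" by linarith
  thus ?thesis
  proof cases
    case 1
    have "((\<lambda>x. poly p (1 / x) * exp (- (1 / x))) has_real_derivative flat_poly ?q x) (at x)"
      using 1 by (auto intro!: derivative_eq_intros poly_DERIV[THEN DERIV_chain2]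
          simp: flat_poly_def field_simps power2_eq_square)
    moreover have "eventually (\<lambda>y. y \<in> {0<..}) (nhds x)" using 1 by (intro eventually_nhds_in_open) auto
    hence "eventually (\<lambda>y. flat_poly p y = poly p (1 / y) * exp (- (1 / y))) (nhds x)"
      by eventually_elim (simp add: flat_poly_def)
    ultimately show ?thesis by (subst DERIV_cong_ev[OF refl _ refl]) auto
  next
    case 2
    have "((\<lambda>x. 0) has_real_derivative flat_poly ?q x) (at x)"
      using 2 by (auto simp: flat_poly_def)
    moreover have "eventually (\<lambda>y. y \<in> {..<0}) (nhds x)" using 2 by (intro eventually_nhds_in_open) auto
    hence "eventually (\<lambda>y. flat_poly p y = 0) (nhds x)"
      by eventually_elim (simp add: flat_poly_def)
    ultimately show ?thesis by (subst DERIV_cong_ev[OF refl _ refl]) auto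
  next
    case 3
    have right: "((\<lambda>h. flat_poly p h / h) \<longlongrightarrow> 0) (at_right 0)"
    proof -
      have "((\<lambda>h. poly ([:0, 1:] * p) (inverse h) * exp (- inverse h)) \<longlongrightarrow> 0) (at_right 0)"
        by (rule filterlim_compose[OF poly_over_exp_tendsto_0 filterlim_inverse_at_top_right])
      moreover have "eventually (\<lambda>h. poly ([:0, 1:] * p) (inverse h) * exp (- inverse h) = flat_poly p h / h) (at_right (0::real))"
        using eventually_at_right_less[of 0] by eventually_elim (simp add: flat_poly_def field_simps)
      ultimately show ?thesis by (rule Lim_transform_eventually)
    qed
    have left: "((\<lambda>h. flat_poly p h / h) \<longlongrightarrow> 0) (at_left 0)"
    proof (rule tendsto_eventually)
      show "eventually (\<lambda>h. flat_poly p h / h = 0) (at_left 0)"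
        by (auto simp: eventually_at_filter flat_poly_def intro!: always_eventually)
    qed
    have "((\<lambda>h. flat_poly p h / h) \<longlongrightarrow> 0) (at 0)"
      using left right by (simp add: filterlim_split_at)
    thus ?thesis using 3 by (simp add: DERIV_def flat_poly_def)
  qed
qed

lemma smooth_upto_flat_poly: "smooth_upto k (flat_poly p)"
proof (induction k arbitrary: p)
  case 0
  have "isCont (flat_poly p) x" for x by (rule DERIV_isCont[OF flat_poly_has_derivative])
  thus ?case by (simp add: continuous_on_eq_continuous_at)
next
  case (Suc k)
  show ?case unfolding smooth_upto.simps
    by (intro exI[of _ "flat_poly ([:0, 0, 1:] * (p - pderiv p))"] conjI allI flat_poly_has_derivative Suc)
qed

lemma flat_poly_1:
  "0 \<le> flat_poly 1 t" "flat_poly 1 t \<le> 1" "flat_poly 1 t \<noteq> 0 \<longleftrightarrow> 0 < t"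
  by (auto simp: flat_poly_def)

text \<open>
  A partial derivative of a product of one-variable functions is again such a product, with one
  factor replaced by its derivative. So smoothness in several variables reduces to one variable.
\<close>

lemma C_k_prod:
  fixes \<beta> :: "'n::finite \<Rightarrow> real \<Rightarrow> real"
  assumes "\<And>i. smooth_upto k (\<beta> i)"
  shows "C_k k (\<lambda>x :: real ^ 'n. \<Prod>i\<in>UNIV. \<beta> i (x $ i))"
  using assms
proof (induction k arbitrary: \<beta>)
  case 0
  have "continuous_on UNIV (\<lambda>x :: real ^ 'n. \<beta> i (x $ i))" for i
    using 0[of i] by (auto intro!: continuous_on_compose2[of UNIV "\<beta> i"] continuous_intros)
  thus ?case by (auto intro!: continuous_on_prod)
next
  case (Suc k)
  have "\<forall>i. \<exists>f'. (\<forall>t. (\<beta> i has_real_derivative f' t) (at t)) \<and> smooth_upto k f'" using Suc.prems by simp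
  then obtain \<beta>' where d: "\<And>i t. (\<beta> i has_real_derivative \<beta>' i t) (at t)" "\<And>i. smooth_upto k (\<beta>' i)"
    by metis
  have D: "((\<lambda>x :: real ^ 'n. \<Prod>i\<in>UNIV. \<beta> i (x $ i)) has_derivative
      (\<lambda>y. \<Sum>i\<in>UNIV. (\<beta>' i (x $ i) * (y $ i)) * (\<Prod>j\<in>UNIV - {i}. \<beta> j (x $ j)))) (at x)" for x
  proof (rule has_derivative_prod)
    fix i
    have "((\<lambda>x :: real ^ 'n. x $ i) has_derivative (\<lambda>y. y $ i)) (at x)"
      by (rule bounded_linear_imp_has_derivative) (rule bounded_linear_vec_nth)
    moreover have "(\<beta> i has_derivative (*) (\<beta>' i (x $ i))) (at (x $ i))"
      using d(1)[of i "x $ i"] by (simp add: has_field_derivative_def)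
    ultimately show "((\<lambda>x. \<beta> i (x $ i)) has_derivative (\<lambda>y. \<beta>' i (x $ i) * y $ i)) (at x)"
      by (rule has_derivative_compose)
  qed
  have "partial_deriv i (\<lambda>x :: real ^ 'n. \<Prod>i\<in>UNIV. \<beta> i (x $ i)) = (\<lambda>x. \<Prod>j\<in>UNIV. (\<beta>(i := \<beta>' i)) j (x $ j))" for i
  proof
    fix x :: "real ^ 'n"
    have "partial_deriv i (\<lambda>x :: real ^ 'n. \<Prod>i\<in>UNIV. \<beta> i (x $ i)) x
      = (\<Sum>l\<in>UNIV. (\<beta>' l (x $ l) * (axis i 1 $ l)) * (\<Prod>j\<in>UNIV - {l}. \<beta> j (x $ j)))"
      unfolding partial_deriv_def frechet_derivative_at[OF D, symmetric] by simp
    also have "\<dots> = (\<Sum>l\<in>UNIV. if l = i then \<beta>' i (x $ i) * (\<Prod>j\<in>UNIV - {i}. \<beta> j (x $ j)) else 0)"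
      by (intro sum.cong) (auto simp: axis_def)
    also have "\<dots> = \<beta>' i (x $ i) * (\<Prod>j\<in>UNIV - {i}. \<beta> j (x $ j))" by simp
    also have "\<dots> = (\<Prod>j\<in>UNIV. (\<beta>(i := \<beta>' i)) j (x $ j))"
      by (subst (2) prod.remove[of _ i]) (auto intro!: prod.cong)
    finally show "partial_deriv i (\<lambda>x :: real ^ 'n. \<Prod>i\<in>UNIV. \<beta> i (x $ i)) x = (\<Prod>j\<in>UNIV. (\<beta>(i := \<beta>' i)) j (x $ j))" .
  qed
  moreover have "smooth_upto k ((\<beta>(i := \<beta>' i)) j)" for i j
    using d(2) Suc.prems smooth_upto_Suc_D by (auto simp: fun_upd_def)
  hence "C_k k (\<lambda>x :: real ^ 'n. \<Prod>j\<in>UNIV. (\<beta>(i := \<beta>' i)) j (x $ j))" for i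
    by (rule Suc.IH)
  ultimately show ?case using D by (auto simp: differentiable_def)
qed

definition box_bump :: "real ^ 'n \<Rightarrow> real ^ 'n \<Rightarrow> nat \<Rightarrow> real ^ 'n \<Rightarrow> real" where
  "box_bump a b n x =
     (\<Prod>i\<in>UNIV. flat_poly 1 (real (Suc n) * (x $ i - a $ i)) * flat_poly 1 (real (Suc n) * (b $ i - x $ i)))"

lemma box_bump_bounds: "0 \<le> box_bump a b n x" "box_bump a b n x \<le> 1"
  unfolding box_bump_def by (auto intro!: prod_nonneg prod_le_1 mult_le_one simp: flat_poly_1)

lemma box_bump_support: "box_bump a b n x \<noteq> 0 \<longleftrightarrow> x \<in> box a b"
  by (auto simp: box_bump_def flat_poly_1 mem_box_cart zero_less_mult_iff)

lemma test_function_box_bump: "test_function (box_bump a b n)"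
  unfolding test_function_def
proof
  have eq: "box_bump a b n = (\<lambda>x. \<Prod>i\<in>UNIV. (\<lambda>t. flat_poly 1 (real (Suc n) * t + (- (real (Suc n) * a $ i)))
      * flat_poly 1 (- real (Suc n) * t + real (Suc n) * b $ i)) (x $ i))"
    by (simp add: box_bump_def fun_eq_iff algebra_simps)
  show "\<forall>k. C_k k (box_bump a b n)"
    unfolding eq by (intro allI C_k_prod, rule smooth_upto_mult[OF smooth_upto_affine[OF smooth_upto_flat_poly] smooth_upto_affine[OF smooth_upto_flat_poly]])
  have "closure {x. box_bump a b n x \<noteq> 0} \<subseteq> cbox a b"
    using box_subset_cbox by (intro closure_minimal) (auto simp: box_bump_support)
  thus "compact (closure {x. box_bump a b n x \<noteq> 0})"
    by (meson bounded_cbox bounded_subset closed_closure compact_eq_bounded_closed)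
qed

lemma box_bump_tendsto_indicator:
  fixes a b x :: "real ^ 'n"
  shows "(\<lambda>n. box_bump a b n x) \<longlonglongrightarrow> indicator (box a b) x"
proof (cases "x \<in> box a b")
  case True
  have lim: "(\<lambda>n. flat_poly 1 (real (Suc n) * t)) \<longlonglongrightarrow> 1" if "t > 0" for t
  proof -
    have "(\<lambda>n. exp (- (1 / t * inverse (real (Suc n))))) \<longlonglongrightarrow> exp (- (1 / t * 0))"
      by (intro tendsto_intros LIMSEQ_inverse_real_of_nat)
    moreover have "flat_poly 1 (real (Suc n) * t) = exp (- (1 / t * inverse (real (Suc n))))" for n
    proof -
      have "0 < real (Suc n) * t" using that by simp
      moreover have "1 / (real (Suc n) * t) = 1 / t * inverse (real (Suc n))" by (simp add: divide_inverse mult.commute)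
      ultimately show ?thesis by (simp add: flat_poly_def del: of_nat_Suc)
    qed
    ultimately show ?thesis by simp
  qed
  have "(\<lambda>n. box_bump a b n x) \<longlonglongrightarrow> (\<Prod>i\<in>(UNIV :: 'n set). 1 * 1)"
    unfolding box_bump_def using True by (intro tendsto_prod tendsto_mult lim) (auto simp: mem_box_cart)
  thus ?thesis using True by simp
next
  case False
  hence "box_bump a b n x = 0" for n using box_bump_support by blast
  thus ?thesis using False by simp
qed

lemma continuous_box_bump: "continuous_on UNIV (box_bump a b n)"
  using test_function_box_bump[of a b n] unfolding test_function_def by (metis C_k.simps(1))

text \<open>
  The bumps converge boundedly to indicators of boxes, so \<open>\<psi>\<close> has integral
  \<open>0\<close> over every box. The measures with densities the positive and the negative
  part of \<open>\<psi>\<close> therefore agree on a generator.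
\<close>

theorem fundamental_lemma_calculus_of_variations:
  fixes \<psi> :: "real ^ 'n \<Rightarrow> real"
  assumes \<psi>[measurable]: "\<psi> \<in> borel_measurable borel"
    and loc: "\<And>a b. integrable lborel (\<lambda>x. indicator (box a b) x * \<psi> x)"
    and zero: "\<And>\<phi>. test_function \<phi> \<Longrightarrow> (LINT x|lborel. \<psi> x * \<phi> x) = 0"
  shows "AE x in lborel. \<psi> x = 0"
proof -
  have box0: "(LINT x|lborel. indicator (box a b) x * \<psi> x) = 0" for a b
  proof -
    have "(\<lambda>n. LINT x|lborel. \<psi> x * box_bump a b n x) \<longlonglongrightarrow> (LINT x|lborel. indicator (box a b) x * \<psi> x)"
    proof (rule integral_dominated_convergence[where w="\<lambda>x. \<bar>indicator (box a b) x * \<psi> x\<bar>"])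
      show "(\<lambda>x. \<psi> x * box_bump a b n x) \<in> borel_measurable lborel" for n
        using borel_measurable_continuous_onI[OF continuous_box_bump] by measurable
      show "integrable lborel (\<lambda>x. \<bar>indicator (box a b) x * \<psi> x\<bar>)" using loc by (rule integrable_abs)
      show "AE x in lborel. (\<lambda>n. \<psi> x * box_bump a b n x) \<longlonglongrightarrow> indicator (box a b) x * \<psi> x"
        by (subst mult.commute) (auto intro!: tendsto_mult box_bump_tendsto_indicator)
      show "AE x in lborel. norm (\<psi> x * box_bump a b n x) \<le> \<bar>indicator (box a b) x * \<psi> x\<bar>" for n
      proof (rule AE_I2)
        fix x
        show "norm (\<psi> x * box_bump a b n x) \<le> \<bar>indicator (box a b) x * \<psi> x\<bar>"
        proof (cases "x \<in> box a b")
          case True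
          thus ?thesis using box_bump_bounds[of a b n x] by (simp add: abs_mult mult_left_le)
        next
          case False
          hence "box_bump a b n x = 0" using box_bump_support by blast
          thus ?thesis by simp
        qed
      qed
    qed measurable
    moreover have "(LINT x|lborel. \<psi> x * box_bump a b n x) = 0" for n
      by (rule zero) (rule test_function_box_bump)
    ultimately show ?thesis by (simp add: LIMSEQ_const_iff)
  qed
  let ?P = "density lborel (\<lambda>x. ennreal (\<psi> x))" and ?M = "density lborel (\<lambda>x. ennreal (- \<psi> x))"
  have em: "emeasure ?P (box a b) = emeasure ?M (box a b) \<and> emeasure ?P (box a b) \<noteq> \<infinity>" for a b
  proof -
    let ?w = "\<lambda>x. indicator (box a b) x * \<psi> x"
    have P: "emeasure ?P (box a b) = (\<integral>\<^sup>+x. ennreal (?w x) \<partial>lborel)"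
      by (subst emeasure_density) (auto intro!: nn_integral_cong simp: indicator_def)
    have M: "emeasure ?M (box a b) = (\<integral>\<^sup>+x. ennreal (- ?w x) \<partial>lborel)"
      by (subst emeasure_density) (auto intro!: nn_integral_cong simp: indicator_def)
    have fin: "(\<integral>\<^sup>+x. ennreal (?w x) \<partial>lborel) \<noteq> \<infinity>" "(\<integral>\<^sup>+x. ennreal (- ?w x) \<partial>lborel) \<noteq> \<infinity>"
      using loc[of a b] by (auto simp: real_integrable_def)
    have "enn2real (\<integral>\<^sup>+x. ennreal (?w x) \<partial>lborel) = enn2real (\<integral>\<^sup>+x. ennreal (- ?w x) \<partial>lborel)"
      using box0[of a b] real_lebesgue_integral_def[OF loc[of a b]] by simp
    hence "(\<integral>\<^sup>+x. ennreal (?w x) \<partial>lborel) = (\<integral>\<^sup>+x. ennreal (- ?w x) \<partial>lborel)"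
      using fin by (auto dest!: arg_cong[where f=ennreal] simp: less_top)
    thus ?thesis using P M fin by simp
  qed
  have "?P = ?M"
  proof (rule measure_eqI_generator_eq)
    let ?E = "range (\<lambda>(a, b). box a b :: (real ^ 'n) set)"
    show "Int_stable ?E" by (auto simp: Int_stable_def box_Int_box)
    show "?E \<subseteq> Pow UNIV" by simp
    have b: "sets borel = sigma_sets UNIV ?E" by (subst borel_eq_box) simp
    show "sets ?P = sigma_sets UNIV ?E" "sets ?M = sigma_sets UNIV ?E"
      by (simp_all only: sets_density sets_lborel b)
    let ?A = "\<lambda>n::nat. box (- (real n *\<^sub>R One)) (real n *\<^sub>R One) :: (real ^ 'n) set"
    show "range ?A \<subseteq> ?E" "(\<Union>i. ?A i) = UNIV" unfolding UN_box_eq_UNIV by auto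
    show "emeasure ?P (?A i) \<noteq> \<infinity>" for i using em by blast
    show "emeasure ?P X = emeasure ?M X" if "X \<in> ?E" for X using that em by auto
  qed
  hence "AE x in lborel. ennreal (\<psi> x) = ennreal (- \<psi> x)"
    by (intro sigma_finite_measure.density_unique[OF sigma_finite_lborel]) measurable
  thus ?thesis
  proof eventually_elim
    case (elim x)
    thus ?case by (cases "\<psi> x \<ge> 0") (auto simp: ennreal_neg ennreal_eq_0_iff dest: sym)
  qed
qed

section \<open>Test functions and segments\<close>

lemma partial_deriv_translate:
  assumes "\<And>x. \<phi> differentiable (at x)"
  shows "partial_deriv i (\<lambda>x. \<phi> (x - a)) x = partial_deriv i \<phi> (x - a)"
proof -
  have D: "((\<lambda>x. \<phi> (x - a)) has_derivative frechet_derivative \<phi> (at (x - a))) (at x)"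
  proof (rule has_derivative_compose[where f="\<lambda>x. x - a" and g=\<phi> and f'="\<lambda>y. y", simplified])
    show "((\<lambda>x. x - a) has_derivative (\<lambda>y. y)) (at x)" by (auto intro!: derivative_eq_intros)
    show "(\<phi> has_derivative frechet_derivative \<phi> (at (x - a))) (at (x - a))"
      using assms frechet_derivative_works by auto
  qed
  show ?thesis unfolding partial_deriv_def frechet_derivative_at[OF D, symmetric] ..
qed

lemma C_k_translate: "C_k k \<phi> \<Longrightarrow> C_k k (\<lambda>x. \<phi> (x - a))"
proof (induction k arbitrary: \<phi>)
  case 0
  thus ?case by (auto intro!: continuous_on_compose2[of UNIV \<phi>] continuous_intros)
next
  case (Suc k)
  hence diff: "\<And>x. \<phi> differentiable (at x)" by simp
  have "(\<lambda>x. \<phi> (x - a)) differentiable (at x)" for x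
    by (rule differentiable_chain_at[where f="\<lambda>x. x - a" and g=\<phi>, unfolded o_def])
       (auto intro!: derivative_intros diff)
  moreover have "partial_deriv i (\<lambda>x. \<phi> (x - a)) = (\<lambda>x. partial_deriv i \<phi> (x - a))" for i
    using partial_deriv_translate[OF diff] by blast
  ultimately show ?case using Suc by simp
qed

lemma test_function_translate:
  assumes "test_function \<phi>"
  shows "test_function (\<lambda>x. \<phi> (x - a))"
  unfolding test_function_def
proof
  show "\<forall>k. C_k k (\<lambda>x. \<phi> (x - a))" using assms C_k_translate by (auto simp: test_function_def)
  have K: "compact (closure {x. \<phi> x \<noteq> 0})" using assms by (simp add: test_function_def)
  have K': "compact ((+) a ` closure {x. \<phi> x \<noteq> 0})" by (rule compact_translation[OF K])
  have "{x. \<phi> (x - a) \<noteq> 0} \<subseteq> (+) a ` closure {x. \<phi> x \<noteq> 0}"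
  proof
    fix x assume "x \<in> {x. \<phi> (x - a) \<noteq> 0}"
    hence "x - a \<in> closure {x. \<phi> x \<noteq> 0}" by (intro subsetD[OF closure_subset]) simp
    thus "x \<in> (+) a ` closure {x. \<phi> x \<noteq> 0}" by (auto intro!: image_eqI[of _ _ "x - a"])
  qed
  hence "bounded {x. \<phi> (x - a) \<noteq> 0}" by (rule bounded_subset[OF compact_imp_bounded[OF K']])
  thus "compact (closure {x. \<phi> (x - a) \<noteq> 0})" by (simp only: compact_closure)
qed

lemma test_function_differentiable: "test_function \<phi> \<Longrightarrow> \<phi> differentiable (at x)"
  by (auto simp: test_function_def dest: spec[of _ "Suc 0"])

lemma test_function_partial_deriv:
  assumes "test_function \<phi>"
  shows "test_function (partial_deriv i \<phi>)"
  unfolding test_function_def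
proof
  have "C_k (Suc k) \<phi>" for k using assms by (simp add: test_function_def)
  thus "\<forall>k. C_k k (partial_deriv i \<phi>)" by simp
  have K: "compact (closure {x. \<phi> x \<noteq> 0})" using assms by (simp add: test_function_def)
  have "{x. partial_deriv i \<phi> x \<noteq> 0} \<subseteq> closure {x. \<phi> x \<noteq> 0}"
  proof (rule ccontr)
    assume "\<not> ?thesis"
    then obtain x where x: "partial_deriv i \<phi> x \<noteq> 0" "x \<in> - closure {x. \<phi> x \<noteq> 0}" by auto
    have "(\<phi> has_derivative (\<lambda>_. 0)) (at x)"
    proof (rule has_derivative_transform_within_open[where s="- closure {x. \<phi> x \<noteq> 0}" and f="\<lambda>_. 0"])
      show "0 = \<phi> z" if "z \<in> - closure {x. \<phi> x \<noteq> 0}" for z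
        using that subsetD[OF closure_subset, of z "{x. \<phi> x \<noteq> 0}"] by auto
    qed (use x in auto)
    from frechet_derivative_at[OF this] have "partial_deriv i \<phi> x = 0" by (metis partial_deriv_def)
    thus False using x by simp
  qed
  hence "bounded {x. partial_deriv i \<phi> x \<noteq> 0}" by (rule bounded_subset[OF compact_imp_bounded[OF K]])
  thus "compact (closure {x. partial_deriv i \<phi> x \<noteq> 0})" by (simp only: compact_closure)
qed

lemma test_function_continuous: "test_function \<phi> \<Longrightarrow> continuous_on UNIV \<phi>"
  unfolding test_function_def by (metis C_k.simps(1))

lemma test_function_borel: "test_function \<phi> \<Longrightarrow> \<phi> \<in> borel_measurable borel"
  by (rule borel_measurable_continuous_onI) (rule test_function_continuous)

lemma test_function_square_integrable:
  assumes "test_function \<phi>"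
  shows "integrable lborel (\<lambda>x. (\<phi> x)\<^sup>2)"
proof -
  let ?K = "closure {x. \<phi> x \<noteq> 0}"
  have "continuous_on ?K (\<lambda>x. (\<phi> x)\<^sup>2)"
    using test_function_continuous[OF assms] by (intro continuous_intros) (auto intro: continuous_on_subset)
  moreover have "compact ?K" using assms by (simp add: test_function_def)
  ultimately have "integrable lborel (\<lambda>x. indicator ?K x *\<^sub>R (\<phi> x)\<^sup>2)" by (rule borel_integrable_compact[rotated])
  moreover have "(\<lambda>x. indicator ?K x *\<^sub>R (\<phi> x)\<^sup>2) = (\<lambda>x. (\<phi> x)\<^sup>2)"
  proof
    fix x
    show "indicator ?K x *\<^sub>R (\<phi> x)\<^sup>2 = (\<phi> x)\<^sup>2"
      using closure_subset[of "{x. \<phi> x \<noteq> 0}"] by (cases "\<phi> x = 0") (auto simp: indicator_def)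
  qed
  ultimately show ?thesis by simp
qed

lemma integrable_mult_L2:
  fixes f g :: "'a \<Rightarrow> real"
  assumes [measurable]: "f \<in> borel_measurable M" "g \<in> borel_measurable M"
    and "integrable M (\<lambda>x. (f x)\<^sup>2)" "integrable M (\<lambda>x. (g x)\<^sup>2)"
  shows "integrable M (\<lambda>x. f x * g x)"
proof (rule Bochner_Integration.integrable_bound)
  show "integrable M (\<lambda>x. (f x)\<^sup>2 + (g x)\<^sup>2)" using assms by simp
  show "AE x in M. norm (f x * g x) \<le> norm ((f x)\<^sup>2 + (g x)\<^sup>2)"
  proof (rule AE_I2)
    fix x
    have "2 * (\<bar>f x\<bar> * \<bar>g x\<bar>) \<le> (f x)\<^sup>2 + (g x)\<^sup>2"
      using sum_squares_bound[of "\<bar>f x\<bar>" "\<bar>g x\<bar>"] by (simp add: mult.assoc)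
    moreover have "0 \<le> \<bar>f x\<bar> * \<bar>g x\<bar>" by simp
    ultimately have "\<bar>f x\<bar> * \<bar>g x\<bar> \<le> (f x)\<^sup>2 + (g x)\<^sup>2" by linarith
    thus "norm (f x * g x) \<le> norm ((f x)\<^sup>2 + (g x)\<^sup>2)" by (simp add: abs_mult)
  qed
qed measurable

lemma lborel_translate:
  fixes f :: "'a::euclidean_space \<Rightarrow> real"
  assumes [measurable]: "f \<in> borel_measurable borel"
  shows "(LINT x|lborel. f (x + a)) = (LINT x|lborel. f x)"
    and "integrable lborel (\<lambda>x. f (x + a)) \<longleftrightarrow> integrable lborel f"
proof -
  have 1: "(LINT x|distr lborel borel ((+) a). f x) = (LINT x|lborel. f (a + x))"
    by (rule integral_distr) measurable
  have 2: "integrable (distr lborel borel ((+) a)) f \<longleftrightarrow> integrable lborel (\<lambda>x. f (a + x))"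
    by (rule integrable_distr_eq) measurable
  show "(LINT x|lborel. f (x + a)) = (LINT x|lborel. f x)"
    using 1 by (simp add: lborel_distr_plus add.commute)
  show "integrable lborel (\<lambda>x. f (x + a)) \<longleftrightarrow> integrable lborel f"
    using 2 by (simp add: lborel_distr_plus add.commute)
qed

text \<open>
  Absolute integrability over \<open>(x, t)\<close> is what allows the average over the segment
  to be exchanged with the pairing against \<open>q\<close>.
\<close>

lemma integrable_segment_pairing:
  fixes p q :: "'a::euclidean_space \<Rightarrow> real"
  assumes p[measurable]: "p \<in> borel_measurable borel" and q[measurable]: "q \<in> borel_measurable borel"
    and p2: "integrable lborel (\<lambda>x. (p x)\<^sup>2)" and q2: "integrable lborel (\<lambda>x. (q x)\<^sup>2)"
  shows "integrable (lborel \<Otimes>\<^sub>M lborel) (\<lambda>(x, t). indicator {0..1::real} t * (p (x + t *\<^sub>R h) * q x))"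
proof (rule integrableI_bounded)
  show "(\<lambda>(x, t). indicator {0..1::real} t * (p (x + t *\<^sub>R h) * q x)) \<in> borel_measurable (lborel \<Otimes>\<^sub>M lborel)"
    by measurable
  define A where "A = (\<integral>\<^sup>+x. ennreal ((p x)\<^sup>2) \<partial>lborel) + (\<integral>\<^sup>+x. ennreal ((q x)\<^sup>2) \<partial>lborel)"
  have A: "A < \<infinity>"
    using p2 q2 by (simp add: A_def nn_integral_eq_integral)
  have "(\<integral>\<^sup>+z. ennreal (norm (case z of (x, t) \<Rightarrow> indicator {0..1::real} t * (p (x + t *\<^sub>R h) * q x))) \<partial>(lborel \<Otimes>\<^sub>M lborel))
    = (\<integral>\<^sup>+t. \<integral>\<^sup>+x. ennreal (norm (indicator {0..1::real} t * (p (x + t *\<^sub>R h) * q x))) \<partial>lborel \<partial>lborel)"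
    by (subst lborel_pair.nn_integral_snd[symmetric]) (auto simp: split_beta')
  also have "\<dots> \<le> (\<integral>\<^sup>+t. A * indicator {0..1::real} t \<partial>lborel)"
  proof (rule nn_integral_mono)
    fix t :: real
    show "(\<integral>\<^sup>+x. ennreal (norm (indicator {0..1::real} t * (p (x + t *\<^sub>R h) * q x))) \<partial>lborel) \<le> A * indicator {0..1} t"
    proof (cases "t \<in> {0..1}")
      case True
      have "(\<integral>\<^sup>+x. ennreal (norm (indicator {0..1::real} t * (p (x + t *\<^sub>R h) * q x))) \<partial>lborel)
        \<le> (\<integral>\<^sup>+x. ennreal ((p (x + t *\<^sub>R h))\<^sup>2) + ennreal ((q x)\<^sup>2) \<partial>lborel)"
      proof (rule nn_integral_mono)
        fix x
        let ?f = "p (x + t *\<^sub>R h)"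
        have "2 * (\<bar>?f\<bar> * \<bar>q x\<bar>) \<le> ?f\<^sup>2 + (q x)\<^sup>2"
          using sum_squares_bound[of "\<bar>?f\<bar>" "\<bar>q x\<bar>"] by (simp add: mult.assoc)
        moreover have "0 \<le> \<bar>?f\<bar> * \<bar>q x\<bar>" by simp
        ultimately have "\<bar>?f\<bar> * \<bar>q x\<bar> \<le> ?f\<^sup>2 + (q x)\<^sup>2" by linarith
        hence "norm (indicator {0..1::real} t * (?f * q x)) \<le> ?f\<^sup>2 + (q x)\<^sup>2"
          using True by (simp add: abs_mult)
        thus "ennreal (norm (indicator {0..1::real} t * (?f * q x))) \<le> ennreal (?f\<^sup>2) + ennreal ((q x)\<^sup>2)"
          by (simp add: ennreal_plus[symmetric] ennreal_leI del: ennreal_plus)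
      qed
      also have "\<dots> = (\<integral>\<^sup>+x. ennreal ((p (x + t *\<^sub>R h))\<^sup>2) \<partial>lborel) + (\<integral>\<^sup>+x. ennreal ((q x)\<^sup>2) \<partial>lborel)"
        by (rule nn_integral_add) measurable
      also have "(\<integral>\<^sup>+x. ennreal ((p (x + t *\<^sub>R h))\<^sup>2) \<partial>lborel) = (\<integral>\<^sup>+x. ennreal ((p x)\<^sup>2) \<partial>lborel)"
        by (rule nn_integral_translate) measurable
      finally show ?thesis using True by (simp add: A_def)
    qed simp
  qed
  also have "\<dots> = A" by (simp add: nn_integral_cmult)
  finally show "(\<integral>\<^sup>+z. ennreal (norm (case z of (x, t) \<Rightarrow> indicator {0..1::real} t * (p (x + t *\<^sub>R h) * q x))) \<partial>(lborel \<Otimes>\<^sub>M lborel)) < \<infinity>"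
    using A by simp
qed

lemma segment_pairing_swap:
  fixes p q :: "'a::euclidean_space \<Rightarrow> real"
  assumes p[measurable]: "p \<in> borel_measurable borel" and q[measurable]: "q \<in> borel_measurable borel"
    and p2: "integrable lborel (\<lambda>x. (p x)\<^sup>2)" and q2: "integrable lborel (\<lambda>x. (q x)\<^sup>2)"
  shows "integrable lborel (\<lambda>x. (LINT t|lborel. indicator {0..1} t * p (x + t *\<^sub>R h)) * q x)"
    and "(LINT x|lborel. (LINT t|lborel. indicator {0..1} t * p (x + t *\<^sub>R h)) * q x)
      = (LINT t|lborel. indicator {0..1} t * (LINT x|lborel. p (x + t *\<^sub>R h) * q x))"
proof -
  note I = integrable_segment_pairing[OF assms, of h]
  have e: "(LINT t|lborel. indicator {0..1} t * (p (x + t *\<^sub>R h) * q x))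
    = (LINT t|lborel. indicator {0..1} t * p (x + t *\<^sub>R h)) * q x" for x
    by (simp add: mult.assoc[symmetric])
  show "integrable lborel (\<lambda>x. (LINT t|lborel. indicator {0..1} t * p (x + t *\<^sub>R h)) * q x)"
    using lborel_pair.integrable_fst[OF I] by (simp add: e)
  show "(LINT x|lborel. (LINT t|lborel. indicator {0..1} t * p (x + t *\<^sub>R h)) * q x)
      = (LINT t|lborel. indicator {0..1} t * (LINT x|lborel. p (x + t *\<^sub>R h) * q x))"
    using lborel_pair.Fubini_integral[OF I] by (simp add: e)
qed

lemma test_function_segment:
  assumes \<phi>: "test_function \<phi>"
  shows "\<phi> (x - h) - \<phi> x = (LINT t|lborel. indicator {0..1} t * (\<Sum>i\<in>UNIV. - (h $ i) * partial_deriv i \<phi> (x + t *\<^sub>R (- h))))"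
proof -
  let ?D = "\<lambda>t::real. \<Sum>i\<in>UNIV. - (h $ i) * partial_deriv i \<phi> (x + t *\<^sub>R (- h))"
  have d: "((\<lambda>t. \<phi> (x + t *\<^sub>R (- h))) has_real_derivative ?D t) (at t)" for t
  proof -
    let ?y = "x + t *\<^sub>R (- h)"
    let ?L = "frechet_derivative \<phi> (at ?y)"
    have L: "(\<phi> has_derivative ?L) (at ?y)"
      using test_function_differentiable[OF \<phi>] frechet_derivative_works by blast
    interpret linear ?L using L by (rule has_derivative_linear)
    have "((\<lambda>t. x + t *\<^sub>R (- h)) has_derivative (\<lambda>s. s *\<^sub>R (- h))) (at t)"
      by (auto intro!: derivative_eq_intros)
    from has_derivative_compose[OF this L]
    have "((\<lambda>t. \<phi> (x + t *\<^sub>R (- h))) has_derivative (\<lambda>s. ?L (s *\<^sub>R (- h)))) (at t)" .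
    moreover have "?L (s *\<^sub>R (- h)) = ?D t * s" for s
    proof -
      have "- h = (\<Sum>i\<in>UNIV. (- (h $ i)) *\<^sub>R axis i 1)"
        by (simp add: vec_eq_iff axis_def if_distrib[where f="\<lambda>c. _ * c"] if_distrib[where f=uminus] cong: if_cong)
      hence "?L (- h) = ?L (\<Sum>i\<in>UNIV. (- (h $ i)) *\<^sub>R axis i 1)" by simp
      also have "\<dots> = ?D t" by (simp only: sum scale partial_deriv_def real_scaleR_def)
      finally show ?thesis by (simp only: scale) simp
    qed
    ultimately show ?thesis by (simp add: has_field_derivative_def)
  qed
  have c: "isCont ?D t" for t
  proof -
    have "continuous_on UNIV (\<lambda>t::real. partial_deriv i \<phi> (x + t *\<^sub>R (- h)))" for i
    proof (rule continuous_on_compose2[OF test_function_continuous[OF test_function_partial_deriv[OF \<phi>]]])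
      show "continuous_on UNIV (\<lambda>t::real. x + t *\<^sub>R (- h))" by (intro continuous_intros)
    qed simp
    hence "continuous_on UNIV ?D" by (intro continuous_on_sum continuous_on_mult continuous_on_const)
    thus ?thesis by (simp add: continuous_on_eq_continuous_at)
  qed
  have "(LINT t|lborel. ?D t * indicator {0..1} t) = \<phi> (x + 1 *\<^sub>R (- h)) - \<phi> (x + 0 *\<^sub>R (- h))"
    by (rule integral_FTC_Icc_real[OF _ d c]) simp
  thus ?thesis by (simp add: mult.commute)
qed

section \<open>Weak gradients along segments\<close>

lemma square_integrable_component:
  fixes g :: "real ^ 'n \<Rightarrow> real ^ 'n"
  assumes "square_integrable g"
  shows "(\<lambda>x. g x \<bullet> h) \<in> borel_measurable borel" "integrable lborel (\<lambda>x. (g x \<bullet> h)\<^sup>2)"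
proof -
  have [measurable]: "g \<in> borel_measurable borel" using assms by (simp add: square_integrable_def)
  show "(\<lambda>x. g x \<bullet> h) \<in> borel_measurable borel" by measurable
  show "integrable lborel (\<lambda>x. (g x \<bullet> h)\<^sup>2)"
  proof (rule Bochner_Integration.integrable_bound)
    show "integrable lborel (\<lambda>x. (norm (g x))\<^sup>2 * (norm h)\<^sup>2)"
      using assms by (simp add: square_integrable_def)
    have "(g x \<bullet> h)\<^sup>2 \<le> (norm (g x))\<^sup>2 * (norm h)\<^sup>2" for x
      using Cauchy_Schwarz_ineq2[of "g x" h] by (metis abs_ge_zero power2_abs power_mono power_mult_distrib)
    thus "AE x in lborel. norm ((g x \<bullet> h)\<^sup>2) \<le> norm ((norm (g x))\<^sup>2 * (norm h)\<^sup>2)" by simp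
  qed measurable
qed

lemma square_integrable_real:
  fixes u :: "real ^ 'n \<Rightarrow> real"
  assumes "square_integrable u"
  shows "u \<in> borel_measurable borel" "integrable lborel (\<lambda>x. (u x)\<^sup>2)"
  using assms by (simp_all add: square_integrable_def)

lemma integrable_box_indicator_square:
  "integrable lborel (\<lambda>x. (indicator (box a b) x :: real)\<^sup>2)"
proof -
  have "(\<lambda>x. (indicator (box a b) x :: real)\<^sup>2) = indicator (box a b)" by (auto simp: indicator_def)
  thus ?thesis using emeasure_lborel_box_finite[of a b] by simp
qed

text \<open>
  Against a test function \<open>\<phi>\<close>, the increment of \<open>u\<close> turns into an
  increment of \<open>\<phi>\<close>, which is an integral of derivatives of translates of
  \<open>\<phi>\<close>; the definition of the weak gradient moves these derivatives back to
  \<open>u\<close>, one \<open>t\<close> at a time. Both sides thus have the same pairing with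
  every test function.
\<close>

theorem weak_gradient_segment:
  fixes u :: "real ^ 'n \<Rightarrow> real" and h :: "real ^ 'n"
  assumes u: "square_integrable u" and g: "square_integrable g" and w: "weak_gradient u g"
  shows "AE x in lborel. u (x + h) - u x = (LINT t|lborel. indicator {0..1} t * (g (x + t *\<^sub>R h) \<bullet> h))"
proof -
  note um[measurable] = square_integrable_real(1)[OF u] and u2 = square_integrable_real(2)[OF u]
  have gm0[measurable]: "g \<in> borel_measurable borel" using g by (simp add: square_integrable_def)
  note gm = square_integrable_component(1)[OF g] and g2 = square_integrable_component(2)[OF g]
  define J where "J x = (LINT t|lborel. indicator {0..1} t * (g (x + t *\<^sub>R h) \<bullet> h))" for x
  have J[measurable]: "J \<in> borel_measurable borel" unfolding J_def by measurable
  have uh2: "integrable lborel (\<lambda>x. (u (x + h))\<^sup>2)"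
    using u2 lborel_translate(2)[of "\<lambda>x. (u x)\<^sup>2" h] by simp
  have I: "integrable lborel (\<lambda>x. u (x + h) * q x)" "integrable lborel (\<lambda>x. u x * q x)" "integrable lborel (\<lambda>x. J x * q x)"
    if [measurable]: "q \<in> borel_measurable borel" and q: "integrable lborel (\<lambda>x. (q x)\<^sup>2)" for q
    unfolding J_def
    by (rule integrable_mult_L2[OF _ _ uh2 q], simp, simp, rule integrable_mult_L2[OF _ _ u2 q], simp, simp,
        rule segment_pairing_swap(1)[OF gm that(1) g2 q])
  have "AE x in lborel. u (x + h) - u x - J x = 0"
  proof (rule fundamental_lemma_calculus_of_variations)
    show "(\<lambda>x. u (x + h) - u x - J x) \<in> borel_measurable borel" by measurable
  next
    fix a b :: "real ^ 'n"
    have b: "indicator (box a b) \<in> borel_measurable borel" by (simp add: borel_measurable_indicator)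
    have "integrable lborel (\<lambda>x. u (x + h) * indicator (box a b) x - u x * indicator (box a b) x - J x * indicator (box a b) x)"
      by (intro Bochner_Integration.integrable_diff I b integrable_box_indicator_square)
    thus "integrable lborel (\<lambda>x. indicator (box a b) x * (u (x + h) - u x - J x))"
      by (simp add: algebra_simps)
  next
    fix \<phi> :: "real ^ 'n \<Rightarrow> real" assume \<phi>: "test_function \<phi>"
    have \<phi>m[measurable]: "\<phi> \<in> borel_measurable borel" by (rule test_function_borel[OF \<phi>])
    have \<phi>2: "integrable lborel (\<lambda>x. (\<phi> x)\<^sup>2)" by (rule test_function_square_integrable[OF \<phi>])
    note pm[measurable] = test_function_borel[OF test_function_partial_deriv[OF \<phi>]]
    have p2: "integrable lborel (\<lambda>x. (partial_deriv i \<phi> x)\<^sup>2)" for i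
      by (intro test_function_square_integrable test_function_partial_deriv \<phi>)
    have tr: "test_function (\<lambda>x. \<phi> (x + t *\<^sub>R (- h)))" for t
      using test_function_translate[OF \<phi>, of "t *\<^sub>R h"] by simp
    have ptr: "partial_deriv i (\<lambda>x. \<phi> (x + t *\<^sub>R (- h))) x = partial_deriv i \<phi> (x + t *\<^sub>R (- h))" for i t x
      using partial_deriv_translate[OF test_function_differentiable[OF \<phi>], of i "t *\<^sub>R h" x] by simp
    let ?S = "\<lambda>y. \<Sum>i\<in>UNIV. - (h $ i) * partial_deriv i \<phi> y"
    have Sm[measurable]: "?S \<in> borel_measurable borel" by measurable
    have S2: "integrable lborel (\<lambda>x. (?S x)\<^sup>2)"
    proof -
      have "integrable lborel (\<lambda>x. (\<Sum>i\<in>UNIV. \<Sum>j\<in>UNIV. (h $ i * h $ j) * (partial_deriv i \<phi> x * partial_deriv j \<phi> x)))"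
        by (intro Bochner_Integration.integrable_sum integrable_mult_right integrable_mult_L2 p2) simp_all
      thus ?thesis by (simp add: power2_eq_square sum_product mult_ac)
    qed
    \<comment> \<open>the weak derivative of a translate, tested against the translated test function\<close>
    have step: "(LINT x|lborel. ?S (x + t *\<^sub>R (- h)) * u x) = (LINT x|lborel. (g (x + t *\<^sub>R h) \<bullet> h) * \<phi> x)" for t :: real
    proof -
      have L2t: "integrable lborel (\<lambda>x. (\<phi> (x + t *\<^sub>R (- h)))\<^sup>2)"
        by (rule test_function_square_integrable[OF tr])
      have gi: "integrable lborel (\<lambda>x. g x $ i * \<phi> (x + t *\<^sub>R (- h)))" for i
      proof -
        have "integrable lborel (\<lambda>x. (g x \<bullet> axis i 1) * \<phi> (x + t *\<^sub>R (- h)))"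
          by (rule integrable_mult_L2[OF _ _ square_integrable_component(2)[OF g] L2t]) measurable
        thus ?thesis by (simp add: inner_axis)
      qed
      have pi: "integrable lborel (\<lambda>x. partial_deriv i \<phi> (x + t *\<^sub>R (- h)) * u x)" for i
      proof (rule integrable_mult_L2[OF _ _ _ u2])
        show "integrable lborel (\<lambda>x. (partial_deriv i \<phi> (x + t *\<^sub>R (- h)))\<^sup>2)"
          using p2[of i] lborel_translate(2)[of "\<lambda>x. (partial_deriv i \<phi> x)\<^sup>2" "t *\<^sub>R (- h)"] by simp
      qed measurable
      have "(LINT x|lborel. ?S (x + t *\<^sub>R (- h)) * u x)
        = (LINT x|lborel. (\<Sum>i\<in>UNIV. - (h $ i) * (partial_deriv i \<phi> (x + t *\<^sub>R (- h)) * u x)))"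
        by (simp add: sum_distrib_right mult.assoc)
      also have "\<dots> = (\<Sum>i\<in>UNIV. - (h $ i) * (LINT x|lborel. u x * partial_deriv i (\<lambda>x. \<phi> (x + t *\<^sub>R (- h))) x))"
        using pi by (subst Bochner_Integration.integral_sum) (auto simp: ptr[simplified] mult.commute[of "u _"])
      also have "\<dots> = (\<Sum>i\<in>UNIV. h $ i * (LINT x|lborel. g x $ i * \<phi> (x + t *\<^sub>R (- h))))"
        using w tr[of t] unfolding weak_gradient_def by (intro sum.cong refl) simp
      also have "\<dots> = (LINT x|lborel. (\<Sum>i\<in>UNIV. h $ i * (g x $ i * \<phi> (x + t *\<^sub>R (- h)))))"
        using gi by (subst Bochner_Integration.integral_sum) auto
      also have "\<dots> = (LINT x|lborel. (g x \<bullet> h) * \<phi> (x + t *\<^sub>R (- h)))"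
        by (simp add: inner_vec_def sum_distrib_right sum_distrib_left mult_ac)
      also have "\<dots> = (LINT x|lborel. (g (x + t *\<^sub>R h) \<bullet> h) * \<phi> (x + t *\<^sub>R h + t *\<^sub>R (- h)))"
        by (rule lborel_translate(1)[symmetric]) measurable
      finally show ?thesis by simp
    qed
    \<comment> \<open>Shift the increment from \<open>u\<close> to \<open>\<phi>\<close>, write it as an
        integral over the segment, and apply the preceding step for each \<open>t\<close>.\<close>
    have "(LINT x|lborel. (u (x + h) - u x) * \<phi> x) = (LINT x|lborel. u (x + h) * \<phi> (x + h - h)) - (LINT x|lborel. u x * \<phi> x)"
      using I[OF \<phi>m \<phi>2] by (simp add: left_diff_distrib)
    also have "(LINT x|lborel. u (x + h) * \<phi> (x + h - h)) = (LINT x|lborel. u x * \<phi> (x - h))"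
      by (rule lborel_translate(1)) measurable
    also have "(LINT x|lborel. u x * \<phi> (x - h)) - (LINT x|lborel. u x * \<phi> x) = (LINT x|lborel. u x * \<phi> (x - h) - u x * \<phi> x)"
    proof (rule Bochner_Integration.integral_diff[symmetric])
      show "integrable lborel (\<lambda>x. u x * \<phi> (x - h))"
        by (rule integrable_mult_L2[OF _ _ u2 test_function_square_integrable[OF test_function_translate[OF \<phi>]]]) measurable
      show "integrable lborel (\<lambda>x. u x * \<phi> x)" by (rule I[OF \<phi>m \<phi>2])
    qed
    also have "\<dots> = (LINT x|lborel. (LINT t|lborel. indicator {0..1} t * ?S (x + t *\<^sub>R (- h))) * u x)"
      unfolding test_function_segment[OF \<phi>, of _ h, symmetric]
      by (rule Bochner_Integration.integral_cong) (simp_all add: algebra_simps)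
    also have "\<dots> = (LINT t|lborel. indicator {0..1} t * (LINT x|lborel. ?S (x + t *\<^sub>R (- h)) * u x))"
      by (rule segment_pairing_swap(2)[OF Sm um S2 u2])
    also have "\<dots> = (LINT t|lborel. indicator {0..1} t * (LINT x|lborel. (g (x + t *\<^sub>R h) \<bullet> h) * \<phi> x))"
      by (simp only: step)
    also have "\<dots> = (LINT x|lborel. J x * \<phi> x)"
      unfolding J_def by (rule segment_pairing_swap(2)[OF gm \<phi>m g2 \<phi>2, symmetric])
    finally have "(LINT x|lborel. (u (x + h) - u x) * \<phi> x) = (LINT x|lborel. J x * \<phi> x)" .
    thus "(LINT x|lborel. (u (x + h) - u x - J x) * \<phi> x) = 0"
      using I[OF \<phi>m \<phi>2] by (simp add: left_diff_distrib)
  qed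
  thus ?thesis by (simp add: J_def)
qed

lemma weak_gradient_unique:
  fixes u :: "real ^ 'n \<Rightarrow> real"
  assumes g: "square_integrable g" "weak_gradient u g" and g': "square_integrable g'" "weak_gradient u g'"
  shows "AE x in lborel. g x = g' x"
proof -
  have "AE x in lborel. g x $ i - g' x $ i = 0" for i
  proof (rule fundamental_lemma_calculus_of_variations)
    note m[measurable] = square_integrable_component(1)[OF g(1), of "axis i 1", simplified inner_axis]
      square_integrable_component(1)[OF g'(1), of "axis i 1", simplified inner_axis]
    note s = square_integrable_component(2)[OF g(1), of "axis i 1", simplified inner_axis]
      square_integrable_component(2)[OF g'(1), of "axis i 1", simplified inner_axis]
    have I: "integrable lborel (\<lambda>x. g x $ i * q x)" "integrable lborel (\<lambda>x. g' x $ i * q x)"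
      if "q \<in> borel_measurable borel" "integrable lborel (\<lambda>x. (q x)\<^sup>2)" for q
      using integrable_mult_L2[of "\<lambda>x. g x $ i" lborel q] integrable_mult_L2[of "\<lambda>x. g' x $ i" lborel q] that m s
      by simp_all
    show "(\<lambda>x. g x $ i - g' x $ i) \<in> borel_measurable borel" using m by simp
    show "integrable lborel (\<lambda>x. indicator (box a b) x * (g x $ i - g' x $ i))" for a b
    proof -
      have b: "indicator (box a b) \<in> borel_measurable borel" by (simp add: borel_measurable_indicator)
      have "integrable lborel (\<lambda>x. g x $ i * indicator (box a b) x - g' x $ i * indicator (box a b) x)"
        by (intro Bochner_Integration.integrable_diff I b integrable_box_indicator_square)
      thus ?thesis by (simp add: algebra_simps)
    qed
    show "(LINT x|lborel. (g x $ i - g' x $ i) * \<phi> x) = 0" if \<phi>: "test_function \<phi>" for \<phi>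
    proof -
      have "(LINT x|lborel. g x $ i * \<phi> x) = (LINT x|lborel. g' x $ i * \<phi> x)"
        using g(2)[unfolded weak_gradient_def, rule_format, OF \<phi>, of i]
          g'(2)[unfolded weak_gradient_def, rule_format, OF \<phi>, of i] by simp
      thus ?thesis using I[OF test_function_borel[OF \<phi>] test_function_square_integrable[OF \<phi>]]
        by (simp add: left_diff_distrib)
    qed
  qed
  hence "AE x in lborel. \<forall>i. g x $ i - g' x $ i = 0" by (simp add: AE_all_countable)
  thus ?thesis by eventually_elim (simp add: vec_eq_iff)
qed

lemma H1_grad:
  assumes "u \<in> H1"
  shows "square_integrable u" "square_integrable (grad u)" "weak_gradient u (grad u)"
proof -
  have "\<exists>g. square_integrable g \<and> weak_gradient u g" using assms by (simp add: H1_def)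
  hence "square_integrable (grad u) \<and> weak_gradient u (grad u)" unfolding grad_def by (rule someI_ex)
  thus "square_integrable (grad u)" "weak_gradient u (grad u)" by auto
  show "square_integrable u" using assms by (simp add: H1_def)
qed

lemma square_integrable_scaleR: "square_integrable g \<Longrightarrow> square_integrable (\<lambda>x. c *\<^sub>R g x)"
  by (auto simp: square_integrable_def power_mult_distrib)

lemma weak_gradient_scale: "weak_gradient u g \<Longrightarrow> weak_gradient (\<lambda>x. c * u x) (\<lambda>x. c *\<^sub>R g x)"
  by (simp add: weak_gradient_def mult.assoc)

lemma H1_scale: "u \<in> H1 \<Longrightarrow> (\<lambda>x. c * u x) \<in> H1"
  using square_integrable_scaleR[OF H1_grad(1), of u c] square_integrable_scaleR[OF H1_grad(2), of u c]
    weak_gradient_scale[OF H1_grad(3), of u c]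
  by (auto simp: H1_def)

lemma L2_norm_nonneg: "0 \<le> L2_norm u"
  by (simp add: L2_norm_def)

lemma L2_norm_square: "(L2_norm u)\<^sup>2 = (LINT x|lborel. (norm (u x))\<^sup>2)"
  by (simp add: L2_norm_def)

lemma L2_norm_scaleR: "(L2_norm (\<lambda>x. c *\<^sub>R u x))\<^sup>2 = c\<^sup>2 * (L2_norm u)\<^sup>2"
  by (simp add: L2_norm_square power_mult_distrib)

lemma L2_norm_grad_scale:
  assumes u: "u \<in> H1"
  shows "(L2_norm (grad (\<lambda>x. c * u x)))\<^sup>2 = c\<^sup>2 * (L2_norm (grad u))\<^sup>2"
proof -
  have "AE x in lborel. grad (\<lambda>x. c * u x) x = c *\<^sub>R grad u x"
    by (intro weak_gradient_unique[of _ "\<lambda>x. c * u x"] H1_grad H1_scale u square_integrable_scaleR weak_gradient_scale)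
  hence "(LINT x|lborel. (norm (grad (\<lambda>x. c * u x) x))\<^sup>2) = (LINT x|lborel. (norm (c *\<^sub>R grad u x))\<^sup>2)"
    using H1_grad(2)[OF H1_scale[OF u, of c]] square_integrable_scaleR[OF H1_grad(2)[OF u], of c]
    by (intro integral_cong_AE) (auto simp: square_integrable_def)
  thus ?thesis using L2_norm_scaleR[of c "grad u"] by (simp add: L2_norm_square)
qed

lemma gagliardo_form_scale: "gagliardo_form s (\<lambda>x. c * u x) (\<lambda>x. c * u x) = c\<^sup>2 * gagliardo_form s u u"
proof -
  have "(\<lambda>(x, y). (c * u x - c * u y) * (c * u x - c * u y) / norm (x - y) powr (real CARD('a) + 2 * s))
     = (\<lambda>z. c\<^sup>2 * (case z of (x, y) \<Rightarrow> (u x - u y) * (u x - u y) / norm (x - y) powr (real CARD('a) + 2 * s)))"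
    for u :: "real ^ 'a \<Rightarrow> real"
    by (auto simp: fun_eq_iff right_diff_distrib[symmetric] power2_eq_square)
  thus ?thesis unfolding gagliardo_form_def by simp
qed

lemma frac_const_nonneg: "0 \<le> frac_const TYPE('n::finite) s"
  unfolding frac_const_def by (intro inverse_nonnegative_iff_nonnegative[THEN iffD2] integral_nonneg) auto

lemma gagliardo_form_nonneg: "0 \<le> gagliardo_form s u u"
proof -
  have "0 \<le> (LINT (x, y)|(lborel \<Otimes>\<^sub>M lborel). (u x - u y) * (u x - u y) / norm (x - y) powr (real CARD('a) + 2 * s))"
    by (rule integral_nonneg_AE) (auto intro!: AE_I2 divide_nonneg_nonneg)
  thus ?thesis unfolding gagliardo_form_def using frac_const_nonneg by (intro mult_nonneg_nonneg) auto
qed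

lemma H1_norm_square: "(H1_norm s u)\<^sup>2 = (L2_norm (grad u))\<^sup>2 + (L2_norm u)\<^sup>2 + gagliardo_form s u u"
  unfolding H1_norm_def using gagliardo_form_nonneg[of s u] by simp

lemma H1_norm_nonneg: "0 \<le> H1_norm s u"
  unfolding H1_norm_def using gagliardo_form_nonneg[of s u] by simp

lemma H1_norm_scale:
  assumes "u \<in> H1"
  shows "H1_norm s (\<lambda>x. c * u x) = \<bar>c\<bar> * H1_norm s u"
proof (rule power2_eq_imp_eq)
  show "(H1_norm s (\<lambda>x. c * u x))\<^sup>2 = (\<bar>c\<bar> * H1_norm s u)\<^sup>2"
    using L2_norm_grad_scale[OF assms, of c] L2_norm_scaleR[of c u]
    by (simp add: H1_norm_square power_mult_distrib gagliardo_form_scale distrib_left)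
qed (auto simp: H1_norm_nonneg)

lemma L2_norm_le_H1_norm: "L2_norm u \<le> H1_norm s u"
  by (rule power2_le_imp_le[OF _ H1_norm_nonneg]) (simp add: H1_norm_square gagliardo_form_nonneg)

section \<open>Translation estimate and Sobolev embedding\<close>

lemma weak_gradient_increment_bound:
  fixes u :: "real ^ 'n \<Rightarrow> real" and h :: "real ^ 'n"
  assumes u: "square_integrable u" and g: "square_integrable g" and w: "weak_gradient u g"
  shows "AE x in lborel. ennreal \<bar>u (x + h) - u x\<bar>
    \<le> (\<integral>\<^sup>+t. indicator {0..1} t * ennreal (norm (g (x + t *\<^sub>R h)) * norm h) \<partial>(lborel :: real measure))"
  using weak_gradient_segment[OF assms, of h]
proof eventually_elim
  case (elim x)
  have [measurable]: "g \<in> borel_measurable borel" using g by (simp add: square_integrable_def)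
  let ?k = "\<lambda>t::real. indicator {0..1} t * (g (x + t *\<^sub>R h) \<bullet> h)"
  have "ennreal \<bar>u (x + h) - u x\<bar> = ennreal (norm (LINT t|lborel. ?k t))" using elim by simp
  also have "\<dots> \<le> (\<integral>\<^sup>+t. ennreal (norm (?k t)) \<partial>lborel)"
  proof (cases "integrable lborel ?k")
    case True thus ?thesis by (rule integral_norm_bound_ennreal)
  qed (simp add: not_integrable_integral_eq)
  also have "\<dots> \<le> (\<integral>\<^sup>+t. indicator {0..1} t * ennreal (norm (g (x + t *\<^sub>R h)) * norm h) \<partial>lborel)"
    by (rule nn_integral_mono) (auto simp: indicator_def abs_mult intro!: ennreal_leI Cauchy_Schwarz_ineq2)
  finally show ?case .
qed

text \<open>
  Cauchy-Schwarz on the segment, then translation invariance for each \<open>t\<close>.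
\<close>

theorem H1_translation_estimate:
  fixes u :: "real ^ 'n \<Rightarrow> real" and h :: "real ^ 'n"
  assumes u: "square_integrable u" and g: "square_integrable g" and w: "weak_gradient u g"
  shows "(\<integral>\<^sup>+x. ennreal ((u (x + h) - u x)\<^sup>2) \<partial>lborel)
    \<le> ennreal ((norm h)\<^sup>2) * (\<integral>\<^sup>+x. ennreal ((norm (g x))\<^sup>2) \<partial>lborel)"
proof -
  have gm[measurable]: "g \<in> borel_measurable borel" using g by (simp add: square_integrable_def)
  let ?i = "\<lambda>t::real. indicator {0..1} t :: ennreal"
  let ?f = "\<lambda>x t. ennreal (norm (g (x + t *\<^sub>R h)) * norm h)"
  have "(\<integral>\<^sup>+x. ennreal ((u (x + h) - u x)\<^sup>2) \<partial>lborel) \<le> (\<integral>\<^sup>+x. \<integral>\<^sup>+t. ?i t * (?f x t)\<^sup>2 \<partial>lborel \<partial>lborel)"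
  proof (rule nn_integral_mono_AE, use weak_gradient_increment_bound[OF assms, of h] in eventually_elim)
    case (elim x)
    have "ennreal ((u (x + h) - u x)\<^sup>2) = (ennreal \<bar>u (x + h) - u x\<bar>)\<^sup>2"
      by (simp add: ennreal_power)
    also have "\<dots> \<le> (\<integral>\<^sup>+t. ?i t * (?i t * ?f x t) \<partial>lborel)\<^sup>2"
    proof (rule power_mono)
      have "?i t * (?i t * ?f x t) = ?i t * ?f x t" for t by (simp add: indicator_def)
      thus "ennreal \<bar>u (x + h) - u x\<bar> \<le> (\<integral>\<^sup>+t. ?i t * (?i t * ?f x t) \<partial>lborel)" using elim by simp
    qed simp
    also have "\<dots> \<le> (\<integral>\<^sup>+t. (?i t)\<^sup>2 \<partial>lborel) * (\<integral>\<^sup>+t. (?i t * ?f x t)\<^sup>2 \<partial>lborel)"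
      by (rule Cauchy_Schwarz_nn_integral) measurable
    also have "(\<integral>\<^sup>+t. (?i t)\<^sup>2 \<partial>lborel) = (\<integral>\<^sup>+t. ?i t \<partial>lborel)"
      by (rule nn_integral_cong) (simp add: indicator_def)
    also have "(\<integral>\<^sup>+t. (?i t * ?f x t)\<^sup>2 \<partial>lborel) = (\<integral>\<^sup>+t. ?i t * (?f x t)\<^sup>2 \<partial>lborel)"
      by (rule nn_integral_cong) (simp add: indicator_def)
    finally show ?case by simp
  qed
  also have "\<dots> = (\<integral>\<^sup>+t. \<integral>\<^sup>+x. ?i t * (?f x t)\<^sup>2 \<partial>lborel \<partial>lborel)"
    by (rule lborel_pair.Fubini'[symmetric]) measurable
  also have "\<dots> = (\<integral>\<^sup>+t. ?i t * (ennreal ((norm h)\<^sup>2) * (\<integral>\<^sup>+x. ennreal ((norm (g x))\<^sup>2) \<partial>lborel)) \<partial>lborel)"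
  proof (rule nn_integral_cong)
    fix t :: real
    have "(\<integral>\<^sup>+x. ?i t * (?f x t)\<^sup>2 \<partial>lborel) = (\<integral>\<^sup>+x. ?i t * (ennreal ((norm h)\<^sup>2) * ennreal ((norm (g (x + t *\<^sub>R h)))\<^sup>2)) \<partial>lborel)"
      by (intro nn_integral_cong) (simp add: ennreal_power power_mult_distrib ennreal_mult[symmetric] mult.commute)
    also have "\<dots> = ?i t * (ennreal ((norm h)\<^sup>2) * (\<integral>\<^sup>+x. ennreal ((norm (g (x + t *\<^sub>R h)))\<^sup>2) \<partial>lborel))"
      by (simp add: nn_integral_cmult)
    also have "(\<integral>\<^sup>+x. ennreal ((norm (g (x + t *\<^sub>R h)))\<^sup>2) \<partial>lborel) = (\<integral>\<^sup>+x. ennreal ((norm (g x))\<^sup>2) \<partial>lborel)"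
      by (rule nn_integral_translate) measurable
    finally show "(\<integral>\<^sup>+x. ?i t * (?f x t)\<^sup>2 \<partial>lborel) = ?i t * (ennreal ((norm h)\<^sup>2) * (\<integral>\<^sup>+x. ennreal ((norm (g x))\<^sup>2) \<partial>lborel))" .
  qed
  also have "\<dots> = ennreal ((norm h)\<^sup>2) * (\<integral>\<^sup>+x. ennreal ((norm (g x))\<^sup>2) \<partial>lborel)"
    by (simp add: nn_integral_multc)
  finally show ?thesis .
qed

lemma nn_integral_negative_power_tail:
  fixes a m :: real
  assumes a: "a > 0" and m: "m \<ge> 1"
  shows "(\<integral>\<^sup>+t. ennreal (t powr (- m - 1)) * indicator {a..} t \<partial>lborel) \<le> ennreal (a powr (- m))"
proof -
  have "(\<integral>\<^sup>+t. ennreal (t powr (- m - 1)) * indicator {a..} t \<partial>lborel) = ennreal (0 - (- (a powr (- m) / m)))"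
  proof (rule nn_integral_FTC_atLeast)
    show "((\<lambda>t. - (t powr (- m) / m)) has_real_derivative t powr (- m - 1)) (at t)" if "a \<le> t" for t
      using that a m by (auto intro!: derivative_eq_intros simp: field_simps)
    have "((\<lambda>t. t powr (- m)) \<longlongrightarrow> 0) at_top"
      by (rule tendsto_neg_powr) (use m filterlim_ident in auto)
    hence "((\<lambda>t. - (t powr (- m) / m)) \<longlongrightarrow> - (0 / m)) at_top"
      using m by (intro tendsto_minus tendsto_divide tendsto_const) auto
    thus "((\<lambda>t. - (t powr (- m) / m)) \<longlongrightarrow> 0) at_top" by simp
  qed auto
  also have "\<dots> \<le> ennreal (a powr (- m))" using m mult_left_mono[of 1 m "a powr (- m)"] by (intro ennreal_leI) (simp add: divide_le_eq)
  finally show ?thesis .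
qed

text \<open>
  For fixed \<open>t\<close> substitute \<open>z = t h\<close>. After exchanging the integrals,
  a given \<open>z\<close> is reached exactly for \<open>t > \<bar>z\<bar>/R\<close>, and the
  integral of \<open>t\<close> to the power \<open>-N-1\<close> over this range produces the
  kernel.
\<close>

lemma cone_average_bound:
  fixes G :: "'a::euclidean_space \<Rightarrow> real" and x :: 'a
  assumes G[measurable]: "G \<in> borel_measurable borel" and G0: "\<And>y. 0 \<le> G y" and R: "R > 0"
  shows "(\<integral>\<^sup>+h. indicator (ball 0 R) h * (\<integral>\<^sup>+t. indicator {0..1} t * ennreal (G (x + t *\<^sub>R h) * norm h) \<partial>(lborel :: real measure)) \<partial>lborel)
    \<le> ennreal (R powr real DIM('a)) * (\<integral>\<^sup>+z. ennreal (norm (x - z) powr (1 - real DIM('a)) * G z) \<partial>lborel)"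
proof -
  let ?N = "real DIM('a)"
  let ?i = "\<lambda>t::real. indicator {0..1} t :: ennreal"
  have "(\<integral>\<^sup>+h. indicator (ball 0 R) h * (\<integral>\<^sup>+t. ?i t * ennreal (G (x + t *\<^sub>R h) * norm h) \<partial>lborel) \<partial>lborel)
    = (\<integral>\<^sup>+h. \<integral>\<^sup>+t. indicator (ball 0 R) h * (?i t * ennreal (G (x + t *\<^sub>R h) * norm h)) \<partial>lborel \<partial>lborel)"
    by (simp add: nn_integral_cmult)
  also have "\<dots> = (\<integral>\<^sup>+t. \<integral>\<^sup>+h. indicator (ball 0 R) h * (?i t * ennreal (G (x + t *\<^sub>R h) * norm h)) \<partial>lborel \<partial>lborel)"
    by (rule lborel_pair.Fubini'[symmetric]) measurable
  also have "\<dots> \<le> (\<integral>\<^sup>+t. \<integral>\<^sup>+z. ennreal (G (x + z) * norm z) * (ennreal (t powr (- ?N - 1)) * indicator {norm z / R..} t) \<partial>lborel \<partial>lborel)"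
  proof (rule nn_integral_mono_AE, use AE_lborel_singleton[of "0::real"] in eventually_elim)
    case (elim t)
    show ?case
    proof (cases "t \<in> {0..1}")
      case True
      hence t: "t > 0" using elim by simp
      let ?f = "\<lambda>z. indicator (ball 0 (t * R)) z * ennreal (G (x + z) * (norm z / t))"
      have f: "(\<integral>\<^sup>+z. ?f z \<partial>lborel) = ennreal (t ^ DIM('a)) * (\<integral>\<^sup>+h. ?f (t *\<^sub>R h) \<partial>lborel)"
        by (rule nn_integral_scale[OF _ t]) measurable
      have "(\<integral>\<^sup>+h. indicator (ball 0 R) h * (?i t * ennreal (G (x + t *\<^sub>R h) * norm h)) \<partial>lborel) = (\<integral>\<^sup>+h. ?f (t *\<^sub>R h) \<partial>lborel)"
        using True t by (intro nn_integral_cong) (auto simp: indicator_def)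
      also have "\<dots> = ennreal (t powr (- ?N)) * (ennreal (t ^ DIM('a)) * (\<integral>\<^sup>+h. ?f (t *\<^sub>R h) \<partial>lborel))"
      proof -
        have "t powr (- ?N) * t ^ DIM('a) = 1" using t by (simp add: powr_minus powr_realpow)
        hence "ennreal (t powr (- ?N)) * ennreal (t ^ DIM('a)) = 1" using t by (simp add: ennreal_mult[symmetric])
        thus ?thesis by (simp add: mult.assoc[symmetric])
      qed
      also have "\<dots> = ennreal (t powr (- ?N)) * (\<integral>\<^sup>+z. ?f z \<partial>lborel)" unfolding f ..
      also have "\<dots> = (\<integral>\<^sup>+z. ennreal (t powr (- ?N)) * ?f z \<partial>lborel)"
        by (rule nn_integral_cmult[symmetric]) measurable
      also have "\<dots> \<le> (\<integral>\<^sup>+z. ennreal (G (x + z) * norm z) * (ennreal (t powr (- ?N - 1)) * indicator {norm z / R..} t) \<partial>lborel)"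
      proof (rule nn_integral_mono)
        fix z
        have e: "t powr (- ?N) * (G (x + z) * (norm z / t)) = G (x + z) * norm z * t powr (- ?N - 1)"
          using t by (simp add: powr_diff)
        show "ennreal (t powr (- ?N)) * ?f z \<le> ennreal (G (x + z) * norm z) * (ennreal (t powr (- ?N - 1)) * indicator {norm z / R..} t)"
        proof (cases "norm z < t * R")
          case True
          hence "norm z / R \<le> t" using R by (simp add: divide_le_eq)
          thus ?thesis using True G0 t e by (simp add: ennreal_mult[symmetric])
        qed simp
      qed
      finally show ?thesis .
    qed simp
  qed
  also have "\<dots> = (\<integral>\<^sup>+z. \<integral>\<^sup>+t. ennreal (G (x + z) * norm z) * (ennreal (t powr (- ?N - 1)) * indicator {norm z / R..} t) \<partial>lborel \<partial>lborel)"
  proof (rule lborel_pair.Fubini'[symmetric])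
    have "(\<lambda>(t, z). ennreal (G (x + z) * norm z) * (ennreal (t powr (- ?N - 1)) * (if norm z / R \<le> t then 1 else 0)))
       \<in> borel_measurable (lborel \<Otimes>\<^sub>M lborel)" by measurable
    thus "(\<lambda>(t, z). ennreal (G (x + z) * norm z) * (ennreal (t powr (- ?N - 1)) * indicator {norm z / R..} t))
       \<in> borel_measurable (lborel \<Otimes>\<^sub>M lborel)" by (simp add: indicator_def)
  qed
  also have "\<dots> \<le> (\<integral>\<^sup>+z. ennreal (R powr ?N) * ennreal (norm z powr (1 - ?N) * G (z + x)) \<partial>lborel)"
  proof (rule nn_integral_mono)
    fix z
    show "(\<integral>\<^sup>+t. ennreal (G (x + z) * norm z) * (ennreal (t powr (- ?N - 1)) * indicator {norm z / R..} t) \<partial>lborel)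
      \<le> ennreal (R powr ?N) * ennreal (norm z powr (1 - ?N) * G (z + x))"
    proof (cases "z = 0")
      case False
      have N1: "?N \<ge> 1" using DIM_positive[where 'a='a] by linarith
      have "(\<integral>\<^sup>+t. ennreal (G (x + z) * norm z) * (ennreal (t powr (- ?N - 1)) * indicator {norm z / R..} t) \<partial>lborel)
        = ennreal (G (x + z) * norm z) * (\<integral>\<^sup>+t. ennreal (t powr (- ?N - 1)) * indicator {norm z / R..} t \<partial>lborel)"
        by (rule nn_integral_cmult) measurable
      also have "\<dots> \<le> ennreal (G (x + z) * norm z) * ennreal ((norm z / R) powr (- ?N))"
        using False R N1 by (intro mult_left_mono nn_integral_negative_power_tail) auto
      also have "\<dots> = ennreal (G (x + z) * norm z * (norm z / R) powr (- ?N))"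
        using G0 by (simp add: ennreal_mult[symmetric])
      also have "G (x + z) * norm z * (norm z / R) powr (- ?N) = R powr ?N * (norm z powr (1 - ?N) * G (z + x))"
        using False R by (simp add: powr_divide powr_minus powr_diff field_simps add.commute)
      finally show ?thesis using G0 by (simp add: ennreal_mult[symmetric])
    qed simp
  qed
  also have "\<dots> = ennreal (R powr ?N) * (\<integral>\<^sup>+z. ennreal (norm (z + x - x) powr (1 - ?N) * G (z + x)) \<partial>lborel)"
    by (simp add: nn_integral_cmult)
  also have "(\<integral>\<^sup>+z. ennreal (norm (z + x - x) powr (1 - ?N) * G (z + x)) \<partial>lborel)
     = (\<integral>\<^sup>+z. ennreal (norm (z - x) powr (1 - ?N) * G z) \<partial>lborel)"
    by (rule nn_integral_translate(1)[where f="\<lambda>z. ennreal (norm (z - x) powr (1 - ?N) * G z)"]) measurable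
  finally show ?thesis by (simp add: norm_minus_commute)
qed

text \<open>
  Average \<open>\<bar>u(x)\<bar> \<le> \<bar>u(x + h)\<bar> + \<bar>u(x + h) -
  u(x)\<bar>\<close> over all \<open>h\<close> in a ball of radius \<open>R\<close>. The first
  average is at most a multiple of the \<open>L\<^sup>2\<close> norm of \<open>u\<close> that
  vanishes as \<open>R\<close> grows, and the second is bounded by the potential of the gradient
  uniformly in \<open>R\<close>.
\<close>

theorem H1_potential_bound:
  fixes u :: "real ^ 'n \<Rightarrow> real"
  assumes u: "square_integrable u" and g: "square_integrable g" and w: "weak_gradient u g"
  obtains K where "K \<ge> 0" "AE x in lborel. ennreal \<bar>u x\<bar>
    \<le> ennreal K * (\<integral>\<^sup>+z. ennreal (norm (x - z) powr (1 - real DIM(real ^ 'n)) * norm (g z)) \<partial>lborel)"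
proof -
  let ?N = "real DIM(real ^ 'n)"
  note um[measurable] = square_integrable_real(1)[OF u] and u2 = square_integrable_real(2)[OF u]
  have gm[measurable]: "g \<in> borel_measurable borel" using g by (simp add: square_integrable_def)
  define W where "W x h = (\<integral>\<^sup>+t. indicator {0..1} t * ennreal (norm (g (x + t *\<^sub>R h)) * norm h) \<partial>(lborel :: real measure))" for x h
  have W[measurable]: "(\<lambda>(x, h). W x h) \<in> borel_measurable (lborel \<Otimes>\<^sub>M lborel)" unfolding W_def by measurable
  define V where "V = measure lborel (ball (0 :: real ^ 'n) 1)"
  have V: "V > 0" unfolding V_def by (rule content_ball_pos) simp
  define U where "U = (LINT x|lborel. (u x)\<^sup>2)"
  have U: "(\<integral>\<^sup>+x. ennreal ((u x)\<^sup>2) \<partial>lborel) = ennreal U" "U \<ge> 0"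
    using nn_integral_eq_integral[OF u2] by (simp_all add: U_def)
  let ?\<Phi> = "\<lambda>x. \<integral>\<^sup>+z. ennreal (norm (x - z) powr (1 - ?N) * norm (g z)) \<partial>lborel"
  have "AE h in lborel. AE x in lborel. ennreal \<bar>u x\<bar> \<le> ennreal \<bar>u (x + h)\<bar> + W x h"
  proof (rule AE_I2)
    fix h :: "real ^ 'n"
    show "AE x in lborel. ennreal \<bar>u x\<bar> \<le> ennreal \<bar>u (x + h)\<bar> + W x h"
      using weak_gradient_increment_bound[OF assms, of h]
    proof eventually_elim
      case (elim x)
      have "ennreal \<bar>u x\<bar> \<le> ennreal (\<bar>u (x + h)\<bar> + \<bar>u (x + h) - u x\<bar>)" by (intro ennreal_leI) simp
      also have "\<dots> = ennreal \<bar>u (x + h)\<bar> + ennreal \<bar>u (x + h) - u x\<bar>" by simp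
      also have "\<dots> \<le> ennreal \<bar>u (x + h)\<bar> + W x h" using elim unfolding W_def by (intro add_left_mono)
      finally show ?case .
    qed
  qed
  hence "AE x in lborel. AE h in lborel. ennreal \<bar>u x\<bar> \<le> ennreal \<bar>u (x + h)\<bar> + W x h"
    by (subst lborel_pair.AE_commute) measurable
  hence "AE x in lborel. ennreal \<bar>u x\<bar> \<le> ennreal (1 / V) * ?\<Phi> x"
  proof eventually_elim
    case (elim x)
    show ?case
    proof (cases "?\<Phi> x = \<infinity>")
      case True thus ?thesis using V by (simp add: ennreal_mult_eq_top_iff)
    next
      case False
      then obtain \<phi> where \<phi>: "\<phi> \<ge> 0" "?\<Phi> x = ennreal \<phi>" by (cases "?\<Phi> x") auto
      have key: "\<bar>u x\<bar> \<le> sqrt (U / (V * R ^ DIM(real ^ 'n))) + \<phi> / V" if R: "R > 0" for R :: real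
      proof -
        let ?v = "V * R ^ DIM(real ^ 'n)"
        have v: "?v > 0" using V R by simp
        let ?b = "\<lambda>h. indicator (ball (0 :: real ^ 'n) R) h :: ennreal"
        have bv: "(\<integral>\<^sup>+h. ?b h \<partial>lborel) = ennreal ?v"
          using R content_ball_conv_unit_ball[of R "0 :: real ^ 'n"] emeasure_lborel_ball_finite[of "0 :: real ^ 'n" R]
          by (simp add: emeasure_eq_ennreal_measure V_def mult.commute)
        define S where "S = (\<integral>\<^sup>+h. ?b h * ennreal \<bar>u (x + h)\<bar> \<partial>lborel)"
        have "S\<^sup>2 \<le> (\<integral>\<^sup>+h. (?b h)\<^sup>2 \<partial>lborel) * (\<integral>\<^sup>+h. (ennreal \<bar>u (x + h)\<bar>)\<^sup>2 \<partial>lborel)"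
          unfolding S_def by (rule Cauchy_Schwarz_nn_integral) measurable
        also have "(\<integral>\<^sup>+h. (?b h)\<^sup>2 \<partial>lborel) = (\<integral>\<^sup>+h. ?b h \<partial>lborel)" by (rule nn_integral_cong) (simp add: indicator_def)
        also have "(\<integral>\<^sup>+h. (ennreal \<bar>u (x + h)\<bar>)\<^sup>2 \<partial>lborel) = (\<integral>\<^sup>+h. ennreal ((u (x + h))\<^sup>2) \<partial>lborel)"
          by (rule nn_integral_cong) (simp add: ennreal_power)
        also have "\<dots> = ennreal U" using nn_integral_translate(2)[of "\<lambda>x. ennreal ((u x)\<^sup>2)" x] U by simp
        finally have S2: "S\<^sup>2 \<le> ennreal (?v * U)" using bv v U by (simp add: ennreal_mult)
        hence "S\<^sup>2 < \<infinity>" using le_less_trans by fastforce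
        then obtain S' where S': "S' \<ge> 0" "S = ennreal S'" by (cases S) (auto simp: power2_eq_square ennreal_mult_eq_top_iff top_unique)
        have "S'\<^sup>2 \<le> ?v * U" using S2 S' U v by (simp add: ennreal_power ennreal_le_iff)
        hence S'': "S' \<le> sqrt (?v * U)" by (rule real_le_rsqrt)
        have "ennreal (\<bar>u x\<bar> * ?v) = (\<integral>\<^sup>+h. ennreal \<bar>u x\<bar> * ?b h \<partial>lborel)"
          using bv v by (simp add: nn_integral_cmult ennreal_mult)
        also have "\<dots> \<le> (\<integral>\<^sup>+h. ?b h * ennreal \<bar>u (x + h)\<bar> + ?b h * W x h \<partial>lborel)"
          by (rule nn_integral_mono_AE, use elim in eventually_elim)
             (simp add: mult.commute[of _ "?b _"] distrib_left[symmetric] mult_left_mono)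
        also have "\<dots> = S + (\<integral>\<^sup>+h. ?b h * W x h \<partial>lborel)"
          unfolding S_def by (rule nn_integral_add) measurable
        also have "\<dots> \<le> S + ennreal (R powr ?N) * ?\<Phi> x"
          unfolding W_def using R by (intro add_left_mono cone_average_bound) auto
        also have "\<dots> = ennreal (S' + R ^ DIM(real ^ 'n) * \<phi>)"
          using S' \<phi> R by (simp add: ennreal_mult powr_realpow)
        finally have "\<bar>u x\<bar> * ?v \<le> S' + R ^ DIM(real ^ 'n) * \<phi>"
          using S' \<phi> R by (subst (asm) ennreal_le_iff) auto
        hence "\<bar>u x\<bar> * ?v \<le> sqrt (?v * U) + R ^ DIM(real ^ 'n) * \<phi>" using S'' by linarith
        hence "\<bar>u x\<bar> \<le> (sqrt (?v * U) + R ^ DIM(real ^ 'n) * \<phi>) / ?v"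
          using v by (simp add: pos_le_divide_eq)
        also have "\<dots> = sqrt (?v * U) / ?v + \<phi> / V" using R V by (simp add: add_divide_distrib)
        also have "sqrt (?v * U) / ?v = sqrt (U / ?v)"
        proof -
          have "U / ?v = (?v * U) / ?v\<^sup>2" using v by (simp add: power2_eq_square)
          hence "sqrt (U / ?v) = sqrt (?v * U) / sqrt (?v\<^sup>2)" by (simp only: real_sqrt_divide)
          thus ?thesis using v by simp
        qed
        finally show ?thesis .
      qed
      have "(\<lambda>n. sqrt (U / (V * real (Suc n) ^ DIM(real ^ 'n))) + \<phi> / V) \<longlonglongrightarrow> sqrt (U / V * 0 ^ DIM(real ^ 'n)) + \<phi> / V"
      proof -
        have "(\<lambda>n. sqrt (U / V * inverse (real (Suc n)) ^ DIM(real ^ 'n)) + \<phi> / V) \<longlonglongrightarrow> sqrt (U / V * 0 ^ DIM(real ^ 'n)) + \<phi> / V"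
          by (intro tendsto_intros LIMSEQ_inverse_real_of_nat)
        thus ?thesis by (simp add: divide_inverse power_inverse mult.assoc del: of_nat_Suc)
      qed
      hence "\<bar>u x\<bar> \<le> sqrt (U / V * 0 ^ DIM(real ^ 'n)) + \<phi> / V"
        by (rule LIMSEQ_le_const) (use key in auto)
      hence "\<bar>u x\<bar> \<le> 1 / V * \<phi>" by (simp add: zero_power)
      hence "ennreal \<bar>u x\<bar> \<le> ennreal (1 / V * \<phi>)" by (rule ennreal_leI)
      thus ?thesis using \<phi> V by (simp add: ennreal_mult[symmetric])
    qed
  qed
  thus thesis using V by (intro that[of "1 / V"]) auto
qed

theorem Sobolev_embedding:
  fixes u :: "real ^ 'n \<Rightarrow> real"
  assumes N: "3 \<le> CARD('n)" and u: "u \<in> H1"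
  shows "(\<integral>\<^sup>+x. ennreal (\<bar>u x\<bar> powr (2 * real CARD('n) / (real CARD('n) - 2))) \<partial>lborel) < \<infinity>"
proof -
  note H = H1_grad[OF u]
  obtain K where K: "K \<ge> 0" "AE x in lborel. ennreal \<bar>u x\<bar>
    \<le> ennreal K * (\<integral>\<^sup>+z. ennreal (norm (x - z) powr (1 - real DIM(real ^ 'n)) * norm (grad u z)) \<partial>lborel)"
    by (rule H1_potential_bound[OF H])
  have [measurable]: "u \<in> borel_measurable borel" "grad u \<in> borel_measurable borel"
    using H by (simp_all add: square_integrable_def)
  have fin: "(\<integral>\<^sup>+x. ennreal ((u x)\<^sup>2) \<partial>lborel) < \<infinity>" "(\<integral>\<^sup>+x. ennreal ((norm (grad u x))\<^sup>2) \<partial>lborel) < \<infinity>"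
    using H(1,2) by (simp_all add: square_integrable_def nn_integral_eq_integral)
  have "(\<integral>\<^sup>+x. ennreal (\<bar>u x\<bar> powr (2 * real DIM(real ^ 'n) / (real DIM(real ^ 'n) - 2))) \<partial>lborel) < \<infinity>"
    by (rule Sobolev_from_potential_bound[OF _ _ _ fin K(1) _ K(2)]) (use N in auto)
  thus ?thesis by simp
qed

section \<open>Convex nonlinearities\<close>

locale convex_nonlinearity =
  fixes F f :: "real \<Rightarrow> real" and k :: real
  assumes F_deriv: "\<And>t. (F has_real_derivative f t) (at t)"
    and f_mono: "mono f"
    and f_linear: "\<And>t. \<bar>f t\<bar> \<le> k * \<bar>t\<bar>"
    and F_0: "F 0 = 0"
begin

lemma f_0: "f 0 = 0"
  using f_linear[of 0] by simp

lemma tangent_below: "F a + (t - a) * f a \<le> F t"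
proof (cases a t rule: linorder_cases)
  case less
  then obtain z where "a < z" "z < t" "F t - F a = (t - a) * f z"
    using MVT2[of a t F f] F_deriv by blast
  moreover have "f a \<le> f z" using \<open>a < z\<close> f_mono by (simp add: monoD)
  hence "(t - a) * f a \<le> (t - a) * f z" using less by (intro mult_left_mono) auto
  ultimately show ?thesis by linarith
next
  case greater
  then obtain z where z: "t < z" "z < a" "F a - F t = (a - t) * f z"
    using MVT2[of t a F f] F_deriv by blast
  moreover have "f z \<le> f a" using \<open>z < a\<close> f_mono by (simp add: monoD)
  hence "(a - t) * f z \<le> (a - t) * f a" using greater by (intro mult_left_mono) auto
  ultimately have "F a - F t \<le> (a - t) * f a" by linarith
  thus ?thesis by (simp add: algebra_simps)
qed simp

lemma F_nonneg: "0 \<le> F t"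
  using tangent_below[of 0 t] by (simp add: F_0 f_0)

lemma F_le_tf: "F t \<le> t * f t"
  using tangent_below[of t 0] by (simp add: F_0)

lemma tf_nonneg: "0 \<le> t * f t"
  using F_le_tf[of t] F_nonneg[of t] by linarith

lemma F_borel [measurable]: "F \<in> borel_measurable borel"
  using F_deriv DERIV_isCont by (intro borel_measurable_continuous_onI) (auto simp: continuous_on_eq_continuous_at)

lemma f_borel [measurable]: "f \<in> borel_measurable borel"
  by (rule borel_measurable_mono) (rule f_mono)

text \<open>
  With \<open>P = a f(a) \<ge> F a\<close> and \<open>Q = b f(b) \<ge> F b\<close>, the tangents
  at \<open>a\<close> and \<open>b\<close> bound the two factors from below by \<open>F a + (t -
  1) P\<close> and \<open>F b + (t - 1) Q\<close>. If both bounds are nonnegative, multiply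
  them; the product exceeds the claim because \<open>P Q\<close> is at least the average of
  \<open>F a Q\<close> and \<open>P F b\<close>. If one is negative, which forces \<open>t <
  1\<close>, already the left-hand side is nonpositive.
\<close>

lemma ray_product_inequality:
  assumes t: "0 \<le> t"
  shows "F a * F b + (t\<^sup>2 - 1) / 2 * (F a * (b * f b) + (a * f a) * F b) \<le> F (t * a) * F (t * b)"
proof -
  define p q P Q where "p = F a" and "q = F b" and "P = a * f a" and "Q = b * f b"
  have pq: "0 \<le> p" "p \<le> P" "0 \<le> q" "q \<le> Q"
    by (auto simp: p_def q_def P_def Q_def F_nonneg F_le_tf)
  have la: "p + (t - 1) * P \<le> F (t * a)" and lb: "q + (t - 1) * Q \<le> F (t * b)"
    using tangent_below[of a "t * a"] tangent_below[of b "t * b"] by (simp_all add: p_def q_def P_def Q_def algebra_simps)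
  have "p * q + (t\<^sup>2 - 1) / 2 * (p * Q + P * q) \<le> F (t * a) * F (t * b)"
  proof (cases "0 \<le> p + (t - 1) * P \<and> 0 \<le> q + (t - 1) * Q")
    case True
    have "(p * Q + P * q) / 2 \<le> P * Q"
    proof -
      have avg: "(x + y) / 2 \<le> z" if "x \<le> z" "y \<le> z" for x y z :: real using that by simp
      show ?thesis using pq by (intro avg mult_right_mono mult_left_mono) auto
    qed
    hence "(t - 1)\<^sup>2 * ((p * Q + P * q) / 2) \<le> (t - 1)\<^sup>2 * (P * Q)"
      by (intro mult_left_mono) auto
    hence "p * q + (t\<^sup>2 - 1) / 2 * (p * Q + P * q) \<le> (p + (t - 1) * P) * (q + (t - 1) * Q)"
      by (simp add: power2_eq_square field_simps)
    also have "\<dots> \<le> F (t * a) * F (t * b)"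
      using True la lb by (intro mult_mono) auto
    finally show ?thesis .
  next
    case False
    have neg: "x * y + (t\<^sup>2 - 1) / 2 * (x * Y + X * y) \<le> 0"
      if xy: "0 \<le> x" "x \<le> X" "0 \<le> y" "y \<le> Y" and n: "x + (t - 1) * X < 0" for x y X Y :: real
    proof -
      have t1: "t < 1"
      proof (rule ccontr)
        assume "\<not> t < 1"
        hence "0 \<le> (t - 1) * X" using xy by simp
        thus False using n xy by linarith
      qed
      have t2: "t\<^sup>2 \<le> 1" using t t1 by (simp add: power_le_one)
      have "x \<le> (1 - t) * X" using n by (simp add: algebra_simps)
      hence "x * y \<le> (1 - t) * X * y" using xy by (intro mult_right_mono) auto
      hence "(1 + t) * (x * y) \<le> (1 + t) * ((1 - t) * X * y)" using t by (intro mult_left_mono) auto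
      also have "\<dots> = (1 - t\<^sup>2) * (X * y)" by (simp add: power2_eq_square algebra_simps)
      finally have 1: "(1 + t) * (x * y) \<le> (1 - t\<^sup>2) * (X * y)" .
      have 2: "(1 - t\<^sup>2) * (x * y) \<le> (1 - t\<^sup>2) * (x * Y)"
        using t2 xy by (intro mult_left_mono) auto
      have "(2 + t - t\<^sup>2) * (x * y) = (1 + t) * (x * y) + (1 - t\<^sup>2) * (x * y)" by (simp add: algebra_simps)
      also have "\<dots> \<le> (1 - t\<^sup>2) * (x * Y + X * y)" using 1 2 by (simp add: distrib_left)
      finally have 3: "(2 + t - t\<^sup>2) * (x * y) \<le> (1 - t\<^sup>2) * (x * Y + X * y)" .
      have "2 * (x * y) \<le> (2 + t - t\<^sup>2) * (x * y)"
        using t t1 xy by (intro mult_right_mono) (auto simp: power2_eq_square mult_left_le_one_le)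
      thus ?thesis using 3 by (simp add: algebra_simps diff_divide_distrib add_divide_distrib)
    qed
    have "p * q + (t\<^sup>2 - 1) / 2 * (p * Q + P * q) \<le> 0"
    proof (cases "p + (t - 1) * P < 0")
      case True thus ?thesis using neg pq by blast
    next
      case np: False
      hence "q + (t - 1) * Q < 0" using False by simp
      from neg[OF pq(3,4,1,2) this] show ?thesis by (simp add: mult.commute add.commute)
    qed
    also have "0 \<le> F (t * a) * F (t * b)" by (simp add: F_nonneg)
    finally show ?thesis .
  qed
  thus ?thesis by (simp add: p_def q_def P_def Q_def)
qed

lemma doubling: "2 * F a \<le> F (2 * a)" "2 * (a * f a) \<le> 2 * a * f (2 * a)"
proof -
  show "2 * F a \<le> F (2 * a)" using tangent_below[of a "2 * a"] F_le_tf[of a] by simp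
  show "2 * (a * f a) \<le> 2 * a * f (2 * a)"
  proof (cases "a \<ge> 0")
    case True
    hence "f a \<le> f (2 * a)" using f_mono by (simp add: monoD)
    thus ?thesis using True by (simp add: mult_left_mono)
  next
    case False
    hence "f (2 * a) \<le> f a" using f_mono by (simp add: monoD)
    thus ?thesis using False by (simp add: mult_left_mono_neg)
  qed
qed

text \<open>
  Equality would make \<open>F\<close> linear between \<open>0\<close> and \<open>a\<close>,
  contradicting \<open>F t = O(t\<^sup>2)\<close> at the origin.
\<close>

lemma doubling_strict:
  assumes "0 < F a"
  shows "2 * F a < F (2 * a)"
proof (rule ccontr)
  assume "\<not> ?thesis"
  hence eq: "F a = a * f a" using tangent_below[of a "2 * a"] F_le_tf[of a] by simp
  \<comment> \<open>If the tangent at \<open>a\<close> passes through the origin, \<open>F\<close> lies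
      above the chord \<open>t F a\<close>, but also below a multiple of
      \<open>t\<^sup>2\<close>.\<close>
  have bound: "F a \<le> t * (\<bar>k\<bar> * a\<^sup>2)" if t: "0 < t" for t
  proof -
    have "t * F a \<le> F (t * a)" using tangent_below[of a "t * a"] eq by (simp add: algebra_simps)
    also have "\<dots> \<le> t * a * f (t * a)" by (rule F_le_tf)
    also have "\<dots> \<le> \<bar>t * a\<bar> * \<bar>f (t * a)\<bar>" by (metis abs_ge_self abs_mult)
    also have "\<dots> \<le> \<bar>t * a\<bar> * (\<bar>k\<bar> * \<bar>t * a\<bar>)"
      using f_linear[of "t * a"] mult_right_mono[OF abs_ge_self[of k], of "\<bar>t * a\<bar>"]
      by (intro mult_left_mono) auto
    also have "\<dots> = t * (t * (\<bar>k\<bar> * a\<^sup>2))" using t by (simp add: abs_mult power2_eq_square)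
    finally show ?thesis using t by simp
  qed
  have "((\<lambda>t. t * (\<bar>k\<bar> * a\<^sup>2)) \<longlongrightarrow> 0 * (\<bar>k\<bar> * a\<^sup>2)) (at_right 0)"
    by (intro tendsto_intros)
  hence "F a \<le> 0 * (\<bar>k\<bar> * a\<^sup>2)"
  proof (rule tendsto_lowerbound)
    show "\<forall>\<^sub>F t in at_right 0. F a \<le> t * (\<bar>k\<bar> * a\<^sup>2)"
      using eventually_at_right_less[of 0] by eventually_elim (rule bound)
  qed simp
  thus False using assms by simp
qed

end

section \<open>The Choquard term on the Sobolev space\<close>

lemma riesz_const_pos:
  assumes "0 < \<alpha>" "\<alpha> < real N"
  shows "0 < riesz_const N \<alpha>"
  using assms unfolding riesz_const_def by (intro divide_pos_pos mult_pos_pos Gamma_real_pos) auto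

lemma riesz_potential_eq: "riesz_potential \<alpha> (z :: real ^ 'n) = riesz_const CARD('n) \<alpha> * norm z powr (\<alpha> - real CARD('n))"
  using powr_minus_divide[of "norm z" "real CARD('n) - \<alpha>"] by (simp add: riesz_potential_def)

lemma riesz_potential_borel [measurable]: "riesz_potential \<alpha> \<in> borel_measurable borel"
  unfolding riesz_potential_eq[abs_def] by measurable

lemma riesz_potential_even: "riesz_potential \<alpha> (y - x) = riesz_potential \<alpha> (x - y)"
  by (simp add: riesz_potential_eq norm_minus_commute)

text \<open>
  The exponents depend on the dimension, which is a type; the parameter \<open>dim\<close> only
  carries that type.
\<close>

locale choquard_nonlinearity = convex_nonlinearity F f k for F f k +
  fixes \<alpha> C :: real and dim :: "'n::finite itself"
  assumes N: "3 \<le> CARD('n)" and \<alpha>: "0 < \<alpha>" "\<alpha> < real CARD('n)"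
    and growth: "\<And>t. \<bar>t * f t\<bar> \<le> C * (\<bar>t\<bar> powr ((real CARD('n) + \<alpha>) / real CARD('n))
             + \<bar>t\<bar> powr ((real CARD('n) + \<alpha>) / (real CARD('n) - 2)))"
    and C_nonneg: "0 \<le> C"
begin

text \<open>
  The two growth exponents are those for which the power \<open>q = 2N/(N + \<alpha>)\<close>
  turns into the exponents \<open>2\<close> and \<open>2N/(N - 2)\<close>.
\<close>

lemma tf_Lq:
  fixes v :: "real ^ 'n \<Rightarrow> real"
  assumes v: "v \<in> H1"
  shows "(\<integral>\<^sup>+x. ennreal ((v x * f (v x)) powr (2 * real CARD('n) / (real CARD('n) + \<alpha>))) \<partial>lborel) < \<infinity>"
proof -
  let ?N = "real CARD('n)"
  define q where "q = 2 * ?N / (?N + \<alpha>)"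
  define a b where "a = (?N + \<alpha>) / ?N" and "b = (?N + \<alpha>) / (?N - 2)"
  have N3: "?N \<ge> 3" using N by simp
  have q: "q > 0" using N3 \<alpha> by (simp add: q_def)
  have aq: "a * q = 2"
  proof -
    have "a * q = (?N + \<alpha>) * (2 * ?N) / (?N * (?N + \<alpha>))" unfolding a_def q_def by (rule times_divide_times_eq)
    also have "\<dots> = 2" using N3 \<alpha> by (subst divide_eq_eq) simp
    finally show ?thesis .
  qed
  have bq: "b * q = 2 * ?N / (?N - 2)"
  proof -
    have "b * q = (?N + \<alpha>) * (2 * ?N) / ((?N - 2) * (?N + \<alpha>))" by (simp add: b_def q_def)
    also have "\<dots> = 2 * ?N / (?N - 2)" using N3 \<alpha> by simp
    finally show ?thesis .
  qed
  note [measurable] = square_integrable_real(1)[OF H1_grad(1)[OF v]]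
  have pw: "(t * f t) powr q \<le> (2 * C) powr q * (\<bar>t\<bar> powr 2 + \<bar>t\<bar> powr (2 * ?N / (?N - 2)))" for t
  proof -
    define m where "m = max (\<bar>t\<bar> powr a) (\<bar>t\<bar> powr b)"
    have m0: "0 \<le> m" by (simp add: m_def le_max_iff_disj)
    have "t * f t \<le> C * (\<bar>t\<bar> powr a + \<bar>t\<bar> powr b)" using growth[of t] by (simp add: a_def b_def)
    also have "\<dots> \<le> C * (2 * m)" using C_nonneg by (intro mult_left_mono) (auto simp: m_def)
    finally have "(t * f t) powr q \<le> (2 * C * m) powr q"
      using tf_nonneg q by (intro powr_mono2) auto
    also have "\<dots> = (2 * C) powr q * m powr q" using C_nonneg m0 by (simp add: powr_mult)
    also have "m powr q \<le> (\<bar>t\<bar> powr a) powr q + (\<bar>t\<bar> powr b) powr q" by (auto simp: m_def max_def)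
    also have "(\<bar>t\<bar> powr a) powr q = \<bar>t\<bar> powr 2" by (simp only: powr_powr aq)
    also have "(\<bar>t\<bar> powr b) powr q = \<bar>t\<bar> powr (2 * ?N / (?N - 2))" by (simp only: powr_powr bq)
    finally show ?thesis by (simp add: mult_left_mono)
  qed
  have "(\<integral>\<^sup>+x. ennreal ((v x * f (v x)) powr q) \<partial>lborel)
    \<le> (\<integral>\<^sup>+x. ennreal ((2 * C) powr q) * (ennreal ((v x)\<^sup>2) + ennreal (\<bar>v x\<bar> powr (2 * ?N / (?N - 2)))) \<partial>lborel)"
  proof (rule nn_integral_mono)
    fix x
    have "ennreal ((v x * f (v x)) powr q) \<le> ennreal ((2 * C) powr q * (\<bar>v x\<bar> powr 2 + \<bar>v x\<bar> powr (2 * ?N / (?N - 2))))"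
      by (rule ennreal_leI) (rule pw)
    thus "ennreal ((v x * f (v x)) powr q) \<le> ennreal ((2 * C) powr q) * (ennreal ((v x)\<^sup>2) + ennreal (\<bar>v x\<bar> powr (2 * ?N / (?N - 2))))"
      by (simp add: ennreal_mult)
  qed
  also have "\<dots> = ennreal ((2 * C) powr q) * ((\<integral>\<^sup>+x. ennreal ((v x)\<^sup>2) \<partial>lborel) + (\<integral>\<^sup>+x. ennreal (\<bar>v x\<bar> powr (2 * ?N / (?N - 2))) \<partial>lborel))"
    by (simp add: nn_integral_cmult nn_integral_add)
  also have "\<dots> < \<infinity>"
    using Sobolev_embedding[OF N v] square_integrable_real(2)[OF H1_grad(1)[OF v]]
    by (simp add: nn_integral_eq_integral ennreal_mult_less_top)
  finally show ?thesis by (simp add: q_def)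
qed

lemma tf_Riesz_energy_finite:
  fixes v :: "real ^ 'n \<Rightarrow> real"
  assumes v: "v \<in> H1"
  shows "(\<integral>\<^sup>+x. \<integral>\<^sup>+y. ennreal (norm (x - y) powr (\<alpha> - real CARD('n)) * (v x * f (v x)) * (v y * f (v y))) \<partial>lborel \<partial>lborel) < \<infinity>"
proof -
  let ?q = "2 * real CARD('n) / (real CARD('n) + \<alpha>)"
  note [measurable] = square_integrable_real(1)[OF H1_grad(1)[OF v]]
  have \<alpha>': "0 < \<alpha>" "\<alpha> < real DIM(real ^ 'n)" using \<alpha> by simp_all
  obtain M where M: "M \<ge> 0" "(\<integral>\<^sup>+x. ennreal ((v x * f (v x)) powr ?q) \<partial>lborel) = ennreal M"
    using tf_Lq[OF v] by (cases "\<integral>\<^sup>+x. ennreal ((v x * f (v x)) powr ?q) \<partial>lborel") auto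
  obtain B where B: "B \<ge> 0"
    "\<And>(g :: real ^ 'n \<Rightarrow> real) M. g \<in> borel_measurable borel \<Longrightarrow> (\<And>y. 0 \<le> g y) \<Longrightarrow> 0 < M \<Longrightarrow>
       (\<integral>\<^sup>+y. ennreal (g y powr (2 * real DIM(real ^ 'n) / (real DIM(real ^ 'n) + \<alpha>))) \<partial>lborel) \<le> ennreal M \<Longrightarrow>
       (\<integral>\<^sup>+x. \<integral>\<^sup>+y. ennreal (norm (x - y) powr (\<alpha> - real DIM(real ^ 'n)) * g x * g y) \<partial>lborel \<partial>lborel)
         \<le> ennreal (B * M powr (2 / (2 * real DIM(real ^ 'n) / (real DIM(real ^ 'n) + \<alpha>))))"
    apply (rule Hardy_Littlewood_Sobolev_diagonal[OF \<alpha>'])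
    subgoal premises p by (rule p(1)[OF p(2,3)])
    done
  have "(\<integral>\<^sup>+x. \<integral>\<^sup>+y. ennreal (norm (x - y) powr (\<alpha> - real DIM(real ^ 'n)) * (v x * f (v x)) * (v y * f (v y))) \<partial>lborel \<partial>lborel)
     \<le> ennreal (B * (M + 1) powr (2 / (2 * real DIM(real ^ 'n) / (real DIM(real ^ 'n) + \<alpha>))))"
    by (rule B(2)) (use M in \<open>auto simp: tf_nonneg ennreal_leI simp del: ennreal_plus\<close>)
  thus ?thesis by (simp add: le_less_trans)
qed

text \<open>
  The integral is taken over the product space, where exchanging the variables and arguing up to
  null sets of pairs are both immediate; \<open>pairing_eq_iterated\<close> connects it to the
  iterated integrals of the functionals.
\<close>

definition pairing :: "(real \<Rightarrow> real) \<Rightarrow> (real \<Rightarrow> real) \<Rightarrow> (real ^ 'n \<Rightarrow> real) \<Rightarrow> real" where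
  "pairing p r v = (LINT (x, y)|(lborel \<Otimes>\<^sub>M lborel). riesz_potential \<alpha> (x - y) * p (v y) * r (v x))"

text \<open>
  The bound \<open>t f(t)\<close> is the largest of the densities that occur, so a single
  finiteness statement covers all pairings.
\<close>

definition dominated :: "(real \<Rightarrow> real) \<Rightarrow> bool" where
  "dominated p \<longleftrightarrow> p \<in> borel_measurable borel \<and> (\<forall>t. 0 \<le> p t \<and> p t \<le> t * f t)"

lemma dominated_F: "dominated F"
  by (simp add: dominated_def F_nonneg F_le_tf)

lemma dominated_tf: "dominated (\<lambda>t. t * f t)"
  by (simp add: dominated_def tf_nonneg)

lemma riesz_potential_nonneg: "0 \<le> riesz_potential \<alpha> (z :: real ^ 'n)"
  using riesz_const_pos[OF \<alpha>] by (simp add: riesz_potential_eq)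

lemma integrable_pairing:
  fixes v :: "real ^ 'n \<Rightarrow> real"
  assumes v: "v \<in> H1" and p: "dominated p" and r: "dominated r"
  shows "integrable (lborel \<Otimes>\<^sub>M lborel) (\<lambda>(x, y). riesz_potential \<alpha> (x - y) * p (v y) * r (v x))"
proof (rule integrableI_bounded)
  note [measurable] = square_integrable_real(1)[OF H1_grad(1)[OF v]]
  have [measurable]: "p \<in> borel_measurable borel" "r \<in> borel_measurable borel" using p r by (simp_all add: dominated_def)
  show "(\<lambda>(x, y). riesz_potential \<alpha> (x - y) * p (v y) * r (v x)) \<in> borel_measurable (lborel \<Otimes>\<^sub>M lborel)" by measurable
  let ?g = "\<lambda>x. v x * f (v x)"
  let ?c = "riesz_const CARD('n) \<alpha>"
  have c: "0 < ?c" by (rule riesz_const_pos[OF \<alpha>])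
  have "(\<integral>\<^sup>+z. ennreal (norm (case z of (x, y) \<Rightarrow> riesz_potential \<alpha> (x - y) * p (v y) * r (v x))) \<partial>(lborel \<Otimes>\<^sub>M lborel))
    = (\<integral>\<^sup>+x. \<integral>\<^sup>+y. ennreal (norm (riesz_potential \<alpha> (x - y) * p (v y) * r (v x))) \<partial>lborel \<partial>lborel)"
    by (subst lborel.nn_integral_fst[symmetric]) (auto simp: split_beta')
  also have "\<dots> \<le> (\<integral>\<^sup>+x. \<integral>\<^sup>+y. ennreal ?c * ennreal (norm (x - y) powr (\<alpha> - real CARD('n)) * ?g x * ?g y) \<partial>lborel \<partial>lborel)"
  proof (intro nn_integral_mono)
    fix x y
    have "norm (riesz_potential \<alpha> (x - y) * p (v y) * r (v x)) = riesz_potential \<alpha> (x - y) * (p (v y) * r (v x))"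
      using p r by (simp add: dominated_def abs_mult riesz_potential_nonneg)
    also have "\<dots> \<le> riesz_potential \<alpha> (x - y) * (?g y * ?g x)"
      using p r tf_nonneg by (intro mult_left_mono mult_mono) (auto simp: dominated_def riesz_potential_nonneg)
    also have "\<dots> = ?c * (norm (x - y) powr (\<alpha> - real CARD('n)) * ?g x * ?g y)"
      by (simp add: riesz_potential_eq mult_ac)
    finally have "ennreal (norm (riesz_potential \<alpha> (x - y) * p (v y) * r (v x)))
      \<le> ennreal (?c * (norm (x - y) powr (\<alpha> - real CARD('n)) * ?g x * ?g y))" by (rule ennreal_leI)
    also have "\<dots> = ennreal ?c * ennreal (norm (x - y) powr (\<alpha> - real CARD('n)) * ?g x * ?g y)"
      using c tf_nonneg by (intro ennreal_mult) auto
    finally show "ennreal (norm (riesz_potential \<alpha> (x - y) * p (v y) * r (v x)))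
      \<le> ennreal ?c * ennreal (norm (x - y) powr (\<alpha> - real CARD('n)) * ?g x * ?g y)" .
  qed
  also have "\<dots> = ennreal ?c * (\<integral>\<^sup>+x. \<integral>\<^sup>+y. ennreal (norm (x - y) powr (\<alpha> - real CARD('n)) * ?g x * ?g y) \<partial>lborel \<partial>lborel)"
    by (simp add: nn_integral_cmult)
  also have "\<dots> < \<infinity>" using tf_Riesz_energy_finite[OF v] by (simp add: ennreal_mult_less_top)
  finally show "(\<integral>\<^sup>+z. ennreal (norm (case z of (x, y) \<Rightarrow> riesz_potential \<alpha> (x - y) * p (v y) * r (v x))) \<partial>(lborel \<Otimes>\<^sub>M lborel)) < \<infinity>" .
qed

lemma pairing_eq_iterated:
  fixes v :: "real ^ 'n \<Rightarrow> real"
  assumes "v \<in> H1" "dominated p" "dominated r"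
  shows "(LINT x|lborel. riesz_conv \<alpha> (\<lambda>y. p (v y)) x * r (v x)) = pairing p r v"
  using lborel_pair.integral_fst[OF integrable_pairing[OF assms]]
  by (simp add: pairing_def riesz_conv_def)

lemma pairing_nonneg:
  assumes "dominated p" "dominated r"
  shows "0 \<le> pairing p r v"
  unfolding pairing_def using assms
  by (intro integral_nonneg_AE AE_I2) (auto simp: dominated_def riesz_potential_nonneg)

lemma pairing_commute:
  fixes v :: "real ^ 'n \<Rightarrow> real"
  assumes v: "v \<in> H1" and "dominated p" "dominated r"
  shows "pairing p r v = pairing r p v"
proof -
  have "pairing p r v = (LINT (y, x)|(lborel \<Otimes>\<^sub>M lborel). riesz_potential \<alpha> (x - y) * p (v y) * r (v x))"
    unfolding pairing_def
    using lborel_pair.integral_product_swap[of "\<lambda>(x, y). riesz_potential \<alpha> (x - y) * p (v y) * r (v x)"]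
      borel_measurable_integrable[OF integrable_pairing[OF assms]] by (simp add: split_beta')
  also have "\<dots> = pairing r p v"
    unfolding pairing_def by (intro arg_cong[where f="integral\<^sup>L _"] ext) (auto simp: riesz_potential_even mult_ac)
  finally show ?thesis .
qed

lemma choquard_term_eq:
  fixes v :: "real ^ 'n \<Rightarrow> real"
  assumes "v \<in> H1"
  shows "choquard_term \<alpha> F v = pairing F F v"
  unfolding choquard_term_def by (rule pairing_eq_iterated[OF assms dominated_F dominated_F])

theorem choquard_term_ray:
  fixes v :: "real ^ 'n \<Rightarrow> real"
  assumes v: "v \<in> H1" and t: "0 \<le> t"
  shows "choquard_term \<alpha> F v + (t\<^sup>2 - 1) * pairing F (\<lambda>t. t * f t) v \<le> choquard_term \<alpha> F (\<lambda>x. t * v x)"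
proof -
  let ?g = "\<lambda>t. t * f t"
  have tv: "(\<lambda>x. t * v x) \<in> H1" by (rule H1_scale[OF v])
  let ?K = "\<lambda>p r v (x :: real ^ 'n, y). riesz_potential \<alpha> (x - y) * p (v y) * r (v x)"
  note I = integrable_pairing[OF v dominated_F dominated_F] integrable_pairing[OF v dominated_F dominated_tf]
    integrable_pairing[OF v dominated_tf dominated_F] integrable_pairing[OF tv dominated_F dominated_F]
  have "(LINT z|(lborel \<Otimes>\<^sub>M lborel). ?K F F v z + (t\<^sup>2 - 1) / 2 * (?K F ?g v z + ?K ?g F v z))
      \<le> (LINT z|(lborel \<Otimes>\<^sub>M lborel). ?K F F (\<lambda>x. t * v x) z)"
  proof (rule integral_mono)
    show "integrable (lborel \<Otimes>\<^sub>M lborel) (\<lambda>z. ?K F F v z + (t\<^sup>2 - 1) / 2 * (?K F ?g v z + ?K ?g F v z))"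
      by (intro Bochner_Integration.integrable_add integrable_mult_right I)
    show "integrable (lborel \<Otimes>\<^sub>M lborel) (?K F F (\<lambda>x. t * v x))" by (rule I)
    fix z :: "(real ^ 'n) \<times> (real ^ 'n)"
    obtain x y where z: "z = (x, y)" by (cases z)
    have "riesz_potential \<alpha> (x - y) * (F (v y) * F (v x) + (t\<^sup>2 - 1) / 2 * (F (v y) * (v x * f (v x)) + (v y * f (v y)) * F (v x)))
      \<le> riesz_potential \<alpha> (x - y) * (F (t * v y) * F (t * v x))"
      by (intro mult_left_mono ray_product_inequality t riesz_potential_nonneg)
    thus "?K F F v z + (t\<^sup>2 - 1) / 2 * (?K F ?g v z + ?K ?g F v z) \<le> ?K F F (\<lambda>x. t * v x) z"
      by (simp add: z algebra_simps)
  qed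
  also have "(LINT z|(lborel \<Otimes>\<^sub>M lborel). ?K F F v z + (t\<^sup>2 - 1) / 2 * (?K F ?g v z + ?K ?g F v z))
     = pairing F F v + (t\<^sup>2 - 1) / 2 * (pairing F ?g v + pairing ?g F v)"
    unfolding pairing_def using I by simp
  also have "pairing ?g F v = pairing F ?g v" by (rule pairing_commute[OF v dominated_tf dominated_F])
  also have "(LINT z|(lborel \<Otimes>\<^sub>M lborel). ?K F F (\<lambda>x. t * v x) z) = pairing F F (\<lambda>x. t * v x)"
    by (simp add: pairing_def)
  finally show ?thesis using choquard_term_eq[OF v] choquard_term_eq[OF tv] by simp
qed

text \<open>
  Each of the two factors at least doubles. If the integrals were equal, the integrands would be
  equal almost everywhere, and strictness in the first factor would make the integrand of
  \<open>v\<close> itself vanish.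
\<close>

lemma pairing_doubling_strict:
  fixes v :: "real ^ 'n \<Rightarrow> real"
  assumes v: "v \<in> H1" and pos: "0 < pairing F (\<lambda>t. t * f t) v"
  shows "4 * pairing F (\<lambda>t. t * f t) v < pairing F (\<lambda>t. t * f t) (\<lambda>x. 2 * v x)"
proof (rule ccontr)
  let ?g = "\<lambda>t. t * f t"
  have tv: "(\<lambda>x. 2 * v x) \<in> H1" by (rule H1_scale[OF v])
  let ?K = "\<lambda>v (x :: real ^ 'n, y). riesz_potential \<alpha> (x - y) * F (v y) * ?g (v x)"
  let ?D = "\<lambda>z. ?K (\<lambda>x. 2 * v x) z - 4 * ?K v z"
  note I = integrable_pairing[OF v dominated_F dominated_tf] integrable_pairing[OF tv dominated_F dominated_tf]
  have D0: "0 \<le> ?D z" and D1: "?D z = 0 \<Longrightarrow> ?K v z = 0" for z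
  proof -
    obtain x y where z: "z = (x, y)" by (cases z)
    let ?r = "riesz_potential \<alpha> (x - y)"
    have r0: "0 \<le> ?r" by (rule riesz_potential_nonneg)
    have 1: "2 * F (v y) * (2 * ?g (v x)) \<le> F (2 * v y) * (2 * ?g (v x))"
      using doubling(1) tf_nonneg by (intro mult_right_mono) auto
    have 2: "F (2 * v y) * (2 * ?g (v x)) \<le> F (2 * v y) * ?g (2 * v x)"
      using doubling(2)[of "v x"] F_nonneg by (intro mult_left_mono) auto
    have eq: "?D z = ?r * (F (2 * v y) * ?g (2 * v x) - 2 * F (v y) * (2 * ?g (v x)))"
      by (simp add: z algebra_simps)
    show "0 \<le> ?D z" unfolding eq using r0 1 2 by (intro mult_nonneg_nonneg) auto
    assume "?D z = 0"
    hence "?r = 0 \<or> F (2 * v y) * ?g (2 * v x) = 2 * F (v y) * (2 * ?g (v x))" unfolding eq by simp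
    moreover have "F (v y) * ?g (v x) = 0" if "F (2 * v y) * ?g (2 * v x) = 2 * F (v y) * (2 * ?g (v x))"
    proof (rule ccontr)
      assume "F (v y) * ?g (v x) \<noteq> 0"
      hence "0 < F (v y)" "0 < ?g (v x)" using F_nonneg[of "v y"] tf_nonneg[of "v x"] by (auto simp: less_le)
      hence "2 * F (v y) * (2 * ?g (v x)) < F (2 * v y) * (2 * ?g (v x))"
        using doubling_strict by (intro mult_strict_right_mono) auto
      thus False using that 2 by linarith
    qed
    ultimately show "?K v z = 0" by (auto simp: z)
  qed
  assume "\<not> ?thesis"
  hence "(LINT z|(lborel \<Otimes>\<^sub>M lborel). ?D z) \<le> 0"
    using I by (simp add: pairing_def)
  moreover have ID: "integrable (lborel \<Otimes>\<^sub>M lborel) ?D"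
    by (intro Bochner_Integration.integrable_diff integrable_mult_right I)
  moreover have "0 \<le> (LINT z|(lborel \<Otimes>\<^sub>M lborel). ?D z)" by (rule integral_nonneg_AE) (simp only: D0 AE_I2)
  ultimately have "(LINT z|(lborel \<Otimes>\<^sub>M lborel). ?D z) = 0" by linarith
  hence "AE z in lborel \<Otimes>\<^sub>M lborel. ?D z = 0"
    using integral_nonneg_eq_0_iff_AE[OF ID] D0 by simp
  hence "AE z in lborel \<Otimes>\<^sub>M lborel. ?K v z = 0" by eventually_elim (rule D1)
  hence "pairing F ?g v = 0" unfolding pairing_def by (rule integral_eq_zero_AE)
  thus False using pos by simp
qed

end

section \<open>Local compactness\<close>

lemma ball_integral_square_bound:
  fixes g :: "'a::euclidean_space \<Rightarrow> real"
  assumes g[measurable]: "g \<in> borel_measurable borel"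
  shows "ennreal ((LINT h|lborel. indicator (ball c \<epsilon>) h * g h)\<^sup>2)
    \<le> ennreal (measure lborel (ball c \<epsilon>)) * (\<integral>\<^sup>+h. indicator (ball c \<epsilon>) h * ennreal ((g h)\<^sup>2) \<partial>lborel)"
proof -
  let ?b = "\<lambda>h. indicator (ball c \<epsilon>) h :: ennreal"
  let ?k = "\<lambda>h. indicator (ball c \<epsilon>) h * g h"
  have "ennreal \<bar>LINT h|lborel. ?k h\<bar> \<le> (\<integral>\<^sup>+h. ennreal (norm (?k h)) \<partial>lborel)"
  proof (cases "integrable lborel ?k")
    case True
    thus ?thesis using integral_norm_bound_ennreal[OF True] by simp
  qed (simp add: not_integrable_integral_eq)
  also have "\<dots> = (\<integral>\<^sup>+h. ?b h * (?b h * ennreal \<bar>g h\<bar>) \<partial>lborel)"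
    by (rule nn_integral_cong) (simp add: indicator_def abs_mult)
  finally have "(ennreal \<bar>LINT h|lborel. ?k h\<bar>)\<^sup>2 \<le> (\<integral>\<^sup>+h. ?b h * (?b h * ennreal \<bar>g h\<bar>) \<partial>lborel)\<^sup>2"
    by (rule power_mono) simp
  also have "\<dots> \<le> (\<integral>\<^sup>+h. (?b h)\<^sup>2 \<partial>lborel) * (\<integral>\<^sup>+h. (?b h * ennreal \<bar>g h\<bar>)\<^sup>2 \<partial>lborel)"
    by (rule Cauchy_Schwarz_nn_integral) measurable
  also have "(\<integral>\<^sup>+h. (?b h)\<^sup>2 \<partial>lborel) = (\<integral>\<^sup>+h. ?b h \<partial>lborel)"
    by (rule nn_integral_cong) (simp add: indicator_def)
  also have "\<dots> = ennreal (measure lborel (ball c \<epsilon>))"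
    using emeasure_lborel_ball_finite[of c \<epsilon>] by (simp add: emeasure_eq_ennreal_measure)
  also have "(\<integral>\<^sup>+h. (?b h * ennreal \<bar>g h\<bar>)\<^sup>2 \<partial>lborel) = (\<integral>\<^sup>+h. ?b h * ennreal ((g h)\<^sup>2) \<partial>lborel)"
    by (rule nn_integral_cong) (simp add: indicator_def ennreal_power)
  finally show ?thesis by (simp add: ennreal_power)
qed

lemma integrable_ball_indicator_mult:
  fixes g :: "'a::euclidean_space \<Rightarrow> real"
  assumes [measurable]: "g \<in> borel_measurable borel" and "integrable lborel (\<lambda>x. (g x)\<^sup>2)"
  shows "integrable lborel (\<lambda>h. indicator (ball c \<epsilon>) h * g h)"
proof (rule integrable_mult_L2[OF _ _ _ assms(2)])
  have "(\<lambda>x. (indicator (ball c \<epsilon>) x :: real)\<^sup>2) = indicator (ball c \<epsilon>)" by (auto simp: indicator_def)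
  thus "integrable lborel (\<lambda>x. (indicator (ball c \<epsilon>) x :: real)\<^sup>2)"
    using emeasure_lborel_ball_finite[of c \<epsilon>] by simp
qed measurable

text \<open>
  A weight turns local convergence into convergence of one integral, so that no diagonal
  sequence over an exhaustion by balls is needed.
\<close>

lemma positive_integrable_weight:
  obtains \<rho> :: "'a::euclidean_space \<Rightarrow> real" where "\<rho> \<in> borel_measurable borel"
    "\<And>x. 0 < \<rho> x" "\<And>x. \<rho> x \<le> 1" "integrable lborel \<rho>"
proof -
  obtain w :: "'a \<Rightarrow> ennreal" where w[measurable]: "w \<in> borel_measurable lborel"
    and fin: "integral\<^sup>N lborel w \<noteq> \<infinity>" and pos: "\<And>x. 0 < w x \<and> w x < \<infinity>"
    using sigma_finite_measure.Ex_finite_integrable_function[OF sigma_finite_lborel] by auto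
  define \<rho> where "\<rho> x = min 1 (enn2real (w x))" for x
  have [measurable]: "\<rho> \<in> borel_measurable borel" unfolding \<rho>_def using w by measurable
  have p: "0 < \<rho> x" for x using pos[of x] by (simp add: \<rho>_def enn2real_positive_iff)
  have "(\<integral>\<^sup>+x. ennreal (\<rho> x) \<partial>lborel) \<le> integral\<^sup>N lborel w"
    by (rule nn_integral_mono) (use pos in \<open>simp add: \<rho>_def min_def ennreal_enn2real_if le_less_trans\<close>,
        metis ennreal_enn2real ennreal_leI ennreal_1 nle_le order_trans)
  also have "\<dots> < \<infinity>" using fin by (simp add: less_top)
  finally have "integrable lborel \<rho>"
    using p by (intro integrableI_bounded) (auto simp: less_imp_le)
  thus thesis using p by (intro that[of \<rho>]) (auto simp: \<rho>_def)
qed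

text \<open>
  The Rellich argument. The distance in \<open>L\<^sup>2\<close> between
  \<open>D\<^sub>k\<close> and its average over balls of radius \<open>\<epsilon>\<close> is at
  most a multiple of \<open>\<epsilon>\<close>, uniformly in \<open>k\<close>; the averages are
  uniformly bounded and tend to \<open>0\<close> pointwise, so dominated convergence applies to
  them under a finite weight.
\<close>

theorem AE_convergent_subsequence_of_vanishing_averages:
  fixes D :: "nat \<Rightarrow> 'a::euclidean_space \<Rightarrow> real"
  assumes D[measurable]: "\<And>k. D k \<in> borel_measurable borel"
    and M: "\<And>k. (\<integral>\<^sup>+x. ennreal ((D k x)\<^sup>2) \<partial>lborel) \<le> ennreal M" "0 \<le> M"
    and G: "\<And>k h. (\<integral>\<^sup>+x. ennreal ((D k (x + h) - D k x)\<^sup>2) \<partial>lborel) \<le> ennreal (G * (norm h)\<^sup>2)" "0 \<le> G"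
    and avg: "\<And>x \<epsilon>. 0 < \<epsilon> \<Longrightarrow> (\<lambda>k. LINT y|lborel. indicator (ball x \<epsilon>) y * D k y) \<longlonglongrightarrow> 0"
  shows "\<exists>r :: nat \<Rightarrow> nat. strict_mono r \<and> (AE x in lborel. (\<lambda>k. D (r k) x) \<longlonglongrightarrow> 0)"
proof -
  obtain \<rho> :: "'a \<Rightarrow> real" where \<rho>[measurable]: "\<rho> \<in> borel_measurable borel"
    and \<rho>0: "\<And>x. 0 < \<rho> x" and \<rho>1: "\<And>x. \<rho> x \<le> 1" and \<rho>i: "integrable lborel \<rho>"
    apply (rule positive_integrable_weight[where 'a='a])
    subgoal premises p by (rule p(1)[OF p(2,3,4,5)])
    done
  have D2: "integrable lborel (\<lambda>x. (D k x)\<^sup>2)" for k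
    using le_less_trans[OF M(1)[of k]] by (intro integrableI_bounded) auto
  have \<rho>D: "integrable lborel (\<lambda>x. \<rho> x * (D k x)\<^sup>2)" for k
    by (rule Bochner_Integration.integrable_bound[OF D2[of k]]) (use \<rho>0 \<rho>1 in \<open>auto simp: abs_mult less_imp_le intro!: mult_left_le_one_le\<close>)
  define e where "e k = (LINT x|lborel. \<rho> x * (D k x)\<^sup>2)" for k
  have e0: "0 \<le> e k" for k unfolding e_def using \<rho>0 by (intro integral_nonneg_AE AE_I2) (simp add: less_imp_le)
  have main: "\<exists>b. b \<longlonglongrightarrow> 0 \<and> (\<forall>k. e k \<le> 2 * (\<epsilon>\<^sup>2 * G) + 2 * b k)" if \<epsilon>: "0 < \<epsilon>" for \<epsilon> :: real
  proof -
    define v where "v = measure lborel (ball (0::'a) \<epsilon>)"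
    have v: "v > 0" unfolding v_def using \<epsilon> by (rule content_ball_pos)
    let ?b = "\<lambda>h. indicator (ball (0::'a) \<epsilon>) h :: ennreal"
    have bv: "(\<integral>\<^sup>+h. ?b h \<partial>lborel) = ennreal v"
      using emeasure_lborel_ball_finite[of "0::'a" \<epsilon>] by (simp add: emeasure_eq_ennreal_measure v_def)
    define m where "m k x = (LINT h|lborel. indicator (ball 0 \<epsilon>) h * D k (x + h)) / v" for k x
    have m[measurable]: "m k \<in> borel_measurable borel" for k unfolding m_def by measurable
    have shift: "integrable lborel (\<lambda>h. (D k (x + h))\<^sup>2)" for k x
      using lborel_translate(2)[of "\<lambda>h. (D k h)\<^sup>2" x] D2[of k] by (simp add: add.commute)
    have m_lim: "(\<lambda>k. m k x) \<longlonglongrightarrow> 0" for x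
    proof -
      have "(LINT h|lborel. indicator (ball 0 \<epsilon>) h * D k (x + h)) = (LINT y|lborel. indicator (ball x \<epsilon>) y * D k y)" for k
      proof -
        have "(LINT h|lborel. indicator (ball x \<epsilon>) (h + x) * D k (h + x)) = (LINT y|lborel. indicator (ball x \<epsilon>) y * D k y)"
          by (rule lborel_translate(1)) measurable
        moreover have "indicator (ball x \<epsilon>) (h + x) = (indicator (ball 0 \<epsilon>) h :: real)" for h
          by (auto simp: indicator_def dist_norm)
        ultimately show ?thesis by (simp add: add.commute)
      qed
      thus ?thesis using avg[OF \<epsilon>, of x] tendsto_divide[OF avg[OF \<epsilon>, of x] tendsto_const[of v]] v
        by (simp add: m_def)
    qed
    have m_bound: "(m k x)\<^sup>2 \<le> M / v" for k x
    proof -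
      have "ennreal ((LINT h|lborel. indicator (ball 0 \<epsilon>) h * D k (x + h))\<^sup>2)
        \<le> ennreal v * (\<integral>\<^sup>+h. ?b h * ennreal ((D k (x + h))\<^sup>2) \<partial>lborel)"
        unfolding v_def by (rule ball_integral_square_bound) measurable
      also have "\<dots> \<le> ennreal v * (\<integral>\<^sup>+h. ennreal ((D k (x + h))\<^sup>2) \<partial>lborel)"
        by (intro mult_left_mono nn_integral_mono) (auto simp: indicator_def)
      also have "(\<integral>\<^sup>+h. ennreal ((D k (x + h))\<^sup>2) \<partial>lborel) = (\<integral>\<^sup>+h. ennreal ((D k h)\<^sup>2) \<partial>lborel)"
        by (rule nn_integral_translate) measurable
      also have "ennreal v * \<dots> \<le> ennreal v * ennreal M" by (intro mult_left_mono M) auto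
      also have "\<dots> = ennreal (v * M)" using v M by (simp add: ennreal_mult)
      finally have "(LINT h|lborel. indicator (ball 0 \<epsilon>) h * D k (x + h))\<^sup>2 \<le> v * M"
        using v M by (simp add: ennreal_le_iff)
      thus ?thesis using v by (simp add: m_def power_divide divide_le_eq power2_eq_square mult.commute)
    qed
    have diff: "ennreal ((D k x - m k x)\<^sup>2) \<le> ennreal (1 / v) * (\<integral>\<^sup>+h. ?b h * ennreal ((D k (x + h) - D k x)\<^sup>2) \<partial>lborel)" for k x
    proof -
      have i1: "integrable lborel (\<lambda>h. indicator (ball (0::'a) \<epsilon>) h * D k (x + h))"
        by (rule integrable_ball_indicator_mult[OF _ shift]) measurable
      have i2: "integrable lborel (\<lambda>h. indicator (ball (0::'a) \<epsilon>) h * D k x)"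
        using emeasure_lborel_ball_finite[of "0::'a" \<epsilon>] by simp
      have "(LINT h|lborel. indicator (ball (0::'a) \<epsilon>) h * (D k (x + h) - D k x)) = v * m k x - v * D k x"
        using i1 i2 v by (simp add: right_diff_distrib m_def v_def[symmetric] mult.commute)
      hence "(D k x - m k x)\<^sup>2 = (1 / v)\<^sup>2 * (LINT h|lborel. indicator (ball (0::'a) \<epsilon>) h * (D k (x + h) - D k x))\<^sup>2"
        using v by (simp add: power_divide right_diff_distrib[symmetric] power_mult_distrib power2_commute)
      hence "ennreal ((D k x - m k x)\<^sup>2) = ennreal ((1 / v)\<^sup>2) * ennreal ((LINT h|lborel. indicator (ball (0::'a) \<epsilon>) h * (D k (x + h) - D k x))\<^sup>2)"
        by (simp add: ennreal_mult)
      also have "\<dots> \<le> ennreal ((1 / v)\<^sup>2) * (ennreal v * (\<integral>\<^sup>+h. ?b h * ennreal ((D k (x + h) - D k x)\<^sup>2) \<partial>lborel))"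
        unfolding v_def by (intro mult_left_mono ball_integral_square_bound) measurable
      also have "\<dots> = ennreal ((1 / v)\<^sup>2 * v) * (\<integral>\<^sup>+h. ?b h * ennreal ((D k (x + h) - D k x)\<^sup>2) \<partial>lborel)"
        using v by (subst ennreal_mult) (auto simp: mult.assoc)
      also have "(1 / v)\<^sup>2 * v = 1 / v" using v by (simp add: power2_eq_square)
      finally show ?thesis .
    qed
    have diff_int: "(\<integral>\<^sup>+x. ennreal ((D k x - m k x)\<^sup>2) \<partial>lborel) \<le> ennreal (\<epsilon>\<^sup>2 * G)" for k
    proof -
      have "(\<integral>\<^sup>+x. ennreal ((D k x - m k x)\<^sup>2) \<partial>lborel)
        \<le> (\<integral>\<^sup>+x. ennreal (1 / v) * (\<integral>\<^sup>+h. ?b h * ennreal ((D k (x + h) - D k x)\<^sup>2) \<partial>lborel) \<partial>lborel)"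
        by (rule nn_integral_mono) (rule diff)
      also have "\<dots> = ennreal (1 / v) * (\<integral>\<^sup>+x. \<integral>\<^sup>+h. ?b h * ennreal ((D k (x + h) - D k x)\<^sup>2) \<partial>lborel \<partial>lborel)"
        by (rule nn_integral_cmult) measurable
      also have "(\<integral>\<^sup>+x. \<integral>\<^sup>+h. ?b h * ennreal ((D k (x + h) - D k x)\<^sup>2) \<partial>lborel \<partial>lborel)
        = (\<integral>\<^sup>+h. \<integral>\<^sup>+x. ?b h * ennreal ((D k (x + h) - D k x)\<^sup>2) \<partial>lborel \<partial>lborel)"
        by (rule lborel_pair.Fubini'[symmetric]) measurable
      also have "\<dots> \<le> (\<integral>\<^sup>+h. ?b h * ennreal (G * \<epsilon>\<^sup>2) \<partial>lborel)"
      proof (rule nn_integral_mono)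
        fix h
        have "(\<integral>\<^sup>+x. ?b h * ennreal ((D k (x + h) - D k x)\<^sup>2) \<partial>lborel) = ?b h * (\<integral>\<^sup>+x. ennreal ((D k (x + h) - D k x)\<^sup>2) \<partial>lborel)"
          by (rule nn_integral_cmult) measurable
        also have "\<dots> \<le> ?b h * ennreal (G * (norm h)\<^sup>2)" by (intro mult_left_mono G) auto
        also have "\<dots> \<le> ?b h * ennreal (G * \<epsilon>\<^sup>2)"
          using G(2) \<epsilon> by (auto simp: indicator_def intro!: ennreal_leI mult_left_mono power_mono)
        finally show "(\<integral>\<^sup>+x. ?b h * ennreal ((D k (x + h) - D k x)\<^sup>2) \<partial>lborel) \<le> ?b h * ennreal (G * \<epsilon>\<^sup>2)" .
      qed
      also have "(\<integral>\<^sup>+h. ?b h * ennreal (G * \<epsilon>\<^sup>2) \<partial>lborel) = ennreal v * ennreal (G * \<epsilon>\<^sup>2)"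
        using bv by (simp add: nn_integral_multc)
      also have "ennreal (1 / v) * (ennreal v * ennreal (G * \<epsilon>\<^sup>2)) = ennreal (\<epsilon>\<^sup>2 * G)"
        using v G(2) by (simp add: ennreal_mult[symmetric] mult.commute)
      finally show ?thesis by (simp add: mult_left_mono)
    qed
    define b where "b k = (LINT x|lborel. \<rho> x * (m k x)\<^sup>2)" for k
    have \<rho>M: "integrable lborel (\<lambda>x. \<rho> x * (M / v))" using \<rho>i by simp
    have \<rho>m: "norm (\<rho> x * (m k x)\<^sup>2) \<le> \<rho> x * (M / v)" for k x
      using \<rho>0[of x] m_bound[of k x] by (simp add: abs_mult mult_left_mono del: times_divide_eq_right)
    have bi: "integrable lborel (\<lambda>x. \<rho> x * (m k x)\<^sup>2)" for k
    proof (rule Bochner_Integration.integrable_bound[OF \<rho>M])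
      show "AE x in lborel. norm (\<rho> x * (m k x)\<^sup>2) \<le> norm (\<rho> x * (M / v))"
        by (intro AE_I2 order_trans[OF \<rho>m]) (simp only: real_norm_def abs_ge_self)
    qed measurable
    have "(\<lambda>k. LINT x|lborel. \<rho> x * (m k x)\<^sup>2) \<longlonglongrightarrow> (LINT x|(lborel :: 'a measure). 0)"
    proof (rule integral_dominated_convergence[where w="\<lambda>x. \<rho> x * (M / v)"])
      show "AE x in lborel. (\<lambda>k. \<rho> x * (m k x)\<^sup>2) \<longlonglongrightarrow> 0"
      proof (rule AE_I2)
        fix x
        have "(\<lambda>k. \<rho> x * (m k x)\<^sup>2) \<longlonglongrightarrow> \<rho> x * 0\<^sup>2" by (intro tendsto_intros m_lim)
        thus "(\<lambda>k. \<rho> x * (m k x)\<^sup>2) \<longlonglongrightarrow> 0" by simp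
      qed
      show "AE x in lborel. norm (\<rho> x * (m k x)\<^sup>2) \<le> \<rho> x * (M / v)" for k using \<rho>m by simp
    qed (use \<rho>M in \<open>auto\<close>)
    hence "b \<longlonglongrightarrow> 0" by (simp add: b_def[abs_def])
    moreover have "e k \<le> 2 * (\<epsilon>\<^sup>2 * G) + 2 * b k" for k
    proof -
      have b0: "0 \<le> b k" unfolding b_def using \<rho>0 by (intro integral_nonneg_AE AE_I2) (simp add: less_imp_le)
      have "ennreal (e k) = (\<integral>\<^sup>+x. ennreal (\<rho> x * (D k x)\<^sup>2) \<partial>lborel)"
        unfolding e_def using \<rho>D \<rho>0 by (intro nn_integral_eq_integral[symmetric]) (auto simp: less_imp_le)
      also have "\<dots> \<le> (\<integral>\<^sup>+x. 2 * ennreal ((D k x - m k x)\<^sup>2) + 2 * ennreal (\<rho> x * (m k x)\<^sup>2) \<partial>lborel)"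
      proof (rule nn_integral_mono)
        fix x
        have "(D k x)\<^sup>2 \<le> 2 * (D k x - m k x)\<^sup>2 + 2 * (m k x)\<^sup>2"
          using sum_squares_bound[of "D k x - m k x" "m k x"] by (simp add: power2_eq_square algebra_simps)
        hence "\<rho> x * (D k x)\<^sup>2 \<le> \<rho> x * (2 * (D k x - m k x)\<^sup>2 + 2 * (m k x)\<^sup>2)"
          using \<rho>0[of x] by (intro mult_left_mono) auto
        also have "\<dots> = \<rho> x * (2 * (D k x - m k x)\<^sup>2) + 2 * (\<rho> x * (m k x)\<^sup>2)" by (simp add: algebra_simps)
        also have "\<rho> x * (2 * (D k x - m k x)\<^sup>2) \<le> 2 * (D k x - m k x)\<^sup>2"
          using \<rho>0[of x] \<rho>1[of x] by (intro mult_left_le_one_le) auto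
        finally have "ennreal (\<rho> x * (D k x)\<^sup>2) \<le> ennreal (2 * (D k x - m k x)\<^sup>2 + 2 * (\<rho> x * (m k x)\<^sup>2))"
          by (simp add: ennreal_leI)
        also have "\<dots> = 2 * ennreal ((D k x - m k x)\<^sup>2) + 2 * ennreal (\<rho> x * (m k x)\<^sup>2)"
          using \<rho>0[of x] by (simp add: ennreal_mult less_imp_le)
        finally show "ennreal (\<rho> x * (D k x)\<^sup>2) \<le> 2 * ennreal ((D k x - m k x)\<^sup>2) + 2 * ennreal (\<rho> x * (m k x)\<^sup>2)" .
      qed
      also have "\<dots> = 2 * (\<integral>\<^sup>+x. ennreal ((D k x - m k x)\<^sup>2) \<partial>lborel) + 2 * (\<integral>\<^sup>+x. ennreal (\<rho> x * (m k x)\<^sup>2) \<partial>lborel)"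
        by (simp add: nn_integral_add nn_integral_cmult)
      also have "(\<integral>\<^sup>+x. ennreal (\<rho> x * (m k x)\<^sup>2) \<partial>lborel) = ennreal (b k)"
        unfolding b_def using bi \<rho>0 by (intro nn_integral_eq_integral) (auto simp: less_imp_le)
      also have "2 * (\<integral>\<^sup>+x. ennreal ((D k x - m k x)\<^sup>2) \<partial>lborel) + 2 * ennreal (b k) \<le> 2 * ennreal (\<epsilon>\<^sup>2 * G) + 2 * ennreal (b k)"
        by (intro add_right_mono mult_left_mono diff_int) auto
      also have "\<dots> = ennreal (2 * (\<epsilon>\<^sup>2 * G) + 2 * b k)"
        using b0 G(2) by (simp add: ennreal_mult)
      finally show ?thesis using b0 G(2) by (subst (asm) ennreal_le_iff) auto
    qed
    ultimately show ?thesis by blast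
  qed
  have "e \<longlonglongrightarrow> 0"
  proof (rule LIMSEQ_I)
    fix \<delta> :: real assume \<delta>: "0 < \<delta>"
    \<comment> \<open>Adding \<open>1\<close> to \<open>G\<close> only keeps the denominator positive.\<close>
    define \<epsilon> where "\<epsilon> = sqrt (\<delta> / (4 * (G + 1)))"
    have \<epsilon>: "0 < \<epsilon>" using \<delta> G(2) by (simp add: \<epsilon>_def)
    have "\<epsilon>\<^sup>2 * G \<le> \<epsilon>\<^sup>2 * (G + 1)" by (intro mult_left_mono) auto
    also have "\<dots> = \<delta> / 4"
      using \<delta> G(2) by (simp add: \<epsilon>_def divide_simps)
    finally have \<epsilon>G: "\<epsilon>\<^sup>2 * G \<le> \<delta> / 4" .
    obtain b where b: "b \<longlonglongrightarrow> 0" "\<And>k. e k \<le> 2 * (\<epsilon>\<^sup>2 * G) + 2 * b k" using main[OF \<epsilon>] by blast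
    obtain n where n: "\<And>k. n \<le> k \<Longrightarrow> norm (b k - 0) < \<delta> / 4"
      using LIMSEQ_D[OF b(1), of "\<delta> / 4"] \<delta> by auto
    have "norm (e k - 0) < \<delta>" if "n \<le> k" for k
      using n[OF that] b(2)[of k] e0[of k] \<epsilon>G by (simp add: abs_less_iff)
    thus "\<exists>n. \<forall>k\<ge>n. norm (e k - 0) < \<delta>" by blast
  qed
  moreover have "(LINT x|lborel. norm (\<rho> x * (D k x)\<^sup>2)) = e k" for k
    unfolding e_def using \<rho>0 by (simp add: abs_mult less_imp_le)
  ultimately have "(\<lambda>k. LINT x|lborel. norm (\<rho> x * (D k x)\<^sup>2)) \<longlonglongrightarrow> 0" by simp
  from tendsto_L1_AE_subseq[of lborel "\<lambda>k x. \<rho> x * (D k x)\<^sup>2", OF \<rho>D this] obtain r :: "nat \<Rightarrow> nat"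
    where r: "strict_mono r" "AE x in lborel. (\<lambda>k. \<rho> x * (D (r k) x)\<^sup>2) \<longlonglongrightarrow> 0" by blast
  from r(2) have "AE x in lborel. (\<lambda>k. D (r k) x) \<longlonglongrightarrow> 0"
  proof eventually_elim
    case (elim x)
    have "(\<lambda>k. sqrt (\<rho> x * (D (r k) x)\<^sup>2 / \<rho> x)) \<longlonglongrightarrow> sqrt (0 / \<rho> x)"
      using elim \<rho>0[of x] by (intro tendsto_intros) auto
    hence "(\<lambda>k. \<bar>D (r k) x\<bar>) \<longlonglongrightarrow> 0" using \<rho>0[of x] by simp
    thus ?case by (simp add: tendsto_rabs_zero_iff)
  qed
  thus ?thesis using r(1) by blast
qed

section \<open>Bounded sequences in the Sobolev space\<close>

text \<open>
  Averages over balls are the functionals against which weak convergence is tested.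
\<close>

lemma H1_dual_ball_average:
  "(\<lambda>v :: real ^ 'n \<Rightarrow> real. LINT y|lborel. indicator (ball c \<epsilon>) y * v y) \<in> H1_dual s"
  unfolding H1_dual_def mem_Collect_eq
proof (intro conjI ballI allI)
  have i: "integrable lborel (\<lambda>y. indicator (ball c \<epsilon>) y * v y)" if "v \<in> H1" for v :: "real ^ 'n \<Rightarrow> real"
    using square_integrable_real[OF H1_grad(1)[OF that]] by (rule integrable_ball_indicator_mult)
  fix v w :: "real ^ 'n \<Rightarrow> real" assume v: "v \<in> H1" and w: "w \<in> H1"
  show "(LINT y|lborel. indicator (ball c \<epsilon>) y * (v y + w y))
      = (LINT y|lborel. indicator (ball c \<epsilon>) y * v y) + (LINT y|lborel. indicator (ball c \<epsilon>) y * w y)"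
    using i[OF v] i[OF w] by (simp add: distrib_left)
next
  fix a :: real and v :: "real ^ 'n \<Rightarrow> real"
  have "(LINT y|lborel. a * (indicator (ball c \<epsilon>) y * v y)) = a * (LINT y|lborel. indicator (ball c \<epsilon>) y * v y)"
    by simp
  thus "(LINT y|lborel. indicator (ball c \<epsilon>) y * (a * v y)) = a * (LINT y|lborel. indicator (ball c \<epsilon>) y * v y)"
    by (simp add: mult.left_commute)
next
  let ?V = "measure lborel (ball c \<epsilon>)"
  show "\<exists>K. \<forall>v\<in>H1. \<bar>LINT y|lborel. indicator (ball c \<epsilon>) y * v y\<bar> \<le> K * H1_norm s v"
  proof (intro exI ballI)
    fix v :: "real ^ 'n \<Rightarrow> real" assume v: "v \<in> H1"
    note vm = square_integrable_real[OF H1_grad(1)[OF v]]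
    note [measurable] = vm(1)
    have "ennreal ((LINT y|lborel. indicator (ball c \<epsilon>) y * v y)\<^sup>2)
        \<le> ennreal ?V * (\<integral>\<^sup>+y. indicator (ball c \<epsilon>) y * ennreal ((v y)\<^sup>2) \<partial>lborel)"
      by (rule ball_integral_square_bound) measurable
    also have "\<dots> \<le> ennreal ?V * (\<integral>\<^sup>+y. ennreal ((v y)\<^sup>2) \<partial>lborel)"
      by (intro mult_left_mono nn_integral_mono) (auto simp: indicator_def)
    also have "(\<integral>\<^sup>+y. ennreal ((v y)\<^sup>2) \<partial>lborel) = ennreal ((L2_norm v)\<^sup>2)"
      using nn_integral_eq_integral[OF vm(2)] by (simp add: L2_norm_square)
    finally have "(LINT y|lborel. indicator (ball c \<epsilon>) y * v y)\<^sup>2 \<le> ?V * (L2_norm v)\<^sup>2"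
      by (simp add: ennreal_mult[symmetric] ennreal_le_iff)
    hence "sqrt ((LINT y|lborel. indicator (ball c \<epsilon>) y * v y)\<^sup>2) \<le> sqrt (?V * (L2_norm v)\<^sup>2)"
      by (rule real_sqrt_le_mono)
    hence "\<bar>LINT y|lborel. indicator (ball c \<epsilon>) y * v y\<bar> \<le> sqrt ?V * L2_norm v"
      by (simp add: real_sqrt_mult L2_norm_nonneg)
    also have "\<dots> \<le> sqrt ?V * H1_norm s v" by (intro mult_left_mono L2_norm_le_H1_norm) auto
    finally show "\<bar>LINT y|lborel. indicator (ball c \<epsilon>) y * v y\<bar> \<le> sqrt ?V * H1_norm s v" .
  qed
qed

lemma H1_square_bound:
  assumes "u \<in> H1"
  shows "(\<integral>\<^sup>+x. ennreal ((u x)\<^sup>2) \<partial>lborel) = ennreal ((L2_norm u)\<^sup>2)"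
    and "(\<integral>\<^sup>+x. ennreal ((norm (grad u x))\<^sup>2) \<partial>lborel) = ennreal ((L2_norm (grad u))\<^sup>2)"
  using H1_grad(1,2)[OF assms] by (simp_all add: L2_norm_square square_integrable_def nn_integral_eq_integral)

lemma nn_integral_square_diff_le:
  fixes a b :: "'a \<Rightarrow> real"
  assumes [measurable]: "a \<in> borel_measurable M" "b \<in> borel_measurable M"
    and "(\<integral>\<^sup>+x. ennreal ((a x)\<^sup>2) \<partial>M) \<le> ennreal A" "(\<integral>\<^sup>+x. ennreal ((b x)\<^sup>2) \<partial>M) \<le> ennreal B"
    and "0 \<le> A" "0 \<le> B"
  shows "(\<integral>\<^sup>+x. ennreal ((a x - b x)\<^sup>2) \<partial>M) \<le> ennreal (2 * (A + B))"
proof -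
  have "(\<integral>\<^sup>+x. ennreal ((a x - b x)\<^sup>2) \<partial>M) \<le> (\<integral>\<^sup>+x. 2 * (ennreal ((a x)\<^sup>2) + ennreal ((b x)\<^sup>2)) \<partial>M)"
  proof (rule nn_integral_mono)
    fix x
    have "(a x - b x)\<^sup>2 \<le> 2 * ((a x)\<^sup>2 + (b x)\<^sup>2)"
      using sum_squares_bound[of "a x" "- b x"] by (simp add: power2_eq_square algebra_simps)
    hence "ennreal ((a x - b x)\<^sup>2) \<le> ennreal (2 * ((a x)\<^sup>2 + (b x)\<^sup>2))" by (rule ennreal_leI)
    thus "ennreal ((a x - b x)\<^sup>2) \<le> 2 * (ennreal ((a x)\<^sup>2) + ennreal ((b x)\<^sup>2))" by (simp add: ennreal_mult)
  qed
  also have "\<dots> = 2 * ((\<integral>\<^sup>+x. ennreal ((a x)\<^sup>2) \<partial>M) + (\<integral>\<^sup>+x. ennreal ((b x)\<^sup>2) \<partial>M))"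
    by (simp add: nn_integral_cmult nn_integral_add)
  also have "\<dots> \<le> 2 * (ennreal A + ennreal B)" by (intro mult_left_mono add_mono assms) auto
  also have "\<dots> = ennreal (2 * (A + B))" using assms(5,6) by (simp add: ennreal_mult)
  finally show ?thesis .
qed

text \<open>
  The bounds are inherited by the translates from the original functions, so the weak gradients
  of the translates do not have to be computed.
\<close>

theorem bounded_translates_AE_subsequence:
  fixes un :: "nat \<Rightarrow> real ^ 'n \<Rightarrow> real" and a :: "nat \<Rightarrow> real ^ 'n"
  assumes un: "\<And>k. un k \<in> H1" and bound: "\<And>k. (H1_norm s (un k))\<^sup>2 \<le> M"
    and weak: "H1_weakly_converges s (\<lambda>k x. un k (x - a k)) u"
  shows "\<exists>r :: nat \<Rightarrow> nat. strict_mono r \<and> (AE x in lborel. (\<lambda>k. un (r k) (x - a (r k))) \<longlonglongrightarrow> u x)"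
proof -
  let ?w = "\<lambda>k x. un k (x - a k)"
  have u: "u \<in> H1" and w: "\<And>k. ?w k \<in> H1"
    and lim: "\<And>L. L \<in> H1_dual s \<Longrightarrow> (\<lambda>k. L (?w k)) \<longlonglongrightarrow> L u"
    using weak by (simp_all add: H1_weakly_converges_def)
  note um[measurable] = square_integrable_real(1)[OF H1_grad(1)[OF u]]
  note unm[measurable] = square_integrable_real(1)[OF H1_grad(1)[OF un]]
  have M0: "0 \<le> M" using bound[of 0] zero_le_power2 order_trans by blast
  have bounds: "(L2_norm (grad v))\<^sup>2 \<le> (H1_norm s v)\<^sup>2" "(L2_norm v)\<^sup>2 \<le> (H1_norm s v)\<^sup>2" for v :: "real ^ 'n \<Rightarrow> real"
    using gagliardo_form_nonneg[of s v] by (simp_all add: H1_norm_square)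
  define B where "B = (H1_norm s u)\<^sup>2"
  have B0: "0 \<le> B" by (simp add: B_def)
  let ?D = "\<lambda>k x. ?w k x - u x"
  have "\<exists>r :: nat \<Rightarrow> nat. strict_mono r \<and> (AE x in lborel. (\<lambda>k. ?D (r k) x) \<longlonglongrightarrow> 0)"
  proof (rule AE_convergent_subsequence_of_vanishing_averages)
    show "?D k \<in> borel_measurable borel" for k by measurable
    show "(\<integral>\<^sup>+x. ennreal ((?D k x)\<^sup>2) \<partial>lborel) \<le> ennreal (2 * (M + B))" for k
    proof (rule nn_integral_square_diff_le[OF _ _ _ _ M0 B0])
      have "(\<integral>\<^sup>+x. ennreal ((?w k x)\<^sup>2) \<partial>lborel) = (\<integral>\<^sup>+x. ennreal ((un k x)\<^sup>2) \<partial>lborel)"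
        by (rule nn_integral_translate(3)) measurable
      also have "\<dots> \<le> ennreal M"
        using H1_square_bound(1)[OF un] order_trans[OF bounds(2) bound] by (simp add: ennreal_leI)
      finally show "(\<integral>\<^sup>+x. ennreal ((?w k x)\<^sup>2) \<partial>lborel) \<le> ennreal M" .
      show "(\<integral>\<^sup>+x. ennreal ((u x)\<^sup>2) \<partial>lborel) \<le> ennreal B"
        using H1_square_bound(1)[OF u] bounds(2)[of u] by (simp add: B_def ennreal_leI)
    qed measurable
    show "(\<integral>\<^sup>+x. ennreal ((?D k (x + h) - ?D k x)\<^sup>2) \<partial>lborel) \<le> ennreal (2 * (M + B) * (norm h)\<^sup>2)" for k h
    proof -
      have tr: "(\<integral>\<^sup>+x. ennreal ((v (x + h) - v x)\<^sup>2) \<partial>lborel) \<le> ennreal ((norm h)\<^sup>2 * (H1_norm s v)\<^sup>2)" if "v \<in> H1" for v :: "real ^ 'n \<Rightarrow> real"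
      proof -
        have "(\<integral>\<^sup>+x. ennreal ((v (x + h) - v x)\<^sup>2) \<partial>lborel) \<le> ennreal ((norm h)\<^sup>2) * ennreal ((L2_norm (grad v))\<^sup>2)"
          using H1_translation_estimate[OF H1_grad[OF that], of h] H1_square_bound(2)[OF that] by simp
        also have "\<dots> \<le> ennreal ((norm h)\<^sup>2 * (H1_norm s v)\<^sup>2)"
          by (simp add: ennreal_mult[symmetric] ennreal_leI mult_left_mono bounds)
        finally show ?thesis .
      qed
      have "(\<integral>\<^sup>+x. ennreal (((?w k (x + h) - ?w k x) - (u (x + h) - u x))\<^sup>2) \<partial>lborel)
          \<le> ennreal (2 * ((norm h)\<^sup>2 * M + (norm h)\<^sup>2 * B))"
      proof (rule nn_integral_square_diff_le)
        have "(\<integral>\<^sup>+x. ennreal ((?w k (x + h) - ?w k x)\<^sup>2) \<partial>lborel)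
          = (\<integral>\<^sup>+x. ennreal ((un k (x - a k + h) - un k (x - a k))\<^sup>2) \<partial>lborel)"
          by (simp add: algebra_simps)
        also have "\<dots> = (\<integral>\<^sup>+x. ennreal ((un k (x + h) - un k x)\<^sup>2) \<partial>lborel)"
          by (rule nn_integral_translate(3)[where f="\<lambda>x. ennreal ((un k (x + h) - un k x)\<^sup>2)"]) measurable
        also have "\<dots> \<le> ennreal ((norm h)\<^sup>2 * (H1_norm s (un k))\<^sup>2)" by (rule tr[OF un])
        also have "\<dots> \<le> ennreal ((norm h)\<^sup>2 * M)" by (intro ennreal_leI mult_left_mono bound) auto
        finally show "(\<integral>\<^sup>+x. ennreal ((?w k (x + h) - ?w k x)\<^sup>2) \<partial>lborel) \<le> ennreal ((norm h)\<^sup>2 * M)" .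
        show "(\<integral>\<^sup>+x. ennreal ((u (x + h) - u x)\<^sup>2) \<partial>lborel) \<le> ennreal ((norm h)\<^sup>2 * B)"
          using tr[OF u] by (simp add: B_def)
      qed (use M0 B0 in \<open>measurable, auto\<close>)
      thus ?thesis by (simp add: algebra_simps)
    qed
    show "(\<lambda>k. LINT y|lborel. indicator (ball x \<epsilon>) y * ?D k y) \<longlonglongrightarrow> 0" for x \<epsilon>
    proof -
      have i: "integrable lborel (\<lambda>y. indicator (ball x \<epsilon>) y * v y)" if "v \<in> H1" for v :: "real ^ 'n \<Rightarrow> real"
        using square_integrable_real[OF H1_grad(1)[OF that]] by (rule integrable_ball_indicator_mult)
      have "(\<lambda>k. (LINT y|lborel. indicator (ball x \<epsilon>) y * ?w k y) - (LINT y|lborel. indicator (ball x \<epsilon>) y * u y))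
        \<longlonglongrightarrow> (LINT y|lborel. indicator (ball x \<epsilon>) y * u y) - (LINT y|lborel. indicator (ball x \<epsilon>) y * u y)"
        by (intro tendsto_diff tendsto_const lim[OF H1_dual_ball_average])
      thus ?thesis using i[OF w] i[OF u] by (simp add: right_diff_distrib)
    qed
  qed (use M0 B0 in auto)
  then obtain r :: "nat \<Rightarrow> nat" where r: "strict_mono r" "AE x in lborel. (\<lambda>k. ?D (r k) x) \<longlonglongrightarrow> 0" by blast
  from r(2) have "AE x in lborel. (\<lambda>k. ?w (r k) x) \<longlonglongrightarrow> u x"
    by eventually_elim (rule LIM_zero_cancel)
  thus ?thesis using r(1) by blast
qed

section \<open>The energy along rays\<close>

lemma H1_dual_norm_bound:
  assumes L: "L \<in> H1_dual s" and v: "v \<in> H1"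
  shows "\<bar>L v\<bar> \<le> H1_dual_norm s L * H1_norm s v"
proof -
  obtain K where "\<forall>w\<in>H1. \<bar>L w\<bar> \<le> K * H1_norm s w" using L by (auto simp: H1_dual_def)
  hence K: "\<bar>L w\<bar> \<le> K * H1_norm s w" if "w \<in> H1" for w using that by blast
  have hom: "L (\<lambda>x. c * w x) = c * L w" if "w \<in> H1" for c w using L that by (auto simp: H1_dual_def)
  let ?n = "H1_norm s v"
  show ?thesis
  proof (cases "?n = 0")
    case True thus ?thesis using K[OF v] by simp
  next
    case False
    hence n: "0 < ?n" using H1_norm_nonneg[of s v] by simp
    let ?v = "\<lambda>x. (1 / ?n) * v x"
    have "H1_norm s ?v = 1" using H1_norm_scale[OF v, of s "1 / ?n"] n by simp
    hence "H1_norm s ?v \<le> 1" by (rule eq_refl)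
    hence "\<bar>L ?v\<bar> \<in> {\<bar>L v\<bar> | v. v \<in> H1 \<and> H1_norm s v \<le> 1}"
      by (intro CollectI exI[of _ ?v] conjI refl H1_scale[OF v])
    moreover have "bdd_above {\<bar>L v\<bar> | v. v \<in> H1 \<and> H1_norm s v \<le> 1}"
    proof (rule bdd_aboveI[where M="\<bar>K\<bar>"])
      fix z assume "z \<in> {\<bar>L v\<bar> | v. v \<in> H1 \<and> H1_norm s v \<le> 1}"
      then obtain w where w: "z = \<bar>L w\<bar>" "w \<in> H1" "H1_norm s w \<le> 1" by auto
      have "\<bar>L w\<bar> \<le> K * H1_norm s w" by (rule K) (rule w)
      also have "\<dots> \<le> \<bar>K\<bar> * 1" using w H1_norm_nonneg[of s w] by (intro mult_mono) auto
      finally show "z \<le> \<bar>K\<bar>" using w by simp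
    qed
    ultimately have "\<bar>L ?v\<bar> \<le> H1_dual_norm s L" unfolding H1_dual_norm_def by (rule cSup_upper)
    moreover have "\<bar>L ?v\<bar> = \<bar>L v\<bar> / ?n" using hom[OF v, of "1 / ?n"] n by (simp add: abs_mult)
    ultimately show ?thesis using n by (simp add: divide_le_eq)
  qed
qed

lemma energy_eq: "energy s \<alpha> F u = (H1_norm s u)\<^sup>2 / 2 - choquard_term \<alpha> F u / 2"
  by (simp add: energy_def H1_norm_square add_divide_distrib)

context choquard_nonlinearity
begin

text \<open>
  Half the derivative of the Choquard term at \<open>v\<close> in the direction
  \<open>v\<close>; this is \<open>B v\<close> in the introduction.
\<close>

abbreviation radial_derivative :: "(real ^ 'n \<Rightarrow> real) \<Rightarrow> real" where
  "radial_derivative v \<equiv> pairing F (\<lambda>t. t * f t) v"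

lemma energy_ray:
  assumes v: "(v :: real ^ 'n \<Rightarrow> real) \<in> H1" and t: "0 \<le> t"
  shows "energy s \<alpha> F (\<lambda>x. t * v x) \<le> energy s \<alpha> F v + (t\<^sup>2 - 1) / 2 * ((H1_norm s v)\<^sup>2 - radial_derivative v)"
proof -
  have "(H1_norm s (\<lambda>x. t * v x))\<^sup>2 = t\<^sup>2 * (H1_norm s v)\<^sup>2"
    using H1_norm_scale[OF v, of s t] by (simp add: power_mult_distrib)
  moreover have "X / 2 - A' / 2 \<le> (h / 2 - A / 2) + (t\<^sup>2 - 1) / 2 * (h - B)"
    if "X = t\<^sup>2 * h" "A + (t\<^sup>2 - 1) * B \<le> A'" for X A A' h B :: real
    using that by (simp add: field_simps)
  ultimately show ?thesis using choquard_term_ray[OF v t] unfolding energy_eq by blast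
qed

text \<open>
  The upper bound \<open>energy_ray\<close> holds on both sides of \<open>t = 1\<close>. Since
  \<open>t - 1\<close> changes sign there, it pins the derivative from above and from below; the
  Choquard term never has to be differentiated under the integral sign.
\<close>

lemma derivative_along_ray:
  assumes v: "(v :: real ^ 'n \<Rightarrow> real) \<in> H1" and L: "H1_has_derivative s (energy s \<alpha> F) v L"
  shows "L v = (H1_norm s v)\<^sup>2 - radial_derivative v"
proof -
  let ?H = "H1_norm s v"
  define \<kappa> where "\<kappa> = ?H\<^sup>2 - radial_derivative v"
  have H: "0 \<le> ?H" by (rule H1_norm_nonneg)
  have hom: "L (\<lambda>x. c * v x) = c * L v" for c using L v by (auto simp: H1_has_derivative_def H1_dual_def)
  have "\<bar>L v - \<kappa>\<bar> \<le> e" if e: "0 < e" for e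
  proof -
    define \<epsilon> where "\<epsilon> = e / (2 * (?H + 1))"
    have \<epsilon>: "0 < \<epsilon>" using e H by (simp add: \<epsilon>_def)
    have "\<epsilon> * ?H \<le> \<epsilon> * (?H + 1)" using \<epsilon> by (intro mult_left_mono) auto
    also have "\<dots> = e / 2" using H by (simp add: \<epsilon>_def field_simps)
    finally have \<epsilon>H: "\<epsilon> * ?H \<le> e / 2" .
    obtain \<delta> where \<delta>: "0 < \<delta>" and D: "\<And>h. h \<in> H1 \<Longrightarrow> H1_norm s h < \<delta> \<Longrightarrow>
        \<bar>energy s \<alpha> F (\<lambda>x. v x + h x) - energy s \<alpha> F v - L h\<bar> \<le> \<epsilon> * H1_norm s h"
      using L \<epsilon> unfolding H1_has_derivative_def by blast
    \<comment> \<open>Small enough for the difference quotient to be within \<open>\<epsilon>\<close>, and for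
        the quadratic remainder \<open>\<tau> \<kappa>\<close> to be at most \<open>e\<close>.\<close>
    define \<tau> where "\<tau> = min 1 (min (\<delta> / (2 * (?H + 1))) (e / (\<bar>\<kappa>\<bar> + 1)))"
    have \<tau>: "0 < \<tau>" "\<tau> \<le> 1" "\<tau> \<le> \<delta> / (2 * (?H + 1))" "\<tau> \<le> e / (\<bar>\<kappa>\<bar> + 1)"
      using \<delta> e H by (auto simp: \<tau>_def)
    have "\<tau> * ?H \<le> \<delta> / (2 * (?H + 1)) * ?H" using \<tau> H by (intro mult_right_mono) auto
    also have "\<dots> = \<delta> * ?H / (2 * (?H + 1))" by simp
    also have "\<dots> < \<delta>"
    proof -
      have "\<delta> * ?H < \<delta> * (2 * (?H + 1))" using \<delta> H by (intro mult_strict_left_mono) auto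
      thus ?thesis using H by (subst pos_divide_less_eq) auto
    qed
    finally have \<tau>H: "\<tau> * ?H < \<delta>" .
    have "\<tau> * \<bar>\<kappa>\<bar> \<le> e / (\<bar>\<kappa>\<bar> + 1) * \<bar>\<kappa>\<bar>" using \<tau> by (intro mult_right_mono) auto
    also have "\<dots> \<le> e" using e by (simp add: divide_le_eq mult_left_mono)
    finally have \<tau>\<kappa>: "\<tau> * \<bar>\<kappa>\<bar> \<le> e" .
    have step: "\<sigma> * L v \<le> (\<sigma> + \<sigma>\<^sup>2 / 2) * \<kappa> + \<epsilon> * (\<bar>\<sigma>\<bar> * ?H)" if \<sigma>: "\<bar>\<sigma>\<bar> = \<tau>" for \<sigma>
    proof -
      have n: "H1_norm s (\<lambda>x. \<sigma> * v x) = \<bar>\<sigma>\<bar> * ?H" by (rule H1_norm_scale[OF v])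
      have "\<bar>energy s \<alpha> F (\<lambda>x. v x + \<sigma> * v x) - energy s \<alpha> F v - L (\<lambda>x. \<sigma> * v x)\<bar> \<le> \<epsilon> * H1_norm s (\<lambda>x. \<sigma> * v x)"
        using \<sigma> \<tau>H n by (intro D H1_scale[OF v]) simp
      hence le: "\<sigma> * L v \<le> energy s \<alpha> F (\<lambda>x. v x + \<sigma> * v x) - energy s \<alpha> F v + \<epsilon> * (\<bar>\<sigma>\<bar> * ?H)"
        unfolding n hom by linarith
      have eq: "(\<lambda>x. v x + \<sigma> * v x) = (\<lambda>x. (1 + \<sigma>) * v x)" by (simp add: fun_eq_iff distrib_right)
      have sq: "((1 + \<sigma>)\<^sup>2 - 1) / 2 = \<sigma> + \<sigma>\<^sup>2 / 2" by (simp add: power2_eq_square field_simps)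
      have "0 \<le> 1 + \<sigma>" using \<sigma> \<tau> by linarith
      from energy_ray[OF v this, of s]
      have "energy s \<alpha> F (\<lambda>x. (1 + \<sigma>) * v x) \<le> energy s \<alpha> F v + (\<sigma> + \<sigma>\<^sup>2 / 2) * \<kappa>"
        unfolding \<kappa>_def sq .
      thus ?thesis using le unfolding eq by linarith
    qed
    have "\<tau> * L v \<le> \<tau> * (\<kappa> + \<tau> * \<kappa> / 2 + \<epsilon> * ?H)"
      using step[of \<tau>] \<tau> by (simp add: power2_eq_square algebra_simps)
    hence up: "L v \<le> \<kappa> + \<tau> * \<kappa> / 2 + \<epsilon> * ?H" using \<tau> by simp
    have "\<tau> * (\<kappa> - \<tau> * \<kappa> / 2 - \<epsilon> * ?H) \<le> \<tau> * L v"
      using step[of "- \<tau>"] \<tau> by (simp add: power2_eq_square algebra_simps)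
    hence lo: "\<kappa> - \<tau> * \<kappa> / 2 - \<epsilon> * ?H \<le> L v" using \<tau> by simp
    have "\<bar>\<tau> * \<kappa>\<bar> \<le> e" using \<tau>\<kappa> \<tau> by (simp add: abs_mult)
    thus ?thesis using up lo \<epsilon>H by (simp add: abs_le_iff)
  qed
  hence "\<bar>L v - \<kappa>\<bar> \<le> 0" by (rule field_le_epsilon[of _ 0, simplified])
  thus ?thesis by (simp add: \<kappa>_def)
qed

lemma weak_solution_Nehari:
  assumes "weak_solution s \<alpha> F f (v :: real ^ 'n \<Rightarrow> real)"
  shows "(H1_norm s v)\<^sup>2 = radial_derivative v"
proof -
  have v: "v \<in> H1" and eq: "(LINT x|lborel. grad v x \<bullet> grad v x) + gagliardo_form s v v + (LINT x|lborel. v x * v x)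
        = (LINT x|lborel. riesz_conv \<alpha> (\<lambda>y. F (v y)) x * f (v x) * v x)"
    using assms by (auto simp: weak_solution_def)
  have "(LINT x|lborel. riesz_conv \<alpha> (\<lambda>y. F (v y)) x * f (v x) * v x)
      = (LINT x|lborel. riesz_conv \<alpha> (\<lambda>y. F (v y)) x * (v x * f (v x)))"
    by (simp add: mult_ac)
  also have "\<dots> = radial_derivative v" by (rule pairing_eq_iterated[OF v dominated_F dominated_tf])
  finally show ?thesis using eq unfolding H1_norm_square L2_norm_square power2_norm_eq_inner
    by (simp add: inner_real_def algebra_simps)
qed

lemma nontrivial_solution_pos:
  assumes v: "v \<in> (nontrivial_weak_solutions s \<alpha> F f :: (real ^ 'n \<Rightarrow> real) set)"
  shows "0 < radial_derivative v"
proof -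
  have sol: "weak_solution s \<alpha> F f v" and nz: "\<not> (AE x in lborel. v x = 0)"
    using v by (auto simp: nontrivial_weak_solutions_def)
  have "v \<in> H1" using sol by (simp add: weak_solution_def)
  hence i: "integrable lborel (\<lambda>x. (v x)\<^sup>2)" by (intro square_integrable_real H1_grad)
  have "(LINT x|lborel. (v x)\<^sup>2) \<noteq> 0"
    using integral_nonneg_eq_0_iff_AE[OF i] nz by simp
  hence "0 < (L2_norm v)\<^sup>2" by (simp add: L2_norm_square less_le)
  also have "\<dots> \<le> (H1_norm s v)\<^sup>2" using gagliardo_form_nonneg[of s v] by (simp add: H1_norm_square)
  finally show ?thesis using weak_solution_Nehari[OF sol] by simp
qed

text \<open>
  The ray inequality is applied at \<open>2 v\<close> instead of \<open>v\<close>: based at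
  \<open>v\<close> it only shows that the energy does not exceed \<open>I v\<close>, while at
  \<open>2 v\<close> the strict inequality \<open>B(2 v) > 4 B v\<close> makes the quadratic
  coefficient negative.
\<close>

lemma energy_ray_negative:
  assumes v: "v \<in> (nontrivial_weak_solutions s \<alpha> F f :: (real ^ 'n \<Rightarrow> real) set)"
  obtains T where "0 \<le> T" "energy s \<alpha> F (\<lambda>x. T * v x) < 0"
proof -
  have sol: "weak_solution s \<alpha> F f v" using v by (simp add: nontrivial_weak_solutions_def)
  hence vH: "v \<in> H1" by (simp add: weak_solution_def)
  let ?w = "\<lambda>x. 2 * v x"
  have w: "?w \<in> H1" by (rule H1_scale[OF vH])
  define h where "h = (H1_norm s v)\<^sup>2"
  define B where "B = radial_derivative ?w"
  have hB: "4 * h < B"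
    using pairing_doubling_strict[OF vH nontrivial_solution_pos[OF v]] weak_solution_Nehari[OF sol] by (simp add: h_def B_def)
  have h0: "0 \<le> h" by (simp add: h_def)
  have w2: "(H1_norm s ?w)\<^sup>2 = 4 * h"
    using H1_norm_scale[OF vH, of s 2] by (simp add: h_def power_mult_distrib)
  have A0: "0 \<le> choquard_term \<alpha> F ?w" unfolding choquard_term_eq[OF w] by (rule pairing_nonneg[OF dominated_F dominated_F])
  \<comment> \<open>Chosen so that \<open>\<tau> (B - 4 h) > B\<close>; since \<open>\<tau> \<ge> 1\<close>,
      the same holds with \<open>\<tau>\<^sup>2\<close>.\<close>
  define \<tau> where "\<tau> = B / (B - 4 * h) + 1"
  have \<tau>1: "1 \<le> \<tau>" using hB h0 by (simp add: \<tau>_def)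
  have "B < \<tau> * (B - 4 * h)" using hB by (simp add: \<tau>_def distrib_right)
  also have "\<dots> \<le> \<tau>\<^sup>2 * (B - 4 * h)" using \<tau>1 hB by (intro mult_right_mono) (auto simp: power2_eq_square)
  finally have \<tau>: "B < \<tau>\<^sup>2 * (B - 4 * h)" .
  have "energy s \<alpha> F (\<lambda>x. \<tau> * ?w x) \<le> energy s \<alpha> F ?w + (\<tau>\<^sup>2 - 1) / 2 * (4 * h - B)"
    using energy_ray[OF w, of \<tau> s] \<tau>1 by (simp add: w2 B_def)
  also have "energy s \<alpha> F ?w \<le> 2 * h" unfolding energy_eq w2 using A0 by simp
  also have "2 * h + (\<tau>\<^sup>2 - 1) / 2 * (4 * h - B) = (B - \<tau>\<^sup>2 * (B - 4 * h)) / 2"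
    by (simp add: field_simps)
  also have "\<dots> < 0" using \<tau> by simp
  finally have "energy s \<alpha> F (\<lambda>x. (\<tau> * 2) * v x) < 0" by (simp add: mult.assoc)
  thus thesis using \<tau>1 by (intro that[of "\<tau> * 2"]) auto
qed

theorem mountain_pass_level_le_solution_energy:
  assumes v: "v \<in> (nontrivial_weak_solutions s \<alpha> F f :: (real ^ 'n \<Rightarrow> real) set)"
  shows "mountain_pass_level TYPE('n) s \<alpha> F \<le> ereal (energy s \<alpha> F v)"
proof -
  have sol: "weak_solution s \<alpha> F f v" using v by (simp add: nontrivial_weak_solutions_def)
  hence vH: "v \<in> H1" by (simp add: weak_solution_def)
  obtain T where T: "0 \<le> T" "energy s \<alpha> F (\<lambda>x. T * v x) < 0" by (rule energy_ray_negative[OF v])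
  define \<rho> where "\<rho> z x = (z * T) * v x" for z x
  have path: "\<rho> \<in> mountain_pass_paths s \<alpha> F"
    unfolding mountain_pass_paths_def mem_Collect_eq
  proof (intro conjI ballI)
    show "\<rho> z \<in> H1" for z unfolding \<rho>_def by (rule H1_scale[OF vH])
    show "((\<lambda>w. H1_norm s (\<lambda>x. \<rho> w x - \<rho> z x)) \<longlongrightarrow> 0) (at z within {0..1})" for z
    proof -
      have "H1_norm s (\<lambda>x. \<rho> w x - \<rho> z x) = \<bar>(w - z) * T\<bar> * H1_norm s v" for w
        using H1_norm_scale[OF vH, of s "(w - z) * T"] by (simp add: \<rho>_def left_diff_distrib)
      moreover have "((\<lambda>w. \<bar>(w - z) * T\<bar> * H1_norm s v) \<longlongrightarrow> \<bar>(z - z) * T\<bar> * H1_norm s v) (at z within {0..1})"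
        by (intro tendsto_intros)
      ultimately show ?thesis by simp
    qed
    show "AE x in lborel. \<rho> 0 x = 0" by (simp add: \<rho>_def)
    show "energy s \<alpha> F (\<rho> 1) < 0" using T by (simp add: \<rho>_def[abs_def])
  qed
  have "mountain_pass_level TYPE('n) s \<alpha> F \<le> (SUP z\<in>{0..1}. ereal (energy s \<alpha> F (\<rho> z)))"
    unfolding mountain_pass_level_def by (rule INF_lower[OF path])
  also have "\<dots> \<le> ereal (energy s \<alpha> F v)"
  proof (rule SUP_least)
    fix z :: real assume "z \<in> {0..1}"
    hence "0 \<le> z * T" using T by simp
    from energy_ray[OF vH this, of s] show "ereal (energy s \<alpha> F (\<rho> z)) \<le> ereal (energy s \<alpha> F v)"
      using weak_solution_Nehari[OF sol] by (simp add: \<rho>_def[abs_def])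
  qed
  finally show ?thesis .
qed

text \<open>
  Twice the energy minus the radial derivative of the energy is the pairing of \<open>F\<close>
  with this nonnegative function, which makes that quantity accessible to Fatou's lemma.
\<close>

section \<open>The energy defect\<close>

abbreviation gap :: "real \<Rightarrow> real" where
  "gap t \<equiv> t * f t - F t"

lemma dominated_gap: "dominated gap"
proof -
  have "gap \<in> borel_measurable borel" by measurable
  thus ?thesis using F_le_tf F_nonneg by (simp add: dominated_def)
qed

lemma pairing_gap:
  assumes v: "(v :: real ^ 'n \<Rightarrow> real) \<in> H1"
  shows "pairing F gap v = radial_derivative v - pairing F F v"
  using integrable_pairing[OF v dominated_F dominated_tf] integrable_pairing[OF v dominated_F dominated_F]
  unfolding pairing_def by (subst Bochner_Integration.integral_diff[symmetric]) (auto simp: split_beta' right_diff_distrib)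

lemma pairing_nn_integral:
  assumes v: "(v :: real ^ 'n \<Rightarrow> real) \<in> H1" and p: "dominated p" and r: "dominated r"
  shows "ennreal (pairing p r v)
    = (\<integral>\<^sup>+x. \<integral>\<^sup>+y. ennreal (riesz_potential \<alpha> (x - y) * p (v y) * r (v x)) \<partial>lborel \<partial>lborel)"
proof -
  let ?K = "\<lambda>(x, y). riesz_potential \<alpha> (x - y) * p (v y) * r (v x)"
  note I = integrable_pairing[OF v p r]
  note [measurable] = square_integrable_real(1)[OF H1_grad(1)[OF v]]
  have [measurable]: "p \<in> borel_measurable borel" "r \<in> borel_measurable borel" using p r by (simp_all add: dominated_def)
  have "ennreal (pairing p r v) = (\<integral>\<^sup>+z. ennreal (?K z) \<partial>(lborel \<Otimes>\<^sub>M lborel))"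
    unfolding pairing_def using p r
    by (intro nn_integral_eq_integral[OF I, symmetric] AE_I2) (auto simp: dominated_def riesz_potential_nonneg)
  also have "\<dots> = (\<integral>\<^sup>+x. \<integral>\<^sup>+y. ennreal (?K (x, y)) \<partial>lborel \<partial>lborel)"
    by (intro lborel.nn_integral_fst[symmetric]) measurable
  finally show ?thesis by simp
qed

lemma pairing_translate:
  assumes v: "(v :: real ^ 'n \<Rightarrow> real) \<in> H1" and p: "dominated p" and r: "dominated r"
  shows "(\<integral>\<^sup>+x. \<integral>\<^sup>+y. ennreal (riesz_potential \<alpha> (x - y) * p (v (y - a)) * r (v (x - a))) \<partial>lborel \<partial>lborel)
    = ennreal (pairing p r v)"
proof -
  note [measurable] = square_integrable_real(1)[OF H1_grad(1)[OF v]]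
  have [measurable]: "p \<in> borel_measurable borel" "r \<in> borel_measurable borel" using p r by (simp_all add: dominated_def)
  let ?f = "\<lambda>x y. ennreal (riesz_potential \<alpha> (x - y) * p (v y) * r (v x))"
  have "(\<integral>\<^sup>+y. ennreal (riesz_potential \<alpha> (x - y) * p (v (y - a)) * r (v (x - a))) \<partial>lborel) = (\<integral>\<^sup>+y. ?f (x - a) y \<partial>lborel)" for x
  proof -
    have "(\<integral>\<^sup>+y. ?f (x - a) (y - a) \<partial>lborel) = (\<integral>\<^sup>+y. ?f (x - a) y \<partial>lborel)"
      by (rule nn_integral_translate(3)) measurable
    thus ?thesis by simp
  qed
  hence "(\<integral>\<^sup>+x. \<integral>\<^sup>+y. ennreal (riesz_potential \<alpha> (x - y) * p (v (y - a)) * r (v (x - a))) \<partial>lborel \<partial>lborel)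
     = (\<integral>\<^sup>+x. \<integral>\<^sup>+y. ?f (x - a) y \<partial>lborel \<partial>lborel)" by simp
  also have "\<dots> = (\<integral>\<^sup>+x. \<integral>\<^sup>+y. ?f x y \<partial>lborel \<partial>lborel)"
    by (rule nn_integral_translate(3)[where f="\<lambda>x. \<integral>\<^sup>+y. ?f x y \<partial>lborel"]) measurable
  also have "\<dots> = ennreal (pairing p r v)" by (rule pairing_nn_integral[OF v p r, symmetric])
  finally show ?thesis .
qed

text \<open>
  Translating both variables leaves the double integral unchanged, so the lower limit can be
  computed along the translates, which converge almost everywhere; Fatou's lemma is applied to
  each of the two integrals.
\<close>

theorem pairing_gap_Fatou:
  fixes un :: "nat \<Rightarrow> real ^ 'n \<Rightarrow> real" and a :: "nat \<Rightarrow> real ^ 'n"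
  assumes f: "continuous_on UNIV f" and un: "\<And>k. un k \<in> H1" and u: "u \<in> H1"
    and conv: "AE x in lborel. (\<lambda>k. un k (x - a k)) \<longlonglongrightarrow> u x"
  shows "ennreal (pairing F gap u) \<le> liminf (\<lambda>k. ennreal (pairing F gap (un k)))"
proof -
  note um[measurable] = square_integrable_real(1)[OF H1_grad(1)[OF u]]
  note unm[measurable] = square_integrable_real(1)[OF H1_grad(1)[OF un]]
  let ?w = "\<lambda>k x. un k (x - a k)"
  let ?K = "\<lambda>v x y. ennreal (riesz_potential \<alpha> (x - y) * F (v y) * gap (v x))"
  have cont: "isCont F t" "isCont f t" for t
    using F_deriv DERIV_isCont f by (auto simp: continuous_on_eq_continuous_at)
  have ptw: "(\<lambda>k. ?K (?w k) x y) \<longlonglongrightarrow> ?K u x y"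
    if "(\<lambda>k. ?w k x) \<longlonglongrightarrow> u x" "(\<lambda>k. ?w k y) \<longlonglongrightarrow> u y" for x y
  proof -
    have "(\<lambda>k. F (?w k y)) \<longlonglongrightarrow> F (u y)" "(\<lambda>k. F (?w k x)) \<longlonglongrightarrow> F (u x)" "(\<lambda>k. f (?w k x)) \<longlonglongrightarrow> f (u x)"
      using isCont_tendsto_compose[OF cont(1)] isCont_tendsto_compose[OF cont(2)] that by auto
    thus ?thesis using that by (intro tendsto_ennrealI tendsto_mult tendsto_diff tendsto_const)
  qed
  have inner: "AE x in lborel. (\<integral>\<^sup>+y. ?K u x y \<partial>lborel) \<le> liminf (\<lambda>k. \<integral>\<^sup>+y. ?K (?w k) x y \<partial>lborel)"
    using conv
  proof eventually_elim
    case (elim x)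
    have "(\<integral>\<^sup>+y. ?K u x y \<partial>lborel) = (\<integral>\<^sup>+y. liminf (\<lambda>k. ?K (?w k) x y) \<partial>lborel)"
    proof (rule nn_integral_cong_AE, use conv in eventually_elim)
      case (elim y)
      show ?case using lim_imp_Liminf[OF _ ptw[OF \<open>(\<lambda>k. ?w k x) \<longlonglongrightarrow> u x\<close> elim]] by simp
    qed
    also have "\<dots> \<le> liminf (\<lambda>k. \<integral>\<^sup>+y. ?K (?w k) x y \<partial>lborel)"
      by (rule nn_integral_liminf) measurable
    finally show ?case .
  qed
  have "ennreal (pairing F gap u) = (\<integral>\<^sup>+x. \<integral>\<^sup>+y. ?K u x y \<partial>lborel \<partial>lborel)"
    by (rule pairing_nn_integral[OF u dominated_F dominated_gap])
  also have "\<dots> \<le> (\<integral>\<^sup>+x. liminf (\<lambda>k. \<integral>\<^sup>+y. ?K (?w k) x y \<partial>lborel) \<partial>lborel)"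
    by (rule nn_integral_mono_AE[OF inner])
  also have "\<dots> \<le> liminf (\<lambda>k. \<integral>\<^sup>+x. \<integral>\<^sup>+y. ?K (?w k) x y \<partial>lborel \<partial>lborel)"
    by (rule nn_integral_liminf) measurable
  also have "\<dots> = liminf (\<lambda>k. ennreal (pairing F gap (un k)))"
    using pairing_translate[OF un dominated_F dominated_gap] by simp
  finally show ?thesis .
qed

text \<open>
  The multiple of the Pohozaev functional is the one that cancels the Choquard term. The
  remaining coefficients are \<open>\<alpha> + 2\<close>, \<open>\<alpha> + 2 s\<close> and
  \<open>\<alpha>\<close>, each divided by \<open>2 (N + \<alpha>)\<close>, and
  \<open>\<alpha>\<close> is the smallest.
\<close>

lemma energy_minus_pohozaev:
  fixes v :: "real ^ 'n \<Rightarrow> real"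
  assumes s: "0 < s"
  shows "\<alpha> / (2 * (real CARD('n) + \<alpha>)) * (H1_norm s v)\<^sup>2
    \<le> energy s \<alpha> F v - pohozaev s \<alpha> F v / (real CARD('n) + \<alpha>)"
proof -
  let ?N = "real CARD('n)"
  let ?X = "(L2_norm (grad v))\<^sup>2" and ?Y = "(L2_norm v)\<^sup>2" and ?Z = "gagliardo_form s v v" and ?A = "choquard_term \<alpha> F v"
  have N\<alpha>: "0 < ?N + \<alpha>" using \<alpha> by simp
  have "(?N + \<alpha>) * (energy s \<alpha> F v - pohozaev s \<alpha> F v / (?N + \<alpha>)) = (?N + \<alpha>) * energy s \<alpha> F v - pohozaev s \<alpha> F v"
    using N\<alpha> by (simp add: right_diff_distrib)
  also have "\<dots> = \<alpha> / 2 * (?X + ?Y + ?Z) + ?X + s * ?Z"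
    unfolding energy_def pohozaev_def by (simp add: field_simps)
  also have "\<dots> \<ge> \<alpha> / 2 * (?X + ?Y + ?Z)"
    using s gagliardo_form_nonneg[of s v] by simp
  finally have "\<alpha> / 2 * (H1_norm s v)\<^sup>2 \<le> (?N + \<alpha>) * (energy s \<alpha> F v - pohozaev s \<alpha> F v / (?N + \<alpha>))"
    by (simp add: H1_norm_square)
  hence "\<alpha> / 2 * (H1_norm s v)\<^sup>2 / (?N + \<alpha>) \<le> energy s \<alpha> F v - pohozaev s \<alpha> F v / (?N + \<alpha>)"
    using N\<alpha> by (subst pos_divide_le_eq) (simp_all add: mult.commute)
  thus ?thesis by simp
qed

end

section \<open>Ground states\<close>

theorem theorem1p2p2:
  fixes s \<alpha> :: real
    and F f :: "real \<Rightarrow> real"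
    and un :: "nat \<Rightarrow> real ^ 'n \<Rightarrow> real"
    and L :: "nat \<Rightarrow> (real ^ 'n \<Rightarrow> real) \<Rightarrow> real"
    and y :: "nat \<Rightarrow> real ^ 'n"
    and r :: "nat \<Rightarrow> nat"
    and u :: "real ^ 'n \<Rightarrow> real"
  assumes N: "CARD('n) \<ge> 3"
    and s: "0 < s" "s < 1"
    and \<alpha>: "0 < \<alpha>" "\<alpha> < real CARD('n)"
    and F_deriv: "\<And>t. (F has_real_derivative f t) (at t)"
    and f_cont: "continuous_on UNIV f"
    and growth: "\<exists>C>0. \<forall>t. \<bar>t * f t\<bar> \<le>
        C * (\<bar>t\<bar> powr ((real CARD('n) + \<alpha>) / real CARD('n))
             + \<bar>t\<bar> powr ((real CARD('n) + \<alpha>) / (real CARD('n) - 2)))"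
    and lim_0: "((\<lambda>t. F t / \<bar>t\<bar> powr ((real CARD('n) + \<alpha>) / real CARD('n))) \<longlongrightarrow> 0) (at 0)"
    and lim_inf: "((\<lambda>t. F t / \<bar>t\<bar> powr ((real CARD('n) + \<alpha>) / (real CARD('n) - 2))) \<longlongrightarrow> 0)
        at_infinity"
    and F_nonzero: "\<exists>t0. t0 \<noteq> 0 \<and> F t0 \<noteq> 0"
    and f_mono: "mono f"
    and f_linear: "\<exists>k>0. \<forall>t. \<bar>f t\<bar> \<le> k * \<bar>t\<bar>"
    and un_H1: "\<And>n. un n \<in> H1"
    and un_energy: "(\<lambda>n. ereal (energy s \<alpha> F (un n))) \<longlonglongrightarrow> mountain_pass_level TYPE('n) s \<alpha> F"
    and un_deriv: "\<And>n. H1_has_derivative s (energy s \<alpha> F) (un n) (L n)"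
    and un_deriv_lim: "(\<lambda>n. H1_dual_norm s (L n)) \<longlonglongrightarrow> 0"
    and un_pohozaev: "(\<lambda>n. pohozaev s \<alpha> F (un n)) \<longlonglongrightarrow> 0"
    and u_sol: "weak_solution s \<alpha> F f u"
    and u_nonzero: "\<not> (AE x in lborel. u x = 0)"
    and subseq: "strict_mono r"
    and u_limit: "H1_weakly_converges s (\<lambda>k x. un (r k) (x - y (r k))) u"
  shows "ground_state s \<alpha> F f u"
proof -
  let ?N = "real CARD('n)"
  obtain C where C: "C > 0" "\<And>t. \<bar>t * f t\<bar> \<le> C * (\<bar>t\<bar> powr ((?N + \<alpha>) / ?N) + \<bar>t\<bar> powr ((?N + \<alpha>) / (?N - 2)))"
    using growth by blast
  obtain k where k: "\<And>t. \<bar>f t\<bar> \<le> k * \<bar>t\<bar>" using f_linear by blast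
  have F0: "F 0 = 0"
  proof -
    let ?p = "(?N + \<alpha>) / ?N"
    have p: "0 < ?p" using \<alpha> N by simp
    have "((\<lambda>t::real. \<bar>t\<bar>) \<longlongrightarrow> 0) (at 0)" by (rule tendsto_rabs_zero) (rule tendsto_ident_at)
    hence "((\<lambda>t::real. \<bar>t\<bar> powr ?p) \<longlongrightarrow> 0 powr ?p) (at 0)"
      using p by (intro tendsto_powr' tendsto_const) auto
    hence "((\<lambda>t. F t / \<bar>t\<bar> powr ?p * \<bar>t\<bar> powr ?p) \<longlongrightarrow> 0 * 0) (at 0)"
      using lim_0 by (intro tendsto_mult) auto
    moreover have "\<forall>\<^sub>F t in at 0. F t / \<bar>t\<bar> powr ?p * \<bar>t\<bar> powr ?p = F t"
      by (auto simp: eventually_at_filter)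
    ultimately have "(F \<longlongrightarrow> 0) (at 0)" by (simp add: tendsto_cong)
    moreover have "(F \<longlongrightarrow> F 0) (at 0)" using DERIV_isCont[OF F_deriv[of 0]] by (simp add: isCont_def)
    ultimately show ?thesis using LIM_unique by blast
  qed
  interpret choquard_nonlinearity F f k \<alpha> C "TYPE('n)"
    by unfold_locales (use F_deriv f_mono k F0 N \<alpha> C in auto)
  \<comment> \<open>The level is finite: it is at most the energy of \<open>u\<close>, and the coercivity
      bound makes it nonnegative.\<close>
  let ?b = "mountain_pass_level TYPE('n) s \<alpha> F"
  let ?S = "nontrivial_weak_solutions s \<alpha> F f :: (real ^ 'n \<Rightarrow> real) set"
  have uS: "u \<in> ?S" using u_sol u_nonzero by (simp add: nontrivial_weak_solutions_def)
  have u: "u \<in> H1" using u_sol by (simp add: weak_solution_def)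
  have b_le: "?b \<le> ereal (energy s \<alpha> F v)" if "v \<in> ?S" for v
    by (rule mountain_pass_level_le_solution_energy[OF that])
  define c where "c = \<alpha> / (2 * (?N + \<alpha>))"
  have c: "0 < c" using \<alpha> by (simp add: c_def)
  let ?e = "\<lambda>n. energy s \<alpha> F (un n)" and ?P = "\<lambda>n. pohozaev s \<alpha> F (un n) / (?N + \<alpha>)"
  have P0: "?P \<longlonglongrightarrow> 0" using tendsto_divide[OF un_pohozaev tendsto_const[of "?N + \<alpha>"]] \<alpha> by simp
  have coercive: "c * (H1_norm s (un n))\<^sup>2 \<le> ?e n - ?P n" for n
    unfolding c_def by (rule energy_minus_pohozaev[OF s(1)])
  have "ereal 0 \<le> ?b"
  proof (rule LIMSEQ_le[OF _ un_energy])
    show "(\<lambda>n. ereal (?P n)) \<longlonglongrightarrow> ereal 0" using P0 by (rule tendsto_ereal)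
    show "\<exists>N. \<forall>n\<ge>N. ereal (?P n) \<le> ereal (?e n)"
    proof (intro exI allI impI)
      fix n
      have "0 \<le> c * (H1_norm s (un n))\<^sup>2" using c by simp
      thus "ereal (?P n) \<le> ereal (?e n)" using coercive[of n] by simp
    qed
  qed
  then obtain b where b: "?b = ereal b" using b_le[OF uS] by (cases ?b) auto
  have e_lim: "?e \<longlonglongrightarrow> b" using un_energy unfolding b by simp
  have "convergent (\<lambda>n. ?e n - ?P n)" using tendsto_diff[OF e_lim P0] by (auto simp: convergent_def)
  then obtain K where K: "\<And>n. norm (?e n - ?P n) \<le> K" using BseqE[OF convergent_imp_Bseq] by blast
  define M where "M = K / c"
  have M: "(H1_norm s (un n))\<^sup>2 \<le> M" for n
  proof -
    have "c * (H1_norm s (un n))\<^sup>2 \<le> K" using coercive[of n] K[of n] by simp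
    thus ?thesis using c by (simp add: M_def pos_le_divide_eq mult.commute)
  qed
  have L_lim: "(\<lambda>n. L n (un n)) \<longlonglongrightarrow> 0"
  proof (rule Lim_null_comparison)
    show "\<forall>\<^sub>F n in sequentially. norm (L n (un n)) \<le> \<bar>H1_dual_norm s (L n)\<bar> * sqrt M"
    proof (rule always_eventually, rule allI)
      fix n
      have "\<bar>L n (un n)\<bar> \<le> H1_dual_norm s (L n) * H1_norm s (un n)"
        using un_deriv[of n] by (intro H1_dual_norm_bound un_H1) (simp add: H1_has_derivative_def)
      also have "\<dots> \<le> \<bar>H1_dual_norm s (L n)\<bar> * sqrt M"
        using M[of n] by (intro mult_mono) (auto simp: H1_norm_nonneg real_le_rsqrt)
      finally show "norm (L n (un n)) \<le> \<bar>H1_dual_norm s (L n)\<bar> * sqrt M" by simp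
    qed
    have "(\<lambda>n. \<bar>H1_dual_norm s (L n)\<bar> * sqrt M) \<longlonglongrightarrow> \<bar>0\<bar> * sqrt M"
      by (intro tendsto_intros un_deriv_lim)
    thus "(\<lambda>n. \<bar>H1_dual_norm s (L n)\<bar> * sqrt M) \<longlonglongrightarrow> 0" by simp
  qed
  have gap_un: "pairing F gap (un n) = 2 * ?e n - L n (un n)" for n
    using derivative_along_ray[OF un_H1 un_deriv] pairing_gap[OF un_H1] choquard_term_eq[OF un_H1]
    by (simp add: energy_eq)
  have gap_u: "pairing F gap u = 2 * energy s \<alpha> F u"
    using weak_solution_Nehari[OF u_sol] pairing_gap[OF u] choquard_term_eq[OF u] by (simp add: energy_eq)
  obtain r' :: "nat \<Rightarrow> nat" where r': "strict_mono r'"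
    and conv: "AE x in lborel. (\<lambda>k. un (r (r' k)) (x - y (r (r' k)))) \<longlonglongrightarrow> u x"
    using bounded_translates_AE_subsequence[of "\<lambda>k. un (r k)" s M "\<lambda>k. y (r k)" u, OF un_H1 M u_limit] by auto
  have "(\<lambda>n. 2 * ?e n - L n (un n)) \<longlonglongrightarrow> 2 * b - 0" by (intro tendsto_intros e_lim L_lim)
  hence "(\<lambda>n. pairing F gap (un n)) \<longlonglongrightarrow> 2 * b" by (simp add: gap_un)
  hence "((\<lambda>n. pairing F gap (un n)) \<circ> (r \<circ> r')) \<longlonglongrightarrow> 2 * b"
    by (rule LIMSEQ_subseq_LIMSEQ) (intro strict_mono_o subseq r')
  hence "(\<lambda>k. ennreal (pairing F gap (un (r (r' k))))) \<longlonglongrightarrow> ennreal (2 * b)"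
    by (intro tendsto_ennrealI) (simp add: o_def)
  hence "liminf (\<lambda>k. ennreal (pairing F gap (un (r (r' k))))) = ennreal (2 * b)"
    by (intro lim_imp_Liminf) simp_all
  hence "ennreal (pairing F gap u) \<le> ennreal (2 * b)"
    using pairing_gap_Fatou[of "\<lambda>k. un (r (r' k))" u "\<lambda>k. y (r (r' k))", OF f_cont un_H1 u conv] by simp
  moreover have "0 \<le> b" using \<open>ereal 0 \<le> ?b\<close> b by simp
  ultimately have "energy s \<alpha> F u \<le> b" by (simp add: gap_u ennreal_le_iff)
  hence min: "ereal (energy s \<alpha> F u) \<le> ereal (energy s \<alpha> F v)" if "v \<in> ?S" for v
    using b_le[OF that] b by (auto intro: order_trans)
  have "ereal (energy s \<alpha> F u) = (INF v\<in>?S. ereal (energy s \<alpha> F v))"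
    by (intro antisym INF_greatest INF_lower uS min)
  thus ?thesis using uS by (simp add: ground_state_def)
qed

end
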